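(* Let $Y$ be a finite-dimensional $\mathbb C(q)$-vector space and let $\Psi:Y\otimes Y\to Y\otimes Y$ be an invertible $\mathbb C(q)$-linear map satisfying the braid equation $(\Psi\otimes1)(1\otimes\Psi)(\Psi\otimes1)=(1\otimes\Psi)(\Psi\otimes1)(1\otimes\Psi)$ on $Y^{\otimes3}$. Assume that: (i) the specialization $\Psi|_{q=1}$ of $\Psi$ (with respect to some basis of $Y$) is the permutation of factors $\tau:Y\otimes Y\to Y\otimes Y$; (ii) $\dim(\Psi-1)(Y\otimes Y)=\dim\Lambda^2Y$. Then the algebra $S_\Psi(Y)=T(Y)/\langle(\Psi-1)(Y\otimes Y)\rangle$ is a flat deformation of the symmetric algebra $S(Y)$ (hence $S_\Psi(Y)$ is PBW for any ordered basis of $Y$).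
   Context: The specialization of $\Psi$ at $q=1$ with respect to a basis $B$ of $Y$ is well defined if all matrix entries of $\Psi$ in the basis $\{b\otimes b'\}_{b,b'\in B}$ of $Y\otimes Y$ are rational functions of $q$ regular at $q=1$; it is then the linear map whose matrix is obtained by evaluating the entries at $q=1$. $T(Y)$ is the tensor algebra. "Flat deformation of $S(Y)$" means that each graded component $S_\Psi(Y)_k$ has the same dimension as $S^k(Y)$ (the defining relations specializing at $q=1$ to those of $S(Y)$). An algebra generated by a totally ordered set $X$ is PBW with respect to $X$ if the ordered monomials in $X$ form a basis of it.
   Formalization: The PBW claim is proved for every ordered basis of Y with respect to which Ψ specializes at q=1 to τ, not for any ordered basis: for the quantum plane xy=qyx, the ordered monomials in a=x+y, b=x+q^{-1}y satisfy q^{-1}aa-(q^{-1}+1)ab+bb=0. *)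

theory Defs
  imports
    "HOL-Library.Poly_Mapping"
    "HOL-Computational_Algebra.Polynomial"
    "HOL-Computational_Algebra.Fraction_Field"
begin

section \<open>The field of rational functions in \<open>q\<close> and evaluation at \<open>q = 1\<close>\<close>

type_synonym cq = "complex poly fract"

definition regular_at_1 :: "cq \<Rightarrow> bool" where
  "regular_at_1 f \<longleftrightarrow> (\<exists>p d. poly d 1 \<noteq> 0 \<and> f = Fract p d)"

definition value_at_1 :: "cq \<Rightarrow> complex" where
  "value_at_1 f = (THE z. \<exists>p d. poly d 1 \<noteq> 0 \<and> f = Fract p d \<and> z = poly p 1 / poly d 1)"

lemma value_at_1_Fract:
  assumes "poly d 1 \<noteq> 0"
  shows "value_at_1 (Fract p d) = poly p 1 / poly d 1"
  unfolding value_at_1_def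
proof (rule the_equality)
  show "\<exists>p' d'. poly d' 1 \<noteq> 0 \<and> Fract p d = Fract p' d' \<and> poly p 1 / poly d 1 = poly p' 1 / poly d' 1"
    using assms by blast
next
  fix z
  assume "\<exists>p' d'. poly d' 1 \<noteq> 0 \<and> Fract p d = Fract p' d' \<and> z = poly p' 1 / poly d' 1"
  then obtain p' d' where *: "poly d' 1 \<noteq> 0" "Fract p d = Fract p' d'" "z = poly p' 1 / poly d' 1"
    by blast
  have "d \<noteq> 0" "d' \<noteq> 0" using assms *(1) by auto
  then have "p * d' = p' * d" using *(2) by (simp add: eq_fract)
  then have "poly p 1 * poly d' 1 = poly p' 1 * poly d 1" by (metis poly_mult)
  then show "z = poly p 1 / poly d 1"
    unfolding *(3) using assms *(1) by (simp add: frac_eq_eq)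
qed


section \<open>Vector spaces over \<open>\<complex>(q)\<close>\<close>

class cq_vector_space = ab_group_add +
  fixes scaleq :: "cq \<Rightarrow> 'a \<Rightarrow> 'a"  (infixr \<open>*\<^sub>q\<close> 75)
  assumes scaleq_add_right: "a *\<^sub>q (x + y) = a *\<^sub>q x + a *\<^sub>q y"
    and scaleq_add_left: "(a + b) *\<^sub>q x = a *\<^sub>q x + b *\<^sub>q x"
    and scaleq_scaleq: "a *\<^sub>q (b *\<^sub>q x) = (a * b) *\<^sub>q x"
    and scaleq_one: "1 *\<^sub>q x = x"

global_interpretation qv: vector_space "scaleq :: cq \<Rightarrow> 'a \<Rightarrow> 'a::cq_vector_space"
  by unfold_locales (rule scaleq_add_right scaleq_add_left scaleq_scaleq scaleq_one)+

definition is_basis :: "'a::cq_vector_space set \<Rightarrow> bool" where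
  "is_basis B \<longleftrightarrow> qv.independent B \<and> qv.span B = UNIV"

definition linear_map_on :: "'a::cq_vector_space set \<Rightarrow> ('a \<Rightarrow> 'b::cq_vector_space) \<Rightarrow> bool" where
  "linear_map_on V F \<longleftrightarrow>
     (\<forall>x\<in>V. \<forall>y\<in>V. F (x + y) = F x + F y) \<and> (\<forall>c. \<forall>x\<in>V. F (c *\<^sub>q x) = c *\<^sub>q F x)"

text \<open>For subspaces \<open>V\<close> and \<open>W\<close>: the classes modulo \<open>W\<close> of the elements \<open>e j\<close>, \<open>j \<in> J\<close>, form a
  basis (indexed by \<open>J\<close>, hence without repetitions) of the image \<open>(V + W)/W\<close> of \<open>V\<close>.\<close>

definition basis_modulo :: "'a::cq_vector_space set \<Rightarrow> 'a set \<Rightarrow> 'j set \<Rightarrow> ('j \<Rightarrow> 'a) \<Rightarrow> bool" where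
  "basis_modulo W V J e \<longleftrightarrow>
     (\<forall>j\<in>J. e j \<in> V) \<and>
     (\<forall>v\<in>V. \<exists>!c :: 'j \<Rightarrow> cq.
        finite {j. c j \<noteq> 0} \<and> {j. c j \<noteq> 0} \<subseteq> J \<and> v - (\<Sum>j | c j \<noteq> 0. c j *\<^sub>q e j) \<in> W)"

definition quotient_has_dim :: "'a::cq_vector_space set \<Rightarrow> 'a set \<Rightarrow> nat \<Rightarrow> bool" where
  "quotient_has_dim W V d \<longleftrightarrow> (\<exists>e. basis_modulo W V {..<d} e)"


section \<open>The tensor algebra\<close>

definition two_sided_ideal :: "'a::ring_1 set \<Rightarrow> bool" where
  "two_sided_ideal I \<longleftrightarrow>
     0 \<in> I \<and> (\<forall>x\<in>I. \<forall>y\<in>I. x + y \<in> I) \<and> (\<forall>a. \<forall>x\<in>I. a * x \<in> I \<and> x * a \<in> I)"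

abbreviation ideal_generated :: "'a::ring_1 set \<Rightarrow> 'a set" where
  "ideal_generated S \<equiv> two_sided_ideal hull S"

lemma two_sided_ideal_hull: "two_sided_ideal (ideal_generated S)"
  by (rule hull_in) (auto simp: two_sided_ideal_def)

lemma two_sided_ideal_uminus: "two_sided_ideal I \<Longrightarrow> x \<in> I \<Longrightarrow> - x \<in> I"
proof -
  assume "two_sided_ideal I" "x \<in> I"
  then have "(- 1) * x \<in> I" unfolding two_sided_ideal_def by blast
  then show "- x \<in> I" by simp
qed

lemma two_sided_ideal_diff: "two_sided_ideal I \<Longrightarrow> x \<in> I \<Longrightarrow> y \<in> I \<Longrightarrow> x - y \<in> I"
proof -
  assume *: "two_sided_ideal I" "x \<in> I" "y \<in> I"
  then have "x + - y \<in> I"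
    using two_sided_ideal_uminus[of I y] unfolding two_sided_ideal_def by blast
  then show "x - y \<in> I" by simp
qed

text \<open>\<open>T(Y)\<close> is the free \<open>\<complex>(q)\<close>-algebra on the set \<open>Y\<close> (the monoid algebra of the free monoid)
  modulo the relations saying that the inclusion of generators is \<open>\<complex>(q)\<close>-linear.\<close>

datatype 'a fword = Word "'a list"

instantiation fword :: (type) monoid_add
begin
definition zero_fword :: "'a fword" where "0 = Word []"
fun plus_fword :: "'a fword \<Rightarrow> 'a fword \<Rightarrow> 'a fword" where "Word u + Word v = Word (u @ v)"
instance
proof
  fix a b c :: "'a fword"
  show "a + b + c = a + (b + c)" by (cases a; cases b; cases c) simp
  show "0 + a = a" "a + 0 = a" by (cases a; simp add: zero_fword_def)+
qed
end

abbreviation free_gen :: "'y \<Rightarrow> 'y fword \<Rightarrow>\<^sub>0 cq" where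
  "free_gen y \<equiv> Poly_Mapping.single (Word [y]) 1"

abbreviation free_const :: "cq \<Rightarrow> 'y fword \<Rightarrow>\<^sub>0 cq" where
  "free_const c \<equiv> Poly_Mapping.single 0 c"

definition linearity_ideal :: "('y::cq_vector_space fword \<Rightarrow>\<^sub>0 cq) set" where
  "linearity_ideal = ideal_generated
     ({free_gen (v + w) - free_gen v - free_gen w | v w. True} \<union>
      {free_gen (c *\<^sub>q v) - free_const c * free_gen v | c v. True})"

lemma linearity_ideal_ideal: "two_sided_ideal linearity_ideal"
  unfolding linearity_ideal_def by (rule two_sided_ideal_hull)

lemma linearity_ideal_zero: "0 \<in> linearity_ideal"
  using linearity_ideal_ideal unfolding two_sided_ideal_def by blast

lemma lookup_const_mult:
  fixes k :: "'a fword"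
  shows "Poly_Mapping.lookup (free_const c * x) k = c * Poly_Mapping.lookup x k"
proof -
  have "Poly_Mapping.lookup (free_const c * x) k =
      (\<Sum>l. (c * (\<Sum>q. Poly_Mapping.lookup x q when k = q)) when l = (0 :: 'a fword))"
    unfolding lookup_mult by (rule Sum_any.cong) (auto simp: lookup_single when_def)
  then show ?thesis by simp
qed

lemma lookup_mult_const:
  fixes k :: "'a fword"
  shows "Poly_Mapping.lookup (x * free_const c) k = Poly_Mapping.lookup x k * c"
proof -
  have "(\<Sum>q. Poly_Mapping.lookup (free_const c) q when k = l + q) = (c when l = k)"
    for l :: "'a fword"
  proof -
    have "(\<Sum>q. Poly_Mapping.lookup (free_const c) q when k = l + q) =
        (\<Sum>q. (c when l = k) when q = (0 :: 'a fword))"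
      by (rule Sum_any.cong) (auto simp: lookup_single when_def)
    then show ?thesis by simp
  qed
  then have "Poly_Mapping.lookup (x * free_const c) k =
      (\<Sum>l. (Poly_Mapping.lookup x l * c) when l = k)"
    unfolding lookup_mult by (intro Sum_any.cong) (simp add: when_def)
  then show ?thesis by simp
qed

lemma free_const_commute: "free_const c * x = x * free_const c"
  by (rule poly_mapping_eqI) (simp add: lookup_const_mult lookup_mult_const mult.commute)

lemma fword_add_eq_0_iff: "(u :: 'a fword) + v = 0 \<longleftrightarrow> u = 0 \<and> v = 0"
  by (cases u; cases v) (simp add: zero_fword_def)

lemma lookup_mult_0:
  "Poly_Mapping.lookup (a * b) (0 :: 'a fword) = Poly_Mapping.lookup a 0 * Poly_Mapping.lookup b 0"
proof -
  have "(\<Sum>q. Poly_Mapping.lookup b q when 0 = l + q) = (Poly_Mapping.lookup b 0 when l = 0)"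
    for l :: "'a fword"
  proof -
    have "(\<Sum>q. Poly_Mapping.lookup b q when 0 = l + q) =
        (\<Sum>q. (Poly_Mapping.lookup b q when l = 0) when q = 0)"
    proof (rule Sum_any.cong)
      fix q :: "'a fword"
      show "(Poly_Mapping.lookup b q when 0 = l + q) =
          ((Poly_Mapping.lookup b q when l = 0) when q = 0)"
        using fword_add_eq_0_iff[of l q] by (auto simp: when_def)
    qed
    then show ?thesis by simp
  qed
  then have "Poly_Mapping.lookup (a * b) (0 :: 'a fword) =
      (\<Sum>l. (Poly_Mapping.lookup a l * Poly_Mapping.lookup b 0) when l = 0)"
    unfolding lookup_mult by (intro Sum_any.cong) (simp add: when_def)
  then show ?thesis by simp
qed

lemma one_notin_linearity_ideal: "1 \<notin> (linearity_ideal :: ('y::cq_vector_space fword \<Rightarrow>\<^sub>0 cq) set)"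
proof -
  let ?A = "{a :: 'y fword \<Rightarrow>\<^sub>0 cq. Poly_Mapping.lookup a 0 = 0}"
  have "two_sided_ideal ?A"
    by (simp add: two_sided_ideal_def lookup_mult_0 lookup_add)
  moreover have "Poly_Mapping.lookup (free_gen y :: 'y fword \<Rightarrow>\<^sub>0 cq) 0 = 0" for y :: 'y
    by (simp add: lookup_single zero_fword_def)
  ultimately have "linearity_ideal \<subseteq> ?A"
    unfolding linearity_ideal_def by (intro hull_minimal) (auto simp: lookup_minus lookup_mult_0)
  then show ?thesis by (auto simp: lookup_one)
qed

quotient_type (overloaded) 'y tensor_algebra = "'y::cq_vector_space fword \<Rightarrow>\<^sub>0 cq" /
  "\<lambda>a b. a - b \<in> linearity_ideal"
proof (rule equivpI)
  show "reflp (\<lambda>a b :: 'y fword \<Rightarrow>\<^sub>0 cq. a - b \<in> linearity_ideal)"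
    by (simp add: reflp_def linearity_ideal_zero)
  show "symp (\<lambda>a b :: 'y fword \<Rightarrow>\<^sub>0 cq. a - b \<in> linearity_ideal)"
  proof (rule sympI)
    fix a b :: "'y fword \<Rightarrow>\<^sub>0 cq"
    assume "a - b \<in> linearity_ideal"
    from two_sided_ideal_uminus[OF linearity_ideal_ideal this]
    show "b - a \<in> linearity_ideal" by simp
  qed
  show "transp (\<lambda>a b :: 'y fword \<Rightarrow>\<^sub>0 cq. a - b \<in> linearity_ideal)"
  proof (rule transpI)
    fix a b c :: "'y fword \<Rightarrow>\<^sub>0 cq"
    assume "a - b \<in> linearity_ideal" "b - c \<in> linearity_ideal"
    then have "(a - b) + (b - c) \<in> linearity_ideal"
      using linearity_ideal_ideal unfolding two_sided_ideal_def by blast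
    then show "a - c \<in> linearity_ideal" by simp
  qed
qed

instantiation tensor_algebra :: (cq_vector_space) "{ring_1, cq_vector_space}"
begin

lift_definition zero_tensor_algebra :: "'a tensor_algebra" is 0 .
lift_definition one_tensor_algebra :: "'a tensor_algebra" is 1 .
lift_definition plus_tensor_algebra :: "'a tensor_algebra \<Rightarrow> 'a tensor_algebra \<Rightarrow> 'a tensor_algebra"
  is "(+)"
proof -
  fix a b c d :: "'a fword \<Rightarrow>\<^sub>0 cq"
  assume "a - b \<in> linearity_ideal" "c - d \<in> linearity_ideal"
  then have "(a - b) + (c - d) \<in> linearity_ideal"
    using linearity_ideal_ideal unfolding two_sided_ideal_def by blast
  then show "a + c - (b + d) \<in> linearity_ideal" by (simp add: algebra_simps)
qed
lift_definition minus_tensor_algebra :: "'a tensor_algebra \<Rightarrow> 'a tensor_algebra \<Rightarrow> 'a tensor_algebra"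
  is "(-)"
proof -
  fix a b c d :: "'a fword \<Rightarrow>\<^sub>0 cq"
  assume "a - b \<in> linearity_ideal" "c - d \<in> linearity_ideal"
  then have "(a - b) - (c - d) \<in> linearity_ideal"
    by (rule two_sided_ideal_diff[OF linearity_ideal_ideal])
  then show "a - c - (b - d) \<in> linearity_ideal" by (simp add: algebra_simps)
qed
lift_definition uminus_tensor_algebra :: "'a tensor_algebra \<Rightarrow> 'a tensor_algebra" is "uminus"
proof -
  fix a b :: "'a fword \<Rightarrow>\<^sub>0 cq"
  assume "a - b \<in> linearity_ideal"
  then have "- (a - b) \<in> linearity_ideal"
    by (rule two_sided_ideal_uminus[OF linearity_ideal_ideal])
  then show "- a - - b \<in> linearity_ideal" by simp
qed
lift_definition times_tensor_algebra :: "'a tensor_algebra \<Rightarrow> 'a tensor_algebra \<Rightarrow> 'a tensor_algebra"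
  is "(*)"
proof -
  fix a b c d :: "'a fword \<Rightarrow>\<^sub>0 cq"
  assume "a - b \<in> linearity_ideal" "c - d \<in> linearity_ideal"
  then have "(a - b) * c + b * (c - d) \<in> linearity_ideal"
    using linearity_ideal_ideal unfolding two_sided_ideal_def by blast
  then show "a * c - b * d \<in> linearity_ideal" by (simp add: algebra_simps)
qed
lift_definition scaleq_tensor_algebra :: "cq \<Rightarrow> 'a tensor_algebra \<Rightarrow> 'a tensor_algebra"
  is "\<lambda>c x. free_const c * x"
proof -
  fix r and a b :: "'a fword \<Rightarrow>\<^sub>0 cq"
  assume "a - b \<in> linearity_ideal"
  then have "free_const r * (a - b) \<in> linearity_ideal"
    using linearity_ideal_ideal unfolding two_sided_ideal_def by blast
  then show "free_const r * a - free_const r * b \<in> linearity_ideal"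
    by (simp add: right_diff_distrib)
qed

instance
proof
  note 0 = linearity_ideal_zero
  fix a b c :: "'a tensor_algebra" and r s :: cq
  show "a + b + c = a + (b + c)" by transfer (simp add: 0 algebra_simps)
  show "a + b = b + a" by transfer (simp add: 0 algebra_simps)
  show "0 + a = a" by transfer (simp add: 0)
  show "- a + a = 0" by transfer (simp add: 0)
  show "a - b = a + - b" by transfer (simp add: 0)
  show "a * b * c = a * (b * c)" by transfer (simp add: 0 mult.assoc)
  show "(a + b) * c = a * c + b * c" by transfer (simp add: 0 algebra_simps)
  show "a * (b + c) = a * b + a * c" by transfer (simp add: 0 algebra_simps)
  show "1 * a = a" by transfer (simp add: 0)
  show "a * 1 = a" by transfer (simp add: 0)
  show "(0 :: 'a tensor_algebra) \<noteq> 1"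
  proof (transfer, rule notI)
    assume "0 - 1 \<in> (linearity_ideal :: ('a fword \<Rightarrow>\<^sub>0 cq) set)"
    from two_sided_ideal_uminus[OF linearity_ideal_ideal this] show False
      by (simp add: one_notin_linearity_ideal)
  qed
  show "r *\<^sub>q (a + b) = r *\<^sub>q a + r *\<^sub>q b" by transfer (simp add: 0 algebra_simps)
  show "(r + s) *\<^sub>q a = r *\<^sub>q a + s *\<^sub>q a" by transfer (simp add: 0 single_add distrib_right)
  show "r *\<^sub>q (s *\<^sub>q a) = (r * s) *\<^sub>q a" by transfer (simp add: 0 mult_single mult.assoc[symmetric])
  show "1 *\<^sub>q a = a" by transfer (simp add: 0)
qed

end

lift_definition gen :: "'y::cq_vector_space \<Rightarrow> 'y tensor_algebra" is free_gen .

lemma gen_add: "gen (v + w) = gen v + gen w"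
proof transfer
  fix v w :: 'a
  have "free_gen (v + w) - free_gen v - free_gen w \<in> linearity_ideal"
    unfolding linearity_ideal_def by (rule hull_inc) blast
  then show "free_gen (v + w) - (free_gen v + free_gen w) \<in> linearity_ideal"
    by (simp add: algebra_simps)
qed

lemma gen_scaleq: "gen (c *\<^sub>q v) = c *\<^sub>q gen v"
proof transfer
  fix c and v :: 'a
  show "free_gen (c *\<^sub>q v) - free_const c * free_gen v \<in> linearity_ideal"
    unfolding linearity_ideal_def by (rule hull_inc) blast
qed

lemma scaleq_mult_left: "(c *\<^sub>q x) * y = c *\<^sub>q (x * y)" for x y :: "'y::cq_vector_space tensor_algebra"
proof transfer
  fix c and x y :: "'y fword \<Rightarrow>\<^sub>0 cq"
  show "free_const c * x * y - free_const c * (x * y) \<in> linearity_ideal"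
    using linearity_ideal_zero by (simp add: mult.assoc)
qed

lemma scaleq_mult_right: "x * (c *\<^sub>q y) = c *\<^sub>q (x * y)" for x y :: "'y::cq_vector_space tensor_algebra"
proof transfer
  fix c and x y :: "'y fword \<Rightarrow>\<^sub>0 cq"
  have "x * (free_const c * y) = free_const c * (x * y)"
    by (simp only: mult.assoc[symmetric] free_const_commute[symmetric])
  then show "x * (free_const c * y) - free_const c * (x * y) \<in> linearity_ideal"
    using linearity_ideal_zero by simp
qed

abbreviation monomial :: "'y::cq_vector_space list \<Rightarrow> 'y tensor_algebra" where
  "monomial ys \<equiv> prod_list (map gen ys)"

text \<open>The \<open>k\<close>-th tensor power of \<open>Y\<close> is the degree \<open>k\<close> component of \<open>T(Y)\<close>; a tensor product of
  vectors is their product in \<open>T(Y)\<close>. In particular a map \<open>\<Psi>\<close> on \<open>Y \<otimes> Y\<close> is a map on \<open>tpow 2\<close>.\<close>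

definition tpow :: "nat \<Rightarrow> 'y::cq_vector_space tensor_algebra set" where
  "tpow k = qv.span {monomial ys | ys. length ys = k}"


section \<open>The braid equation\<close>

text \<open>\<open>F\<close> is \<open>\<Psi> \<otimes> 1\<close>, respectively \<open>1 \<otimes> \<Psi>\<close>, on the third tensor power. By multilinearity such an
  \<open>F\<close> exists for every linear \<open>\<Psi>\<close>, and it is unique there.\<close>

definition acts_on_12 ::
  "('y::cq_vector_space tensor_algebra \<Rightarrow> 'y tensor_algebra) \<Rightarrow>
   ('y tensor_algebra \<Rightarrow> 'y tensor_algebra) \<Rightarrow> bool" where
  "acts_on_12 \<Psi> F \<longleftrightarrow> linear_map_on (tpow 3) F \<and> (\<forall>t\<in>tpow 2. \<forall>y. F (t * gen y) = \<Psi> t * gen y)"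

definition acts_on_23 ::
  "('y::cq_vector_space tensor_algebra \<Rightarrow> 'y tensor_algebra) \<Rightarrow>
   ('y tensor_algebra \<Rightarrow> 'y tensor_algebra) \<Rightarrow> bool" where
  "acts_on_23 \<Psi> F \<longleftrightarrow> linear_map_on (tpow 3) F \<and> (\<forall>t\<in>tpow 2. \<forall>y. F (gen y * t) = gen y * \<Psi> t)"

definition braid_equation ::
  "('y::cq_vector_space tensor_algebra \<Rightarrow> 'y tensor_algebra) \<Rightarrow> bool" where
  "braid_equation \<Psi> \<longleftrightarrow>
     (\<exists>F G. acts_on_12 \<Psi> F \<and> acts_on_23 \<Psi> G \<and> (\<forall>t\<in>tpow 3. F (G (F t)) = G (F (G t))))"


section \<open>Specialization at \<open>q = 1\<close>\<close>

text \<open>Coordinates with respect to the basis \<open>{b \<otimes> b'}\<close> of \<open>Y \<otimes> Y\<close>.\<close>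

definition tensor_coeff ::
  "'y::cq_vector_space set \<Rightarrow> 'y tensor_algebra \<Rightarrow> 'y \<times> 'y \<Rightarrow> cq" where
  "tensor_coeff B t p =
     qv.representation ((\<lambda>(b, b'). gen b * gen b') ` (B \<times> B)) t (gen (fst p) * gen (snd p))"

definition specializable ::
  "'y::cq_vector_space set \<Rightarrow> ('y tensor_algebra \<Rightarrow> 'y tensor_algebra) \<Rightarrow> bool" where
  "specializable B \<Psi> \<longleftrightarrow>
     (\<forall>b\<in>B. \<forall>b'\<in>B. \<forall>c\<in>B. \<forall>c'\<in>B. regular_at_1 (tensor_coeff B (\<Psi> (gen b * gen b')) (c, c')))"

text \<open>The matrix of \<open>\<Psi>|\<^bsub>q=1\<^esub>\<close>: the entry in row \<open>(c, c')\<close> and column \<open>(b, b')\<close>. The permutation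
  of factors \<open>\<tau>\<close> sends \<open>b \<otimes> b'\<close> to \<open>b' \<otimes> b\<close>.\<close>

definition specialization ::
  "'y::cq_vector_space set \<Rightarrow> ('y tensor_algebra \<Rightarrow> 'y tensor_algebra) \<Rightarrow>
   'y \<times> 'y \<Rightarrow> 'y \<times> 'y \<Rightarrow> complex" where
  "specialization B \<Psi> = (\<lambda>(c, c') (b, b'). value_at_1 (tensor_coeff B (\<Psi> (gen b * gen b')) (c, c')))"

definition specializes_to_flip ::
  "'y::cq_vector_space set \<Rightarrow> ('y tensor_algebra \<Rightarrow> 'y tensor_algebra) \<Rightarrow> bool" where
  "specializes_to_flip B \<Psi> \<longleftrightarrow> specializable B \<Psi> \<and>
     (\<forall>b\<in>B. \<forall>b'\<in>B. \<forall>c\<in>B. \<forall>c'\<in>B.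
        specialization B \<Psi> (c, c') (b, b') = (if (c, c') = (b', b) then 1 else 0))"


section \<open>Braided symmetric algebras, flatness and the PBW property\<close>

abbreviation relations ::
  "('y::cq_vector_space tensor_algebra \<Rightarrow> 'y tensor_algebra) \<Rightarrow> 'y tensor_algebra set" where
  "relations \<Psi> \<equiv> (\<lambda>t. \<Psi> t - t) ` tpow 2"

text \<open>\<open>S\<^sub>\<Psi>(Y)\<close> is \<open>T(Y)\<close> modulo \<open>braided_ideal \<Psi>\<close>, and \<open>S(Y)\<close> is \<open>T(Y)\<close> modulo \<open>symmetric_ideal\<close>;
  their degree \<open>k\<close> components are the images of \<open>tpow k\<close>.\<close>

definition braided_ideal ::
  "('y::cq_vector_space tensor_algebra \<Rightarrow> 'y tensor_algebra) \<Rightarrow> 'y tensor_algebra set" where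
  "braided_ideal \<Psi> = ideal_generated (relations \<Psi>)"

definition symmetric_ideal :: "'y::cq_vector_space tensor_algebra set" where
  "symmetric_ideal = ideal_generated {gen x * gen y - gen y * gen x | x y. True}"

text \<open>\<open>\<Lambda>\<^sup>2 Y\<close> is \<open>Y \<otimes> Y\<close> modulo this subspace.\<close>

definition exterior_square_kernel :: "'y::cq_vector_space tensor_algebra set" where
  "exterior_square_kernel = qv.span {gen y * gen y | y. True}"

text \<open>The evaluations at \<open>q = 1\<close> of the defining relations with regular coefficients are exactly
  the tensors \<open>\<tau> g - g\<close>, i.e. the defining relations of the symmetric algebra over \<open>\<complex>\<close>
  of the span of \<open>B\<close>. Tensors over \<open>\<complex>\<close> are functions on \<open>B \<times> B\<close>, extended by \<open>0\<close>.\<close>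

definition relations_specialize ::
  "'y::cq_vector_space set \<Rightarrow> ('y tensor_algebra \<Rightarrow> 'y tensor_algebra) \<Rightarrow> bool" where
  "relations_specialize B \<Psi> \<longleftrightarrow>
     {(\<lambda>p. if p \<in> B \<times> B then value_at_1 (tensor_coeff B r p) else 0) | r.
        r \<in> relations \<Psi> \<and> (\<forall>p\<in>B \<times> B. regular_at_1 (tensor_coeff B r p))} =
     {(\<lambda>(c, c'). if (c, c') \<in> B \<times> B then g (c', c) - g (c, c') else 0) | g :: 'y \<times> 'y \<Rightarrow> complex. True}"

definition flat_deformation ::
  "'y::cq_vector_space set \<Rightarrow> ('y tensor_algebra \<Rightarrow> 'y tensor_algebra) \<Rightarrow> bool" where
  "flat_deformation B \<Psi> \<longleftrightarrow>
     relations_specialize B \<Psi> \<and>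
     (\<forall>k. \<exists>d. quotient_has_dim (braided_ideal \<Psi>) (tpow k) d \<and>
              quotient_has_dim symmetric_ideal (tpow k :: 'y tensor_algebra set) d)"

text \<open>\<open>T(Y)/I\<close> is PBW with respect to the set \<open>B\<close> ordered by \<open>r\<close>: the classes of the ordered
  monomials \<open>b\<^sub>1 \<cdots> b\<^sub>k\<close>, \<open>b\<^sub>1 \<le> \<dots> \<le> b\<^sub>k\<close>, form a basis.

  For \<open>S\<^sub>\<Psi>(Y)\<close> this depends on \<open>B\<close>: it can fail for a basis of \<open>Y\<close> in which \<open>\<Psi>\<close> does not specialize
  to the flip. With \<open>Y\<close> spanned by \<open>x, y\<close> and \<open>S\<^sub>\<Psi>(Y)\<close> the quantum plane \<open>x y = q y x\<close>, the ordered basis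
  \<open>a = x + y\<close>, \<open>b = x + q\<^sup>-\<^sup>1 y\<close> satisfies \<open>q\<^sup>-\<^sup>1 a a - (q\<^sup>-\<^sup>1 + 1) a b + b b = 0\<close>.\<close>

definition pbw :: "'y::cq_vector_space tensor_algebra set \<Rightarrow> 'y set \<Rightarrow> ('y \<times> 'y) set \<Rightarrow> bool" where
  "pbw I B r \<longleftrightarrow>
     basis_modulo I UNIV {ys. set ys \<subseteq> B \<and> sorted_wrt (\<lambda>x y. (x, y) \<in> r) ys} monomial"

end

(*
  Let R be the local ring of rational functions regular at q = 1 and h = q - 1. Over R, Psi at the
  positions i, i + 1 is an operator A_i on the lattice spanned by the words in B, and modulo h it is
  the adjacent transposition s_i.

  Spanning by sorted words is Nakayama's lemma. Independence amounts to the lattice modulo the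
  relations (A_i - 1) x having no h-torsion, i.e. to lifting every syzygy between the s_i - 1 to one
  between the A_i - 1. These syzygies are generated by three kinds: commutation of distant positions
  (which lifts trivially), the hexagon s_i s_j s_i = s_j s_i s_j (which lifts by the braid
  equation), and (s_i - 1)(s_i + 1) = 0 (which lifts because the dimension hypothesis makes every
  symmetric tensor liftable to a fixed vector of Psi). That they generate is the diamond argument for
  sorting by adjacent transpositions. S(Y) itself is the case where Psi is the flip.
*)

theory Submission
  imports Defs
begin

section \<open>The local ring of rational functions regular at \<open>q = 1\<close>\<close>

text \<open>Write L for the lattice. What decides independence is the inclusion of
  \<open>rspan rels\<close> \<inter> h L in h \<open>rspan rels\<close>: a combination of relations
  that vanishes at q = 1 must be rewritten with every coefficient divisible by h. The rewriting is
  done by \<open>path\<close>, the sum of the relations met while sorting a word. Modulo h it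
  depends on the word alone, so each relation is recovered from its own value s_i w - w at q = 1 as
  a difference of two paths.

  The delicate place is a pair of equal letters. There s_i w = w, the relation itself vanishes at q
  = 1, and sorting never passes through it. The fixed vectors of \<Psi> enter here: the one that
  lifts 2 x x bounds twice the relation, and 2 is invertible. They exist because the relations of
  the pairs x < y remain independent at q = 1, while their number, dim \<Lambda>^2 Y, leaves no room
  for further relations.\<close>

definition qm1 :: cq where "qm1 = Fract [:-1, 1:] 1"

definition cconst :: "complex \<Rightarrow> cq" where "cconst z = Fract [:z:] 1"

lemma regular_at_1I: "poly d 1 \<noteq> 0 \<Longrightarrow> regular_at_1 (Fract p d)"
  unfolding regular_at_1_def by blast

lemma regular_at_1E:
  assumes "regular_at_1 f"
  obtains p d where "poly d 1 \<noteq> 0" "d \<noteq> 0" "f = Fract p d"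
  using assms unfolding regular_at_1_def by (metis poly_0)

lemma regular_0 [simp]: "regular_at_1 0"
  unfolding Zero_fract_def by (rule regular_at_1I) simp

lemma regular_1 [simp]: "regular_at_1 1"
  unfolding One_fract_def by (rule regular_at_1I) simp

lemma regular_qm1 [simp]: "regular_at_1 qm1"
  unfolding qm1_def by (rule regular_at_1I) simp

lemma regular_cconst [simp]: "regular_at_1 (cconst z)"
  unfolding cconst_def by (rule regular_at_1I) simp

lemma
  assumes "regular_at_1 f" "regular_at_1 g"
  shows regular_add: "regular_at_1 (f + g)"
    and value_at_1_add: "value_at_1 (f + g) = value_at_1 f + value_at_1 g"
    and regular_mult: "regular_at_1 (f * g)"
    and value_at_1_mult: "value_at_1 (f * g) = value_at_1 f * value_at_1 g"
proof -
  obtain p d where f: "poly d 1 \<noteq> 0" "d \<noteq> 0" "f = Fract p d" using assms(1) by (rule regular_at_1E)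
  obtain p' d' where g: "poly d' 1 \<noteq> 0" "d' \<noteq> 0" "g = Fract p' d'" using assms(2) by (rule regular_at_1E)
  have s: "f + g = Fract (p * d' + p' * d) (d * d')" and m: "f * g = Fract (p * p') (d * d')"
    using f g by simp_all
  have d: "poly (d * d') 1 \<noteq> 0" using f g by simp
  show "regular_at_1 (f + g)" "regular_at_1 (f * g)" unfolding s m by (rule regular_at_1I[OF d])+
  show "value_at_1 (f + g) = value_at_1 f + value_at_1 g"
    unfolding s value_at_1_Fract[OF d] unfolding f(3) g(3)
    using f g by (simp add: value_at_1_Fract field_simps)
  show "value_at_1 (f * g) = value_at_1 f * value_at_1 g"
    unfolding m value_at_1_Fract[OF d] unfolding f(3) g(3)
    using f g by (simp add: value_at_1_Fract)
qed

lemma value_at_1_cconst [simp]: "value_at_1 (cconst z) = z"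
  unfolding cconst_def by (simp add: value_at_1_Fract)

lemma cconst_0 [simp]: "cconst 0 = 0" and cconst_1 [simp]: "cconst 1 = 1"
  by (simp_all add: cconst_def Zero_fract_def One_fract_def one_pCons)

lemma value_at_1_0 [simp]: "value_at_1 0 = 0" and value_at_1_1 [simp]: "value_at_1 1 = 1"
  using value_at_1_cconst[of 0] value_at_1_cconst[of 1] by simp_all

lemma value_at_1_qm1 [simp]: "value_at_1 qm1 = 0"
  unfolding qm1_def by (simp add: value_at_1_Fract)

lemma qm1_nonzero [simp]: "qm1 \<noteq> 0"
  unfolding qm1_def by (simp add: Zero_fract_def eq_fract)

lemma cconst_minus_1 [simp]: "cconst (- 1) = - 1"
  unfolding cconst_def by (simp add: One_fract_def one_pCons)

lemma regular_uminus: "regular_at_1 f \<Longrightarrow> regular_at_1 (- f)"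
  using regular_mult[OF regular_cconst[of "- 1"], of f] by simp

lemma value_at_1_uminus: "regular_at_1 f \<Longrightarrow> value_at_1 (- f) = - value_at_1 f"
  using value_at_1_mult[OF regular_cconst[of "- 1"], of f] value_at_1_cconst[of "- 1"] by simp

lemma regular_diff: "regular_at_1 f \<Longrightarrow> regular_at_1 g \<Longrightarrow> regular_at_1 (f - g)"
  using regular_add[of f "- g"] regular_uminus[of g] by simp

lemma value_at_1_diff:
  "regular_at_1 f \<Longrightarrow> regular_at_1 g \<Longrightarrow> value_at_1 (f - g) = value_at_1 f - value_at_1 g"
  using value_at_1_add[of f "- g"] regular_uminus[of g] value_at_1_uminus[of g] by simp

lemma regular_sum: "(\<And>i. i \<in> J \<Longrightarrow> regular_at_1 (f i)) \<Longrightarrow> regular_at_1 (sum f J)"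
  by (induction J rule: infinite_finite_induct) (auto intro: regular_add)

lemma value_at_1_sum:
  "(\<And>i. i \<in> J \<Longrightarrow> regular_at_1 (f i)) \<Longrightarrow> value_at_1 (sum f J) = (\<Sum>i\<in>J. value_at_1 (f i))"
  by (induction J rule: infinite_finite_induct) (auto simp: value_at_1_add regular_sum)

text \<open>A numerator that vanishes at 1 is divisible by q - 1, so the maximal ideal of the local
  ring is principal.\<close>

lemma value_0_dvd_qm1:
  assumes "regular_at_1 f" "value_at_1 f = 0"
  obtains g where "regular_at_1 g" "f = qm1 * g"
proof -
  obtain p d where f: "poly d 1 \<noteq> 0" "d \<noteq> 0" "f = Fract p d" using assms(1) by (rule regular_at_1E)
  have "poly p 1 = 0" using assms(2) f by (simp add: value_at_1_Fract)
  then obtain k where "p = [:-1, 1:] * k" unfolding poly_eq_0_iff_dvd by (auto elim: dvdE)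
  then have "f = qm1 * Fract k d" unfolding f(3) qm1_def by simp
  then show ?thesis using that regular_at_1I[OF f(1)] by blast
qed

text \<open>The local ring is a valuation ring: after the powers of q - 1 are split off from
  numerator and denominator, the comparison of the two exponents decides which quotient is
  regular.\<close>

lemma regular_or_regular_inverse: "regular_at_1 f \<or> regular_at_1 (inverse f)"
proof (cases f)
  case (Fract p d)
  show ?thesis
  proof (cases "p = 0")
    case True
    then have "f = 0" using Fract by (simp add: Zero_fract_def eq_fract)
    then show ?thesis by simp
  next
    case False
    let ?h = "[:-1, 1:] :: complex poly"
    have nz: "?h \<noteq> 0" by simp
    obtain a p' where p': "p = ?h ^ a * p'" "\<not> ?h dvd p'"
      using order_decomp[OF False, of 1] by blast
    obtain b d' where d': "d = ?h ^ b * d'" "\<not> ?h dvd d'"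
      using order_decomp[OF Fract(2), of 1] by blast
    have p1: "poly p' 1 \<noteq> 0" and d1: "poly d' 1 \<noteq> 0"
      using p'(2) d'(2) by (simp_all add: poly_eq_0_iff_dvd)
    have pd: "p' \<noteq> 0" "d' \<noteq> 0" using p1 d1 by auto
    show ?thesis
    proof (cases "b \<le> a")
      case True
      have "p * d' = (?h ^ (a - b) * p') * d"
        unfolding p'(1) d'(1) using True
        by (simp add: mult.assoc mult.left_commute[of _ "?h ^ b"] power_add[symmetric] flip: mult.assoc)
      then have "f = Fract (?h ^ (a - b) * p') d'"
        unfolding Fract(1) using Fract(2) pd by (simp add: eq_fract)
      then show ?thesis using regular_at_1I[OF d1] by simp
    next
      case False': False
      have "d * p' = (?h ^ (b - a) * d') * p"
        unfolding p'(1) d'(1) using False'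
        by (simp add: mult.assoc mult.left_commute[of _ "?h ^ a"] power_add[symmetric] flip: mult.assoc)
      then have "inverse f = Fract (?h ^ (b - a) * d') p'"
        unfolding Fract(1) using Fract(2) False pd by (simp add: eq_fract)
      then show ?thesis using regular_at_1I[OF p1] by simp
    qed
  qed
qed

text \<open>Divisibility in a valuation ring is total, so one coefficient of least order at q = 1
  divides all the others. Dividing by it makes a vector regular with one entry equal to 1; this
  normalization drives every contradiction at q = 1 below.\<close>

lemma dominant_coefficient:
  fixes x :: "'j \<Rightarrow> cq"
  assumes "finite J" "\<exists>j\<in>J. x j \<noteq> 0"
  obtains j where "j \<in> J" "x j \<noteq> 0" "\<And>i. i \<in> J \<Longrightarrow> regular_at_1 (x i / x j)"
proof -
  have "(\<exists>j\<in>J. x j \<noteq> 0) \<longrightarrow> (\<exists>j\<in>J. x j \<noteq> 0 \<and> (\<forall>i\<in>J. regular_at_1 (x i / x j)))"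
    using assms(1)
  proof induction
    case (insert k J)
    show ?case
    proof (cases "\<exists>j\<in>J. x j \<noteq> 0")
      case True
      then obtain j where j: "j \<in> J" "x j \<noteq> 0" "\<And>i. i \<in> J \<Longrightarrow> regular_at_1 (x i / x j)"
        using insert by blast
      show ?thesis
      proof (cases "regular_at_1 (x k / x j)")
        case True
        then show ?thesis using j by blast
      next
        case False
        then have r: "regular_at_1 (x j / x k)" and k: "x k \<noteq> 0"
          using regular_or_regular_inverse[of "x k / x j"] by (auto simp: inverse_eq_divide)
        have "regular_at_1 (x i / x k)" if "i \<in> J" for i
          using regular_mult[OF j(3)[OF that] r] j(2) by simp
        then show ?thesis using k by auto
      qed
    next
      case False
      have "regular_at_1 (x i / x k)" if "i \<in> insert k J" for i
        using that False by (cases "x k = 0") auto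
      then show ?thesis using False by blast
    qed
  qed simp
  then show ?thesis using assms(2) that by blast
qed

lemma regular_power: "regular_at_1 f \<Longrightarrow> regular_at_1 (f ^ n)"
  by (induction n) (auto intro: regular_mult)

lemma pole_order:
  obtains n where "regular_at_1 (qm1 ^ n * f)"
proof (cases f)
  case (Fract p d)
  let ?h = "[:-1, 1:] :: complex poly"
  obtain d' where d': "d = ?h ^ order 1 d * d'" "\<not> ?h dvd d'"
    using order_decomp[OF Fract(2), of 1] by blast
  have d1: "poly d' 1 \<noteq> 0" using d'(2) by (simp add: poly_eq_0_iff_dvd)
  then have "d' \<noteq> 0" by auto
  have q: "qm1 ^ n = Fract (?h ^ n) 1" for n
    by (induction n) (simp_all add: qm1_def One_fract_def)
  have "p * ?h ^ order 1 d * d' = p * d" by (subst (2) d'(1)) (simp add: ac_simps)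
  then have "qm1 ^ order 1 d * f = Fract p d'"
    unfolding q Fract(1) using Fract(2) \<open>d' \<noteq> 0\<close> by (simp add: eq_fract ac_simps)
  then show ?thesis using that regular_at_1I[OF d1] by metis
qed


section \<open>Spans over the local ring\<close>

text \<open>The local ring is a subset of the field and not a type of its own, so the module
  generated by \<open>S\<close> is defined by closure, one term at a time.\<close>

inductive_set rspan :: "'a::cq_vector_space set \<Rightarrow> 'a set" for S where
  rspan_zero: "0 \<in> rspan S"
| rspan_step: "regular_at_1 a \<Longrightarrow> s \<in> S \<Longrightarrow> x \<in> rspan S \<Longrightarrow> a *\<^sub>q s + x \<in> rspan S"

lemma rspan_superset: "s \<in> S \<Longrightarrow> s \<in> rspan S"
  using rspan_step[OF regular_1 _ rspan_zero, of s S] by (simp add: scaleq_one)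

lemma rspan_add: "x \<in> rspan S \<Longrightarrow> y \<in> rspan S \<Longrightarrow> x + y \<in> rspan S"
  by (induction rule: rspan.induct) (auto simp: add.assoc intro: rspan_step)

lemma rspan_scale: "x \<in> rspan S \<Longrightarrow> regular_at_1 a \<Longrightarrow> a *\<^sub>q x \<in> rspan S"
  by (induction rule: rspan.induct)
     (auto simp: scaleq_add_right scaleq_scaleq intro: rspan_step rspan_zero regular_mult)

lemma rspan_uminus: "x \<in> rspan S \<Longrightarrow> - x \<in> rspan S"
  using rspan_scale[OF _ regular_uminus[OF regular_1], of x S] by (simp add: scaleq_one)

lemma rspan_diff: "x \<in> rspan S \<Longrightarrow> y \<in> rspan S \<Longrightarrow> x - y \<in> rspan S"
  using rspan_add[OF _ rspan_uminus, of x S y] by simp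

lemma rspan_sum: "(\<And>i. i \<in> J \<Longrightarrow> f i \<in> rspan S) \<Longrightarrow> sum f J \<in> rspan S"
  by (induction J rule: infinite_finite_induct) (auto intro: rspan_zero rspan_add)

text \<open>A combination over the field has finitely many coefficients, and a common power of q - 1
  clears all their poles at 1.\<close>

lemma span_into_rspan:
  assumes "x \<in> qv.span S"
  obtains n where "qm1 ^ n *\<^sub>q x \<in> rspan S"
proof -
  have "\<exists>n. qm1 ^ n *\<^sub>q x \<in> rspan S"
    using assms
  proof (induction rule: qv.span_induct_alt)
    case base
    show ?case by (simp add: rspan_zero)
  next
    case (step c s y)
    from step obtain n where n: "qm1 ^ n *\<^sub>q y \<in> rspan S" by blast
    obtain m where m: "regular_at_1 (qm1 ^ m * c)" by (rule pole_order)
    have "qm1 ^ (m + n) *\<^sub>q (c *\<^sub>q s + y) =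
        qm1 ^ n *\<^sub>q ((qm1 ^ m * c) *\<^sub>q s) + qm1 ^ m *\<^sub>q (qm1 ^ n *\<^sub>q y)"
      by (simp add: scaleq_add_right scaleq_scaleq power_add ac_simps)
    also have "\<dots> \<in> rspan S"
      by (rule rspan_add; rule rspan_scale)
         (use n m step in \<open>auto intro: rspan_scale regular_power rspan_superset\<close>)
    finally show ?case by blast
  qed
  then show ?thesis using that by blast
qed

text \<open>Congruence modulo this set is reduction at \<open>q = 1\<close>.\<close>

definition maxspan :: "'a::cq_vector_space set \<Rightarrow> 'a set" where
  "maxspan S = (\<lambda>x. qm1 *\<^sub>q x) ` rspan S"

lemma maxspanI: "x \<in> rspan S \<Longrightarrow> qm1 *\<^sub>q x \<in> maxspan S"
  by (simp add: maxspan_def)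

lemma maxspan_zero: "0 \<in> maxspan S"
  using maxspanI[OF rspan_zero, of S] by simp

lemma maxspan_add: "x \<in> maxspan S \<Longrightarrow> y \<in> maxspan S \<Longrightarrow> x + y \<in> maxspan S"
  unfolding maxspan_def by (auto simp: scaleq_add_right[symmetric] intro: rspan_add)

lemma maxspan_scale: "x \<in> maxspan S \<Longrightarrow> regular_at_1 a \<Longrightarrow> a *\<^sub>q x \<in> maxspan S"
  unfolding maxspan_def by (auto simp: scaleq_scaleq mult.commute[of a] intro!: imageI)
     (metis imageI rspan_scale scaleq_scaleq)

lemma maxspan_sum: "(\<And>i. i \<in> J \<Longrightarrow> f i \<in> maxspan S) \<Longrightarrow> sum f J \<in> maxspan S"
  by (induction J rule: infinite_finite_induct) (auto intro: maxspan_zero maxspan_add)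

lemma maxspan_uminus: "x \<in> maxspan S \<Longrightarrow> - x \<in> maxspan S"
  using maxspan_scale[OF _ regular_uminus[OF regular_1], of x S] by (simp add: scaleq_one)

lemma maxspan_diff: "x \<in> maxspan S \<Longrightarrow> y \<in> maxspan S \<Longrightarrow> x - y \<in> maxspan S"
  using maxspan_add[OF _ maxspan_uminus, of x S y] by simp

lemma maxspan_subset_rspan: "maxspan S \<subseteq> rspan S"
  unfolding maxspan_def by (auto intro: rspan_scale)

lemma maxspan_step: "value_at_1 a = 0 \<Longrightarrow> regular_at_1 a \<Longrightarrow> x \<in> rspan S \<Longrightarrow> a *\<^sub>q x \<in> maxspan S"
  by (metis maxspanI rspan_scale scaleq_scaleq value_0_dvd_qm1)

section \<open>Linear maps, on the whole space or on a subspace only\<close>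

global_interpretation qvp: vector_space_pair
  "scaleq :: cq \<Rightarrow> 'a \<Rightarrow> 'a::cq_vector_space" "scaleq :: cq \<Rightarrow> 'b \<Rightarrow> 'b::cq_vector_space"
  by unfold_locales

abbreviation qlinear :: "('a::cq_vector_space \<Rightarrow> 'b::cq_vector_space) \<Rightarrow> bool" where
  "qlinear \<equiv> Vector_Spaces.linear scaleq scaleq"

lemma qlinearI:
  "(\<And>x y. f (x + y) = f x + f y) \<Longrightarrow> (\<And>c x. f (c *\<^sub>q x) = c *\<^sub>q f x) \<Longrightarrow> qlinear f"
  by (simp add: Vector_Spaces.linear_iff qv.vector_space_axioms)

lemma
  assumes "qlinear f"
  shows qlinear_add: "f (x + y) = f x + f y"
    and qlinear_scale: "f (c *\<^sub>q x) = c *\<^sub>q f x"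
    and qlinear_0: "f 0 = 0"
    and qlinear_diff: "f (x - y) = f x - f y"
    and qlinear_sum: "f (sum g J) = (\<Sum>i\<in>J. f (g i))"
  using assms
  by (auto intro: qvp.linear_add qvp.linear_scale qvp.linear_0 qvp.linear_diff
      qvp.linear_sum)

lemma rspan_linear_image:
  assumes f: "qlinear f" and gens: "\<And>s. s \<in> S \<Longrightarrow> f s \<in> rspan U" and x: "x \<in> rspan S"
  shows "f x \<in> rspan U"
  using x
  by induction (simp_all add: qlinear_add[OF f] qlinear_scale[OF f] qlinear_0[OF f] gens
      rspan_zero rspan_add rspan_scale)

lemma maxspan_linear_image:
  assumes f: "qlinear f" and gens: "\<And>s. s \<in> S \<Longrightarrow> f s \<in> rspan U" and x: "x \<in> maxspan S"
  shows "f x \<in> maxspan U"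
  using x rspan_linear_image[OF f gens] by (auto simp: maxspan_def qlinear_scale[OF f])

lemma linear_map_on_eq:
  assumes F: "linear_map_on V F" and G: "linear_map_on V G" and V: "qv.subspace V" and SV: "S \<subseteq> V"
    and gens: "\<And>s. s \<in> S \<Longrightarrow> F s = G s" and x: "x \<in> qv.span S"
  shows "F x = G x"
proof -
  have add: "F (x + y) = F x + F y" "G (x + y) = G x + G y" if "x \<in> V" "y \<in> V" for x y
    using F G that unfolding linear_map_on_def by blast+
  have scale: "F (c *\<^sub>q x) = c *\<^sub>q F x" "G (c *\<^sub>q x) = c *\<^sub>q G x" if "x \<in> V" for x c
    using F G that unfolding linear_map_on_def by blast+
  \<comment> \<open>Both maps are arbitrary outside \<open>V\<close>, so the induction has to carry
    membership in \<open>V\<close> along.\<close>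
  have "x \<in> V \<and> F x = G x"
    using x
  proof (induction rule: qv.span_induct_alt)
    case base
    have "F (0 *\<^sub>q 0) = 0 *\<^sub>q F 0" "G (0 *\<^sub>q 0) = 0 *\<^sub>q G 0"
      by (rule scale[OF qv.subspace_0[OF V]])+
    then show ?case using V by (simp add: qv.subspace_0)
  next
    case (step c s y)
    then have "s \<in> V" using SV by blast
    then show ?case using step V gens
      by (simp add: add scale qv.subspace_scale qv.subspace_add)
  qed
  then show ?thesis by blast
qed


section \<open>Coordinates on the tensor algebra\<close>

text \<open>The dual basis of a tensor power evaluated on a pure tensor: the coefficient of the
  basis word \<open>w\<close> in the product of the letters of \<open>u\<close>, which are arbitrary
  vectors.\<close>

fun word_coeff :: "'y::cq_vector_space set \<Rightarrow> 'y list \<Rightarrow> 'y list \<Rightarrow> cq" where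
  "word_coeff B [] [] = 1"
| "word_coeff B (b # w) (y # u) = qv.representation B y b * word_coeff B w u"
| "word_coeff B _ _ = 0"

lemma word_coeff_length: "length w \<noteq> length u \<Longrightarrow> word_coeff B w u = 0"
  by (induction B w u rule: word_coeff.induct) auto

lemma word_coeff_append:
  "word_coeff B w (u @ v) = word_coeff B (take (length u) w) u * word_coeff B (drop (length u) w) v"
proof (induction u arbitrary: w)
  case Nil
  show ?case by simp
next
  case (Cons y u)
  then show ?case by (cases w) (simp_all add: word_coeff_length)
qed

text \<open>The cut is counted from the end, as right multiplication requires. If \<open>w\<close>
  is shorter than \<open>v\<close>, truncated subtraction confronts all of \<open>w\<close> with
  \<open>v\<close>, and both sides vanish because of the lengths.\<close>

lemma word_coeff_append_right:
  "word_coeff B w (u @ v) =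
     word_coeff B (take (length w - length v) w) u * word_coeff B (drop (length w - length v) w) v"
proof (cases "length w = length u + length v")
  case True
  then show ?thesis by (simp add: word_coeff_append)
next
  case False
  then have l: "word_coeff B w (u @ v) = 0" by (simp add: word_coeff_length)
  show ?thesis
  proof (cases "length v \<le> length w")
    case True
    then have "word_coeff B (take (length w - length v) w) u = 0"
      using False by (intro word_coeff_length) auto
    then show ?thesis using l by simp
  next
    case False
    then have "word_coeff B (drop (length w - length v) w) v = 0"
      by (intro word_coeff_length) auto
    then show ?thesis using l by simp
  qed
qed

lemma word_coeff_basis:
  assumes "is_basis B" "set u \<subseteq> B"
  shows "word_coeff B w u = (if w = u then 1 else 0)"
  using assms(2)
proof (induction u arbitrary: w)
  case Nil
  show ?case by (cases w) auto
next
  case (Cons y u)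
  then show ?case using assms(1)
    by (cases w) (auto simp: is_basis_def qv.representation_basis)
qed

lemma word_coeff_linear:
  assumes "is_basis B"
  shows "word_coeff B w (u @ (x + y) # v) = word_coeff B w (u @ x # v) + word_coeff B w (u @ y # v)"
    and "word_coeff B w (u @ (c *\<^sub>q x) # v) = c * word_coeff B w (u @ x # v)"
proof -
  have B: "qv.independent B" "qv.span B = UNIV" using assms by (simp_all add: is_basis_def)
  have "word_coeff B w ((x + y) # v) = word_coeff B w (x # v) + word_coeff B w (y # v)" for w
    by (cases w) (simp_all add: B qv.representation_add[OF B(1)] distrib_right)
  then show "word_coeff B w (u @ (x + y) # v) = word_coeff B w (u @ x # v) + word_coeff B w (u @ y # v)"
    by (simp add: word_coeff_append distrib_left)
  have "word_coeff B w ((c *\<^sub>q x) # v) = c * word_coeff B w (x # v)" for w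
    by (cases w) (simp_all add: B qv.representation_scale[OF B(1)])
  then show "word_coeff B w (u @ (c *\<^sub>q x) # v) = c * word_coeff B w (u @ x # v)"
    by (simp add: word_coeff_append)
qed

lemma free_algebra_induct [case_names zero step]:
  fixes x :: "'y fword \<Rightarrow>\<^sub>0 cq"
  assumes "P 0" and step: "\<And>u c x. P x \<Longrightarrow> P (Poly_Mapping.single (Word u) c + x)"
  shows "P x"
proof (induction x rule: Poly_Mapping.update_induct)
  case const
  show ?case by (rule assms(1))
next
  case (update x k c)
  obtain u where k: "k = Word u" by (cases k)
  have "Poly_Mapping.update k c x = Poly_Mapping.single (Word u) c + x"
    by (rule poly_mapping_eqI)
       (use update k in \<open>auto simp: lookup_update lookup_add lookup_single when_def in_keys_iff\<close>)
  then show ?case using step update by simp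
qed

primrec letters :: "'y fword \<Rightarrow> 'y list" where "letters (Word u) = u"

definition raw_coord :: "'y::cq_vector_space set \<Rightarrow> 'y list \<Rightarrow> ('y fword \<Rightarrow>\<^sub>0 cq) \<Rightarrow> cq" where
  "raw_coord B w x =
     (\<Sum>k\<in>Poly_Mapping.keys x. Poly_Mapping.lookup x k * word_coeff B w (letters k))"

lemma raw_coord_superset:
  assumes "finite K" "Poly_Mapping.keys x \<subseteq> K"
  shows "raw_coord B w x = (\<Sum>k\<in>K. Poly_Mapping.lookup x k * word_coeff B w (letters k))"
  unfolding raw_coord_def
  by (rule sum.mono_neutral_left) (use assms in \<open>auto simp: in_keys_iff\<close>)

lemma raw_coord_add: "raw_coord B w (x + y) = raw_coord B w x + raw_coord B w y"
proof -
  let ?K = "Poly_Mapping.keys x \<union> Poly_Mapping.keys y"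
  have "Poly_Mapping.keys (x + y) \<subseteq> ?K" by (rule Poly_Mapping.keys_add)
  then show ?thesis
    by (simp add: raw_coord_superset[where K = ?K] lookup_add distrib_right sum.distrib)
qed

lemma raw_coord_single: "raw_coord B w (Poly_Mapping.single (Word u) c) = c * word_coeff B w u"
  by (simp add: raw_coord_superset[where K = "{Word u}"])

lemma raw_coord_0: "raw_coord B w 0 = 0"
  by (simp add: raw_coord_def)

lemma raw_coord_uminus: "raw_coord B w (- x) = - raw_coord B w x"
  by (simp add: raw_coord_def sum_negf)

lemma raw_coord_diff: "raw_coord B w (x - y) = raw_coord B w x - raw_coord B w y"
  using raw_coord_add[of B w x "- y"] by (simp add: raw_coord_uminus)

text \<open>\<open>u\<close> reads the first letters of \<open>w\<close> and \<open>x\<close> reads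
  the rest. If \<open>w\<close> is too short, \<open>take\<close> returns \<open>w\<close> itself,
  whose coefficient in \<open>u\<close> is zero.\<close>

lemma raw_coord_single_mult:
  "raw_coord B w (Poly_Mapping.single (Word u) c * x) =
     c * word_coeff B (take (length u) w) u * raw_coord B (drop (length u) w) x"
  by (induction x rule: free_algebra_induct)
     (simp_all add: raw_coord_0 raw_coord_add raw_coord_single distrib_left mult_single
       word_coeff_append)

lemma raw_coord_mult_single:
  "raw_coord B w (x * Poly_Mapping.single (Word u) c) =
     raw_coord B (take (length w - length u) w) x * word_coeff B (drop (length w - length u) w) u * c"
  by (induction x rule: free_algebra_induct)
     (simp_all add: raw_coord_0 raw_coord_add raw_coord_single distrib_left distrib_right mult_single
       word_coeff_append_right)

text \<open>Coordinates of a product with a single word factor, so the elements on which all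
  coordinates vanish form a two-sided ideal. It contains the generators because a coefficient is
  linear in each letter.\<close>

lemma raw_coord_linearity_ideal:
  assumes B: "is_basis B" and x: "x \<in> linearity_ideal"
  shows "raw_coord B w x = 0"
proof -
  let ?Z = "{x. \<forall>w. raw_coord B w x = 0}"
  have "raw_coord B w (a * x) = 0" if "x \<in> ?Z" for a x w
    using that
    by (induction a rule: free_algebra_induct)
       (simp_all add: raw_coord_0 raw_coord_add distrib_right raw_coord_single_mult)
  moreover have "raw_coord B w (x * a) = 0" if "x \<in> ?Z" for a x w
    using that
    by (induction a rule: free_algebra_induct)
       (simp_all add: raw_coord_0 raw_coord_add distrib_left raw_coord_mult_single)
  ultimately have "two_sided_ideal ?Z"
    by (auto simp: two_sided_ideal_def raw_coord_0 raw_coord_add)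
  then have "linearity_ideal \<subseteq> ?Z"
    unfolding linearity_ideal_def
  proof (rule hull_minimal[rotated])
    show "{free_gen (v + w) - free_gen v - free_gen w |v w. True} \<union>
        {free_gen (c *\<^sub>q v) - free_const c * free_gen v |c v. True} \<subseteq> ?Z"
      using word_coeff_linear(1)[OF B, where u = "[]" and v = "[]"]
        word_coeff_linear(2)[OF B, where u = "[]" and v = "[]"]
      by (auto simp: raw_coord_diff raw_coord_single mult_single)
  qed
  then show ?thesis using x by blast
qed

text \<open>A junk value if \<open>B\<close> is not a basis: then \<open>qv.representation\<close> need not be linear.\<close>

lift_definition coord :: "'y::cq_vector_space set \<Rightarrow> 'y list \<Rightarrow> 'y tensor_algebra \<Rightarrow> cq" is
  "\<lambda>B w x. if is_basis B then raw_coord B w x else 0"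
  using raw_coord_linearity_ideal by (fastforce simp: raw_coord_diff)

lemma monomial_abs: "monomial u = abs_tensor_algebra (Poly_Mapping.single (Word u) 1)"
proof (induction u)
  case Nil
  show ?case by (simp add: one_tensor_algebra_def flip: zero_fword_def single_one)
next
  case (Cons y u)
  then show ?case
    by (simp add: gen.abs_eq times_tensor_algebra.abs_eq mult_single)
qed

lemma scaleq_monomial_abs:
  "c *\<^sub>q monomial u = abs_tensor_algebra (Poly_Mapping.single (Word u) c)"
  by (simp add: monomial_abs scaleq_tensor_algebra.abs_eq mult_single)

lemma span_mult:
  fixes x y :: "'y::cq_vector_space tensor_algebra"
  assumes "x \<in> qv.span S" "y \<in> qv.span U" and SU: "\<And>s u. s \<in> S \<Longrightarrow> u \<in> U \<Longrightarrow> s * u \<in> qv.span V"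
  shows "x * y \<in> qv.span V"
  using assms(1)
proof (induction rule: qv.span_induct_alt)
  case base
  show ?case by (simp add: qv.span_zero)
next
  case (step c s x)
  have "s * y \<in> qv.span V"
    using assms(2)
  proof (induction rule: qv.span_induct_alt)
    case base
    show ?case by (simp add: qv.span_zero)
  next
    case (step c u y)
    then show ?case
      by (simp add: distrib_left scaleq_mult_right qv.span_add qv.span_scale SU \<open>s \<in> S\<close>)
  qed
  then show ?case using step
    by (simp add: distrib_right scaleq_mult_left qv.span_add qv.span_scale)
qed

lemma span_monomials: "x \<in> qv.span (range monomial)"
proof -
  define a where "a = rep_tensor_algebra x"
  have a: "x = abs_tensor_algebra a"
    unfolding a_def by (rule Quotient3_abs_rep[OF Quotient3_tensor_algebra, symmetric])
  have "abs_tensor_algebra a \<in> qv.span (range monomial)"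
  proof (induction a rule: free_algebra_induct)
    case zero
    show ?case by (simp add: qv.span_zero flip: zero_tensor_algebra_def)
  next
    case (step u c a)
    have "abs_tensor_algebra (Poly_Mapping.single (Word u) c + a) =
        c *\<^sub>q monomial u + abs_tensor_algebra a"
      by (simp add: scaleq_monomial_abs plus_tensor_algebra.abs_eq)
    moreover have "monomial u \<in> qv.span (range monomial)"
      by (rule qv.span_base) blast
    ultimately show ?case using step by (simp add: qv.span_add qv.span_scale)
  qed
  then show ?thesis using a by simp
qed

lemma tpow_mult:
  assumes "x \<in> tpow k" "y \<in> tpow l"
  shows "x * y \<in> tpow (k + l)"
  unfolding tpow_def
proof (rule span_mult[OF assms[unfolded tpow_def]])
  fix s t :: "'a tensor_algebra"
  assume "s \<in> {monomial u |u. length u = k}" "t \<in> {monomial u |u. length u = l}"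
  then obtain u v where "s = monomial u" "length u = k" "t = monomial v" "length v = l" by blast
  then show "s * t \<in> qv.span {monomial u |u. length u = k + l}"
    by (intro qv.span_base CollectI exI[of _ "u @ v"]) simp
qed

lemma monomial_in_tpow: "length u = k \<Longrightarrow> monomial u \<in> tpow k"
  unfolding tpow_def by (blast intro: qv.span_base)

lemma subspace_tpow: "qv.subspace (tpow k)"
  unfolding tpow_def by (rule qv.subspace_span)

section \<open>The words in a basis of \<open>Y\<close> as a basis of the tensor algebra\<close>

locale tensor_basis =
  fixes B :: "'y::cq_vector_space set"
  assumes basis: "is_basis B"
begin

definition words :: "'y list set" where "words = {w. set w \<subseteq> B}"

definition words_of_length :: "nat \<Rightarrow> 'y list set" where
  "words_of_length k = {w. set w \<subseteq> B \<and> length w = k}"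

lemma words_simps [simp]:
  "[] \<in> words" "x # w \<in> words \<longleftrightarrow> x \<in> B \<and> w \<in> words" "u @ v \<in> words \<longleftrightarrow> u \<in> words \<and> v \<in> words"
  by (auto simp: words_def)

lemma words_of_length_iff: "w \<in> words_of_length k \<longleftrightarrow> w \<in> words \<and> length w = k"
  by (simp add: words_of_length_def words_def)

lemma coord_add: "coord B w (x + y) = coord B w x + coord B w y"
  by transfer (simp add: raw_coord_add)

lemma coord_scale: "coord B w (c *\<^sub>q x) = c * coord B w x"
  by transfer (simp add: raw_coord_single_mult zero_fword_def)

lemma coord_0: "coord B w 0 = 0"
  by transfer (simp add: raw_coord_0)

lemma coord_diff: "coord B w (x - y) = coord B w x - coord B w y"
  by transfer (simp add: raw_coord_diff)

lemma coord_sum: "coord B w (sum f J) = (\<Sum>i\<in>J. coord B w (f i))"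
  by (induction J rule: infinite_finite_induct) (simp_all add: coord_0 coord_add)

lemma coord_monomial: "u \<in> words \<Longrightarrow> coord B w (monomial u) = (if w = u then 1 else 0)"
  unfolding monomial_abs words_def
  by (simp add: coord.abs_eq basis raw_coord_single word_coeff_basis)

lemma inj_on_monomial: "inj_on monomial words"
proof (rule inj_onI)
  fix u v :: "'y list"
  assume "u \<in> words" "v \<in> words" "monomial u = monomial v"
  then show "u = v" using coord_monomial[of u u] coord_monomial[of v u] by (auto split: if_splits)
qed

lemma monomial_in_span: "monomial u \<in> qv.span (monomial ` words_of_length (length u))"
proof (induction u)
  case Nil
  show ?case by (rule qv.span_base) (force simp: words_of_length_iff)
next
  case (Cons y u)
  have "gen y \<in> qv.span (gen ` B)"
  proof -
    have "qlinear (gen :: 'y \<Rightarrow> _)" by (rule qlinearI) (simp_all add: gen_add gen_scaleq)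
    then have "gen ` qv.span B = qv.span (gen ` B)" by (rule qvp.linear_span_image[symmetric])
    then show ?thesis using basis by (auto simp: is_basis_def)
  qed
  then have "gen y * monomial u \<in> qv.span (monomial ` words_of_length (length (y # u)))"
  proof (rule span_mult[OF _ Cons])
    fix s t assume "s \<in> gen ` B" "t \<in> monomial ` words_of_length (length u)"
    then obtain b v where "s = gen b" "b \<in> B" "t = monomial v" "v \<in> words_of_length (length u)" by blast
    then show "s * t \<in> qv.span (monomial ` words_of_length (length (y # u)))"
      by (intro qv.span_base image_eqI[of _ _ "b # v"]) (simp_all add: words_of_length_iff)
  qed
  then show ?case by simp
qed

lemma tpow_eq_span: "tpow k = qv.span (monomial ` words_of_length k)"
proof -
  have "{monomial u |u :: 'y list. length u = k} \<subseteq> qv.span (monomial ` words_of_length k)"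
    using monomial_in_span by blast
  moreover have "monomial ` words_of_length k \<subseteq> {monomial u |u. length u = k}"
    by (auto simp: words_of_length_iff)
  ultimately show ?thesis
    unfolding tpow_def by (meson qv.span_minimal qv.span_mono qv.subspace_span subset_antisym)
qed

lemma span_words: "qv.span (monomial ` words) = UNIV"
proof -
  have "words_of_length k \<subseteq> words" for k by (auto simp: words_of_length_iff)
  then have "range monomial \<subseteq> qv.span (monomial ` words)"
    using monomial_in_span by (meson image_mono image_subsetI qv.span_mono subsetD)
  then have "qv.span (range monomial) \<subseteq> qv.span (monomial ` words)"
    by (metis qv.span_minimal qv.subspace_span)
  then show ?thesis using span_monomials by blast
qed

lemma independent_words: "qv.independent (monomial ` words)"
  unfolding qv.dependent_def
proof clarify
  fix u assume u: "u \<in> words" and "monomial u \<in> qv.span (monomial ` words - {monomial u})"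
  from this(2) have "coord B u (monomial u) = 0"
    by (induction rule: qv.span_induct_alt)
       (auto simp: coord_0 coord_add coord_scale coord_monomial split: if_splits)
  then show False using u by (simp add: coord_monomial)
qed

lemma coord_expansion:
  "finite {w. coord B w x \<noteq> 0} \<and> {w. coord B w x \<noteq> 0} \<subseteq> words \<and>
     (\<Sum>w | coord B w x \<noteq> 0. coord B w x *\<^sub>q monomial w) = x"
proof -
  \<comment> \<open>A finite set that contains the support is easy to enlarge in the induction; the
    support itself may shrink by cancellation.\<close>
  have "\<exists>F. finite F \<and> F \<subseteq> words \<and> (\<forall>w. w \<notin> F \<longrightarrow> coord B w x = 0) \<and>
      (\<Sum>w\<in>F. coord B w x *\<^sub>q monomial w) = x"
    using span_words[THEN equalityD2, THEN subsetD, of x, OF UNIV_I]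
  proof (induction rule: qv.span_induct_alt)
    case base
    show ?case by (intro exI[of _ "{}"]) (simp add: coord_0)
  next
    case (step c s x)
    then obtain u F where u: "u \<in> words" "s = monomial u" and F: "finite F" "F \<subseteq> words"
      "\<And>w. w \<notin> F \<Longrightarrow> coord B w x = 0" "(\<Sum>w\<in>F. coord B w x *\<^sub>q monomial w) = x" by auto
    have "(\<Sum>w\<in>insert u F. coord B w x *\<^sub>q monomial w) = x"
      using F by (cases "u \<in> F") (simp_all add: insert_absorb)
    moreover have "(\<Sum>w\<in>insert u F. coord B w (c *\<^sub>q s) *\<^sub>q monomial w) = c *\<^sub>q s"
    proof -
      have "(\<Sum>w\<in>insert u F. coord B w (c *\<^sub>q s) *\<^sub>q monomial w) =
          (\<Sum>w\<in>insert u F. if w = u then c *\<^sub>q s else 0)"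
        using u by (intro sum.cong) (auto simp: coord_scale coord_monomial)
      then show ?thesis using F(1) by simp
    qed
    ultimately show ?case using F u
      by (intro exI[of _ "insert u F"])
         (simp add: coord_add coord_scale coord_monomial scaleq_add_left sum.distrib)
  qed
  then obtain F where F: "finite F" "F \<subseteq> words" "\<And>w. w \<notin> F \<Longrightarrow> coord B w x = 0"
    "(\<Sum>w\<in>F. coord B w x *\<^sub>q monomial w) = x" by blast
  have sub: "{w. coord B w x \<noteq> 0} \<subseteq> F" using F(3) by blast
  have "(\<Sum>w | coord B w x \<noteq> 0. coord B w x *\<^sub>q monomial w) =
      (\<Sum>w\<in>F. coord B w x *\<^sub>q monomial w)"
    by (rule sum.mono_neutral_left[OF F(1) sub]) auto
  then show ?thesis using F sub finite_subset[OF sub F(1)] by auto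
qed

lemma coord_tpow: "x \<in> tpow k \<Longrightarrow> w \<notin> words_of_length k \<Longrightarrow> coord B w x = 0"
  unfolding tpow_eq_span
  by (induction rule: qv.span_induct_alt)
     (auto simp: coord_0 coord_add coord_scale coord_monomial words_of_length_iff split: if_splits)

definition extend :: "('y list \<Rightarrow> 'b::cq_vector_space) \<Rightarrow> 'y tensor_algebra \<Rightarrow> 'b" where
  "extend g = (SOME f. qlinear f \<and> (\<forall>w\<in>words. f (monomial w) = g w))"

lemma
  shows qlinear_extend: "qlinear (extend g)"
    and extend_monomial: "w \<in> words \<Longrightarrow> extend g (monomial w) = g w"
proof -
  obtain f where f: "qlinear f"
    "\<forall>x\<in>monomial ` words. f x = g (inv_into words monomial x)"
    using qvp.linear_independent_extend
      [OF independent_words, of "\<lambda>x. g (inv_into words monomial x)"] by blast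
  have "f (monomial w) = g w" if "w \<in> words" for w
    using f(2) that inv_into_f_f[OF inj_on_monomial that] by simp
  then have "\<exists>f. qlinear f \<and> (\<forall>w\<in>words. f (monomial w) = g w)"
    using f(1) by blast
  then have "qlinear (extend g) \<and> (\<forall>w\<in>words. extend g (monomial w) = g w)"
    unfolding extend_def by (rule someI_ex)
  then show "qlinear (extend g)" "w \<in> words \<Longrightarrow> extend g (monomial w) = g w" by auto
qed

lemma pair_monomials:
  "(\<lambda>(b, b'). gen b * gen b') ` (B \<times> B) = monomial ` words_of_length 2"
proof -
  have "words_of_length 2 = (\<lambda>(b, b'). [b, b']) ` (B \<times> B)"
    by (force simp: words_of_length_def numeral_2_eq_2 length_Suc_conv)
  then show ?thesis by (auto simp: image_image split_beta)
qed

text \<open>Links the coordinates in the statement, which are indexed by basis vectors of the tensor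
  square, with \<open>coord\<close>, which is indexed by words. The two indexings match because
  \<open>monomial\<close> is injective on words.\<close>

lemma tensor_coeff_eq_coord:
  assumes t: "t \<in> tpow 2" and p: "p \<in> B \<times> B"
  shows "tensor_coeff B t p = coord B [fst p, snd p] t"
proof -
  let ?S = "monomial ` words_of_length 2"
  have "words_of_length 2 \<subseteq> words" by (auto simp: words_of_length_iff)
  then have ind: "qv.independent ?S"
    using qv.independent_mono[OF independent_words image_mono] by blast
  have w: "[fst p, snd p] \<in> words" using p by auto
  have "t \<in> qv.span ?S \<and>
      qv.representation ?S t (monomial [fst p, snd p]) = coord B [fst p, snd p] t"
    using t unfolding tpow_eq_span
  proof (induction rule: qv.span_induct_alt)
    case base
    show ?case by (simp add: coord_0 qv.representation_zero qv.span_zero)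
  next
    case (step c s x)
    then obtain u where u: "u \<in> words" "s = monomial u" by (auto simp: words_of_length_iff)
    have "monomial [fst p, snd p] = monomial u \<longleftrightarrow> [fst p, snd p] = u"
      by (rule inj_on_eq_iff[OF inj_on_monomial w u(1)])
    then have "qv.representation ?S s (monomial [fst p, snd p]) = coord B [fst p, snd p] s"
      using step(1) u by (simp only: qv.representation_basis[OF ind] coord_monomial)
    moreover have "s \<in> qv.span ?S" using step(1) by (rule qv.span_base)
    ultimately show ?case
      using step(2) by (simp only: coord_add coord_scale qv.representation_add[OF ind] qv.span_scale
        qv.span_add qv.representation_scale[OF ind])
  qed
  then show ?thesis unfolding tensor_coeff_def pair_monomials by simp
qed

text \<open>The lattice is free on the words, hence membership is decided coordinate by
  coordinate.\<close>

lemma rspan_words_iff: "x \<in> rspan (monomial ` words) \<longleftrightarrow> (\<forall>w. regular_at_1 (coord B w x))"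
proof
  assume "x \<in> rspan (monomial ` words)"
  then show "\<forall>w. regular_at_1 (coord B w x)"
    by induction (auto simp: coord_0 coord_add coord_scale coord_monomial intro: regular_add regular_mult)
next
  assume r: "\<forall>w. regular_at_1 (coord B w x)"
  have "(\<Sum>w | coord B w x \<noteq> 0. coord B w x *\<^sub>q monomial w) \<in> rspan (monomial ` words)"
    using r coord_expansion[of x] by (intro rspan_sum rspan_scale rspan_superset) auto
  then show "x \<in> rspan (monomial ` words)" using coord_expansion[of x] by simp
qed

lemma maxspan_words_iff:
  "x \<in> maxspan (monomial ` words) \<longleftrightarrow> (\<forall>w. regular_at_1 (coord B w x) \<and> value_at_1 (coord B w x) = 0)"
proof
  assume "x \<in> maxspan (monomial ` words)"
  then obtain z where z: "z \<in> rspan (monomial ` words)" "x = qm1 *\<^sub>q z" by (auto simp: maxspan_def)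
  then show "\<forall>w. regular_at_1 (coord B w x) \<and> value_at_1 (coord B w x) = 0"
    by (simp add: rspan_words_iff coord_scale regular_mult value_at_1_mult)
next
  assume r: "\<forall>w. regular_at_1 (coord B w x) \<and> value_at_1 (coord B w x) = 0"
  have "(\<Sum>w | coord B w x \<noteq> 0. coord B w x *\<^sub>q monomial w) \<in> maxspan (monomial ` words)"
    using r coord_expansion[of x] by (intro maxspan_sum maxspan_step rspan_superset) auto
  then show "x \<in> maxspan (monomial ` words)" using coord_expansion[of x] by simp
qed

end


section \<open>Quadratic relations acting at consecutive positions\<close>

lemma two_sided_ideal_scaleq:
  fixes I :: "'y::cq_vector_space tensor_algebra set"
  assumes "two_sided_ideal I" "x \<in> I"
  shows "c *\<^sub>q x \<in> I"
proof -
  have "(c *\<^sub>q 1) * x \<in> I" using assms unfolding two_sided_ideal_def by blast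
  then show ?thesis by (simp add: scaleq_mult_left)
qed

lemma two_sided_ideal_subspace:
  fixes I :: "'y::cq_vector_space tensor_algebra set"
  assumes "two_sided_ideal I"
  shows "qv.subspace I"
  using assms two_sided_ideal_scaleq[OF assms] unfolding two_sided_ideal_def qv.subspace_def by blast

text \<open>The common setting of the braiding and of the flip, so that the two quotient algebras
  are treated by the same argument.\<close>

locale quadratic = tensor_basis B for B :: "'y::cq_vector_space set" +
  fixes \<Psi> :: "'y tensor_algebra \<Rightarrow> 'y tensor_algebra"
  assumes linear: "linear_map_on (tpow 2) \<Psi>"
    and into: "t \<in> tpow 2 \<Longrightarrow> \<Psi> t \<in> tpow 2"
begin

text \<open>\<open>\<Psi>\<close> at the positions \<open>i\<close> and \<open>i + 1\<close>, on all tensor powers at once.\<close>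

definition act :: "nat \<Rightarrow> 'y tensor_algebra \<Rightarrow> 'y tensor_algebra" where
  "act i = extend (\<lambda>w. if Suc i < length w
     then monomial (take i w) * \<Psi> (gen (w ! i) * gen (w ! Suc i)) * monomial (drop (Suc (Suc i)) w)
     else monomial w)"

lemma qlinear_act: "qlinear (act i)"
  unfolding act_def by (rule qlinear_extend)

lemma act_monomial:
  assumes "u @ x # y # v \<in> words" "length u = i"
  shows "act i (monomial (u @ x # y # v)) = monomial u * \<Psi> (gen x * gen y) * monomial v"
  unfolding act_def extend_monomial[OF assms(1)] using assms(2)
  by (auto simp: nth_append)

lemma act_short: "w \<in> words \<Longrightarrow> \<not> Suc i < length w \<Longrightarrow> act i (monomial w) = monomial w"
  unfolding act_def by (simp add: extend_monomial)

lemma gen_gen_tpow: "gen x * gen y \<in> tpow 2"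
  using monomial_in_tpow[of "[x, y]" 2] by simp

text \<open>\<open>act\<close> is defined through words in \<open>B\<close>. Both sides are linear
  in each of the three factors, so the formula passes from words to all tensors and becomes
  independent of the basis.\<close>

lemma act_mult:
  assumes "p \<in> tpow i" "t \<in> tpow 2"
  shows "act i (p * t * x) = p * \<Psi> t * x"
proof -
  note act = qlinear_add[OF qlinear_act] qlinear_scale[OF qlinear_act]
  note algebra = distrib_left distrib_right scaleq_mult_left scaleq_mult_right
  have \<Psi>: "a \<in> tpow 2 \<Longrightarrow> b \<in> tpow 2 \<Longrightarrow> \<Psi> (a + b) = \<Psi> a + \<Psi> b"
      "a \<in> tpow 2 \<Longrightarrow> \<Psi> (c *\<^sub>q a) = c *\<^sub>q \<Psi> a" for a b c
    using linear unfolding linear_map_on_def by blast+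
  have 1: "act i (monomial u * t * monomial v) = monomial u * \<Psi> t * monomial v"
    if u: "u \<in> words" "length u = i" and v: "v \<in> words" for u v
  proof (rule linear_map_on_eq[where V = "tpow 2" and S = "monomial ` words_of_length 2"
        and F = "\<lambda>t. act i (monomial u * t * monomial v)" and G = "\<lambda>t. monomial u * \<Psi> t * monomial v"])
    show "linear_map_on (tpow 2) (\<lambda>t. act i (monomial u * t * monomial v))"
      by (simp add: linear_map_on_def algebra act)
    show "linear_map_on (tpow 2) (\<lambda>t. monomial u * \<Psi> t * monomial v)"
      by (simp add: linear_map_on_def algebra \<Psi>)
    show "qv.subspace (tpow 2)" by (rule subspace_tpow)
    show "monomial ` words_of_length 2 \<subseteq> tpow 2"
      by (auto simp: words_of_length_iff intro: monomial_in_tpow)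
    show "t \<in> qv.span (monomial ` words_of_length 2)"
      using assms(2) by (simp add: tpow_eq_span)
    fix s assume "s \<in> monomial ` words_of_length 2"
    then have "s \<in> (\<lambda>(a, b). gen a * gen b) ` (B \<times> B)" by (simp only: pair_monomials)
    then obtain a b where s: "s = gen a * gen b" "a \<in> B" "b \<in> B" by auto
    have "act i (monomial (u @ a # b # v)) = monomial u * \<Psi> (gen a * gen b) * monomial v"
      by (rule act_monomial) (use u v s in auto)
    then show "act i (monomial u * s * monomial v) = monomial u * \<Psi> s * monomial v"
      by (simp add: s mult.assoc)
  qed
  have 2: "act i (monomial u * t * x) = monomial u * \<Psi> t * x"
    if u: "u \<in> words" "length u = i" for u
  proof (rule qvp.linear_eq_on[where f = "\<lambda>x. act i (monomial u * t * x)"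
        and g = "\<lambda>x. monomial u * \<Psi> t * x"])
    show "qlinear (\<lambda>x. act i (monomial u * t * x))" by (rule qlinearI) (simp_all add: algebra act)
    show "qlinear (\<lambda>x. monomial u * \<Psi> t * x)" by (rule qlinearI) (simp_all add: algebra)
    show "x \<in> qv.span (monomial ` words)" by (simp add: span_words)
  qed (use 1[OF u] in blast)
  show ?thesis
  proof (rule qvp.linear_eq_on[where f = "\<lambda>p. act i (p * t * x)" and g = "\<lambda>p. p * \<Psi> t * x"])
    show "qlinear (\<lambda>p. act i (p * t * x))" by (rule qlinearI) (simp_all add: algebra act)
    show "qlinear (\<lambda>p. p * \<Psi> t * x)" by (rule qlinearI) (simp_all add: algebra)
    show "p \<in> qv.span (monomial ` words_of_length i)" using assms(1) by (simp add: tpow_eq_span)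
  qed (use 2 in \<open>auto simp: words_of_length_iff\<close>)
qed

lemma one_tpow_0: "1 \<in> tpow 0"
  using monomial_in_tpow[of "[]" 0] by simp

lemma act_0: "t \<in> tpow 2 \<Longrightarrow> act 0 (t * x) = \<Psi> t * x"
  using act_mult[OF one_tpow_0, of t x] by simp

lemma act_0_eq: "t \<in> tpow 2 \<Longrightarrow> act 0 t = \<Psi> t"
  using act_0[of t 1] by simp

lemma gen_tpow_1: "gen y \<in> tpow 1"
  using monomial_in_tpow[of "[y]" 1] by simp

lemma act_1: "t \<in> tpow 2 \<Longrightarrow> act 1 (gen y * t * x) = gen y * \<Psi> t * x"
  using act_mult[OF gen_tpow_1, of t y x] by simp

lemma
  shows acts_on_12_act: "acts_on_12 \<Psi> (act 0)"
    and acts_on_23_act: "acts_on_23 \<Psi> (act 1)"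
  using act_0 act_1[where x = 1]
  by (simp_all add: acts_on_12_def acts_on_23_def linear_map_on_def
      qlinear_add[OF qlinear_act] qlinear_scale[OF qlinear_act])

lemma word_splitE:
  assumes "Suc i < length w"
  obtains u x y v where "w = u @ x # y # v" "length u = i"
proof
  show "w = take i w @ (w ! i) # (w ! Suc i) # drop (Suc (Suc i)) w"
    using assms by (simp add: Cons_nth_drop_Suc)
  show "length (take i w) = i" using assms by simp
qed

lemma act_word_tpow:
  assumes "w \<in> words"
  shows "act i (monomial w) \<in> tpow (length w)"
proof (cases "Suc i < length w")
  case True
  then obtain u x y v where w: "w = u @ x # y # v" "length u = i" by (rule word_splitE)
  have "monomial u * \<Psi> (gen x * gen y) * monomial v \<in> tpow (length u + 2 + length v)"
    by (intro tpow_mult into gen_gen_tpow monomial_in_tpow refl)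
  then show ?thesis using act_monomial[of u x y v i] assms w by simp
qed (simp add: act_short assms monomial_in_tpow)

lemma act_tpow:
  assumes "x \<in> tpow k"
  shows "act i x \<in> tpow k"
proof -
  have "act i x \<in> act i ` qv.span (monomial ` words_of_length k)"
    using assms by (simp add: tpow_eq_span)
  also have "\<dots> = qv.span (act i ` monomial ` words_of_length k)"
    by (rule qvp.linear_span_image[OF qlinear_act, symmetric])
  also have "\<dots> \<subseteq> tpow k"
    by (rule qv.span_minimal)
       (use act_word_tpow in \<open>auto simp: words_of_length_iff intro: subspace_tpow\<close>)
  finally show ?thesis .
qed

text \<open>Transports identities in the third tensor power, in particular the braid equation, to
  three consecutive positions of a longer tensor.\<close>

lemma act_mult_cube:
  assumes "p \<in> tpow i" "t \<in> tpow 3"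
  shows "act i (p * t * x) = p * act 0 t * x" and "act (Suc i) (p * t * x) = p * act 1 t * x"
proof -
  note act = qlinear_add[OF qlinear_act] qlinear_scale[OF qlinear_act]
  note algebra = distrib_left distrib_right scaleq_mult_left scaleq_mult_right
  have t: "t \<in> qv.span (monomial ` words_of_length 3)" using assms(2) by (simp add: tpow_eq_span)
  have w3: "\<exists>a b c. w = [a, b, c]" if "w \<in> words_of_length 3" for w
    using that by (auto simp: words_of_length_iff numeral_3_eq_3 length_Suc_conv)
  show "act i (p * t * x) = p * act 0 t * x"
  proof (rule qvp.linear_eq_on[where f = "\<lambda>t. act i (p * t * x)" and g = "\<lambda>t. p * act 0 t * x", OF _ _ t])
    show "qlinear (\<lambda>t. act i (p * t * x))" "qlinear (\<lambda>t. p * act 0 t * x)"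
      by (rule qlinearI; simp add: algebra act)+
    fix s assume "s \<in> monomial ` words_of_length 3"
    then obtain a b c where s: "s = (gen a * gen b) * gen c" using w3 by (fastforce simp: mult.assoc)
    have "act i (p * (gen a * gen b) * (gen c * x)) = p * \<Psi> (gen a * gen b) * (gen c * x)"
      by (rule act_mult[OF assms(1) gen_gen_tpow])
    then show "act i (p * s * x) = p * act 0 s * x"
      unfolding s act_0[OF gen_gen_tpow] by (simp add: mult.assoc)
  qed
  show "act (Suc i) (p * t * x) = p * act 1 t * x"
  proof (rule qvp.linear_eq_on[where f = "\<lambda>t. act (Suc i) (p * t * x)" and g = "\<lambda>t. p * act 1 t * x", OF _ _ t])
    show "qlinear (\<lambda>t. act (Suc i) (p * t * x))" "qlinear (\<lambda>t. p * act 1 t * x)"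
      by (rule qlinearI; simp add: algebra act)+
    fix s assume "s \<in> monomial ` words_of_length 3"
    then obtain a b c where s: "s = gen a * (gen b * gen c) * 1" using w3 by fastforce
    \<comment> \<open>The first letter of the cube joins the prefix, which raises the position by
      one.\<close>
    have "p * gen a \<in> tpow (Suc i)" using tpow_mult[OF assms(1) gen_tpow_1] by simp
    then have "act (Suc i) ((p * gen a) * (gen b * gen c) * x) = (p * gen a) * \<Psi> (gen b * gen c) * x"
      by (rule act_mult[OF _ gen_gen_tpow])
    then show "act (Suc i) (p * s * x) = p * act 1 s * x"
      unfolding s act_1[OF gen_gen_tpow] by (simp add: mult.assoc)
  qed
qed

text \<open>The operators touch disjoint pairs of factors. As \<Psi> preserves the degree, applying
  it to the left pair leaves a prefix of degree \<open>j\<close> in front of the right pair.\<close>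

lemma act_commute:
  assumes "u @ x # y # v @ a # b # z \<in> words" "length u = i" "length (u @ x # y # v) = j"
  shows "act i (act j (monomial (u @ x # y # v @ a # b # z))) =
    act j (act i (monomial (u @ x # y # v @ a # b # z)))"
proof -
  have j: "monomial u * s * monomial v \<in> tpow j" and i: "monomial u \<in> tpow i" if "s \<in> tpow 2" for s
    using assms(2,3) tpow_mult[OF tpow_mult[OF monomial_in_tpow[of u i] that] monomial_in_tpow[of v "length v"]]
    by (simp_all add: monomial_in_tpow)
  have 1: "act j (monomial u * s * monomial v * r * monomial z) = monomial u * s * monomial v * \<Psi> r * monomial z"
    if "s \<in> tpow 2" "r \<in> tpow 2" for s r
    by (rule act_mult[OF j that(2)]) (rule that)
  have 2: "act i (monomial u * s * monomial v * r * monomial z) = monomial u * \<Psi> s * monomial v * r * monomial z"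
    if "s \<in> tpow 2" for s r
    using act_mult[OF i[OF that] that, where x = "monomial v * r * monomial z"] that by (simp add: mult.assoc)
  have w: "monomial (u @ x # y # v @ a # b # z) =
      monomial u * (gen x * gen y) * monomial v * (gen a * gen b) * monomial z"
    by (simp add: mult.assoc)
  show ?thesis
    unfolding w by (simp add: 1 2 gen_gen_tpow into del: prod_list.append)
qed

section \<open>The defining ideal as the span of the relations at all positions of all words\<close>

definition rel :: "nat \<Rightarrow> 'y list \<Rightarrow> 'y tensor_algebra" where
  "rel i w = act i (monomial w) - monomial w"

definition rels :: "'y tensor_algebra set" where
  "rels = {rel i w | i w. w \<in> words}"

lemma rel_in_rels: "w \<in> words \<Longrightarrow> rel i w \<in> rels"
  by (auto simp: rels_def)

lemma rel_eq:
  assumes "u @ x # y # v \<in> words" "length u = i"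
  shows "rel i (u @ x # y # v) = monomial u * (\<Psi> (gen x * gen y) - gen x * gen y) * monomial v"
  unfolding rel_def act_monomial[OF assms] by (simp add: algebra_simps)

text \<open>Out of range \<open>act\<close> is the identity by default, so such a relation is zero
  and \<open>rels\<close> can admit every position.\<close>

lemma rel_short: "w \<in> words \<Longrightarrow> \<not> Suc i < length w \<Longrightarrow> rel i w = 0"
  by (simp add: rel_def act_short)

text \<open>Multiplying a relation by a word on the left shifts its position by the length of the
  word; multiplying on the right only prolongs the tail. Either product is again a relation.\<close>

lemma two_sided_ideal_span_rels: "two_sided_ideal (qv.span rels)"
proof -
  have left: "monomial p * rel i w \<in> qv.span rels" if "p \<in> words" "w \<in> words" for p i w
  proof (cases "Suc i < length w")
    case True
    then obtain u x y v where w: "w = u @ x # y # v" "length u = i" by (rule word_splitE)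
    let ?r = "\<Psi> (gen x * gen y) - gen x * gen y"
    have "rel (length p + i) ((p @ u) @ x # y # v) = monomial (p @ u) * ?r * monomial v"
      by (rule rel_eq) (use that w in auto)
    moreover have "rel i (u @ x # y # v) = monomial u * ?r * monomial v"
      by (rule rel_eq) (use that w in auto)
    ultimately have "monomial p * rel i w = rel (length p + i) ((p @ u) @ x # y # v)"
      unfolding w(1) by (simp only: prod_list.append map_append mult.assoc)
    then show ?thesis using that w by (auto intro!: qv.span_base rel_in_rels)
  qed (use that in \<open>simp add: rel_short qv.span_zero\<close>)
  have right: "rel i w * monomial p \<in> qv.span rels" if "p \<in> words" "w \<in> words" for p i w
  proof (cases "Suc i < length w")
    case True
    then obtain u x y v where w: "w = u @ x # y # v" "length u = i" by (rule word_splitE)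
    let ?r = "\<Psi> (gen x * gen y) - gen x * gen y"
    have "rel i (u @ x # y # (v @ p)) = monomial u * ?r * monomial (v @ p)"
      by (rule rel_eq) (use that w in auto)
    moreover have "rel i (u @ x # y # v) = monomial u * ?r * monomial v"
      by (rule rel_eq) (use that w in auto)
    ultimately have "rel i w * monomial p = rel i (u @ x # y # (v @ p))"
      unfolding w(1) by (simp only: prod_list.append map_append mult.assoc)
    then show ?thesis using that w by (auto intro!: qv.span_base rel_in_rels)
  qed (use that in \<open>simp add: rel_short qv.span_zero\<close>)
  have "a * x \<in> qv.span rels" if "x \<in> qv.span rels" for a x
    by (rule span_mult[where S = "monomial ` words" and U = rels])
       (use that left in \<open>auto simp: span_words rels_def\<close>)
  moreover have "x * a \<in> qv.span rels" if "x \<in> qv.span rels" for a x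
    by (rule span_mult[where U = "monomial ` words" and S = rels])
       (use that right in \<open>auto simp: span_words rels_def\<close>)
  ultimately show ?thesis
    by (simp add: two_sided_ideal_def qv.span_zero qv.span_add)
qed

lemma pair_relation_in_rels:
  assumes "x \<in> B" "y \<in> B"
  shows "\<Psi> (gen x * gen y) - gen x * gen y \<in> rels"
proof -
  have "rel 0 [x, y] = \<Psi> (gen x * gen y) - gen x * gen y"
    using rel_eq[of "[]" x y "[]"] assms by simp
  moreover have "rel 0 [x, y] \<in> rels" by (rule rel_in_rels) (simp add: assms)
  ultimately show ?thesis by simp
qed

text \<open>Stated for an arbitrary generating set because it serves twice: for the image of \<Psi>
  - 1 and for the commutators that define the symmetric algebra.\<close>

lemma ideal_eq_span_rels:
  assumes pairs: "\<And>x y. x \<in> B \<Longrightarrow> y \<in> B \<Longrightarrow> \<Psi> (gen x * gen y) - gen x * gen y \<in> ideal_generated S"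
    and S: "S \<subseteq> qv.span rels"
  shows "ideal_generated S = qv.span rels"
proof
  show "ideal_generated S \<subseteq> qv.span rels"
    by (rule hull_minimal) (use S two_sided_ideal_span_rels in auto)
  have I: "two_sided_ideal (ideal_generated S)" by (rule two_sided_ideal_hull)
  have "rel i w \<in> ideal_generated S" if "w \<in> words" for i w
  proof (cases "Suc i < length w")
    case True
    then obtain u x y v where w: "w = u @ x # y # v" "length u = i" by (rule word_splitE)
    then have "\<Psi> (gen x * gen y) - gen x * gen y \<in> ideal_generated S" using that by (auto intro: pairs)
    then show ?thesis
      using I that w(2) unfolding w(1) by (subst rel_eq) (auto simp: two_sided_ideal_def)
  qed (use that I in \<open>simp add: rel_short two_sided_ideal_def\<close>)
  then show "qv.span rels \<subseteq> ideal_generated S"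
    by (intro qv.span_minimal two_sided_ideal_subspace[OF I]) (auto simp: rels_def)
qed

lemma relations_subset_span: "relations \<Psi> \<subseteq> qv.span ((\<lambda>(x, y). \<Psi> (gen x * gen y) - gen x * gen y) ` (B \<times> B))"
proof clarify
  fix t :: "'y tensor_algebra" assume t: "t \<in> tpow 2"
  \<comment> \<open>\<open>act 0\<close> agrees with \<Psi> on \<open>tpow 2\<close> but is linear
    everywhere, so results on images of spans apply to it.\<close>
  let ?f = "\<lambda>t. act 0 t - t"
  have "qlinear ?f"
    by (rule qlinearI) (simp_all add: qlinear_add[OF qlinear_act] qlinear_scale[OF qlinear_act] qv.scale_right_diff_distrib)
  then have "?f t \<in> qv.span (?f ` monomial ` words_of_length 2)"
    using t by (simp add: tpow_eq_span qvp.linear_span_image)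
  also have "?f ` monomial ` words_of_length 2 = (\<lambda>(x, y). \<Psi> (gen x * gen y) - gen x * gen y) ` (B \<times> B)"
    unfolding pair_monomials[symmetric] image_image
    by (rule image_cong) (auto simp: act_0_eq gen_gen_tpow)
  finally show "\<Psi> t - t \<in> qv.span ((\<lambda>(x, y). \<Psi> (gen x * gen y) - gen x * gen y) ` (B \<times> B))"
    using t by (simp add: act_0_eq)
qed

lemma braided_ideal_eq_span: "braided_ideal \<Psi> = qv.span rels"
  unfolding braided_ideal_def
proof (rule ideal_eq_span_rels)
  show "\<Psi> (gen x * gen y) - gen x * gen y \<in> ideal_generated (relations \<Psi>)" for x y
    by (rule hull_inc) (use gen_gen_tpow in blast)
  have "(\<lambda>(x, y). \<Psi> (gen x * gen y) - gen x * gen y) ` (B \<times> B) \<subseteq> rels"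
    using pair_relation_in_rels by auto
  then show "relations \<Psi> \<subseteq> qv.span rels"
    using relations_subset_span qv.span_mono by blast
qed

end


section \<open>Sorting words and lifting syzygies\<close>

text \<open>Each letter counts its rank once for every letter from itself to the end. Exchanging the
  letters of a descent lowers the sum by the difference of their ranks, which makes sorting
  terminate.\<close>

primrec weight :: "('y \<Rightarrow> nat) \<Rightarrow> 'y list \<Rightarrow> nat" where
  "weight rk [] = 0"
| "weight rk (x # w) = Suc (length w) * rk x + weight rk w"

definition swap_at :: "nat \<Rightarrow> 'y list \<Rightarrow> 'y list" where
  "swap_at i w =
     (if Suc i < length w then take i w @ w ! Suc i # w ! i # drop (Suc (Suc i)) w else w)"

definition descent :: "('y \<Rightarrow> nat) \<Rightarrow> nat \<Rightarrow> 'y list \<Rightarrow> bool" where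
  "descent rk i w \<longleftrightarrow> Suc i < length w \<and> rk (w ! Suc i) < rk (w ! i)"

lemma swap_at_append [simp]: "swap_at (length u) (u @ x # y # v) = u @ y # x # v"
  by (simp add: swap_at_def nth_append)

lemma swap_at_append_Suc [simp]: "swap_at (Suc (length u)) (u @ z # x # y # v) = u @ z # y # x # v"
  using swap_at_append[of "u @ [z]" x y v] by (simp del: swap_at_append)

lemma swap_at_short: "\<not> Suc i < length w \<Longrightarrow> swap_at i w = w"
  by (simp add: swap_at_def)

lemma descent_append [simp]: "descent rk (length u) (u @ x # y # v) \<longleftrightarrow> rk y < rk x"
  by (simp add: descent_def nth_append)

lemma descent_append_Suc [simp]: "descent rk (Suc (length u)) (u @ z # x # y # v) \<longleftrightarrow> rk y < rk x"
  using descent_append[of rk "u @ [z]" x y v] by (simp del: descent_append)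

lemma mset_swap_at [simp]: "mset (swap_at i w) = mset w"
proof (cases "Suc i < length w")
  case True
  then have "w = take i w @ w ! i # w ! Suc i # drop (Suc (Suc i)) w"
    by (simp add: Cons_nth_drop_Suc)
  then have "mset w = mset (take i w @ w ! i # w ! Suc i # drop (Suc (Suc i)) w)" by simp
  then show ?thesis using True by (simp add: swap_at_def)
qed (simp add: swap_at_short)

lemma set_swap_at [simp]: "set (swap_at i w) = set w"
  by (metis mset_swap_at set_mset_mset)

lemma length_swap_at [simp]: "length (swap_at i w) = length w"
  by (metis mset_swap_at size_mset)

lemma weight_append: "weight rk (u @ v) = weight rk u + length v * sum_list (map rk u) + weight rk v"
  by (induction u) (simp_all add: algebra_simps)

lemma weight_swap_at:
  assumes "descent rk i w"
  shows "weight rk (swap_at i w) < weight rk w"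
proof -
  define u x y v where "u = take i w" "x = w ! i" "y = w ! Suc i" "v = drop (Suc (Suc i)) w"
  have l: "Suc i < length w" using assms by (simp add: descent_def)
  then have w: "w = u @ x # y # v" "length u = i"
    by (simp_all add: u_x_y_v_def Cons_nth_drop_Suc)
  have "rk y < rk x" using assms by (simp add: descent_def u_x_y_v_def)
  then show ?thesis
    unfolding w(2)[symmetric] w(1) swap_at_append by (simp add: weight_append algebra_simps)
qed

lemma sorted_no_descent:
  "sorted (map rk w) \<longleftrightarrow> (\<forall>i. \<not> descent rk i w)"
proof -
  have "descent rk i w \<longleftrightarrow> \<not> (Suc i < length w \<longrightarrow> map rk w ! i \<le> map rk w ! Suc i)" for i
    by (auto simp: descent_def)
  then show ?thesis unfolding sorted_iff_nth_Suc length_map by simp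
qed

text \<open>With injective ranks the sorted list depends only on the multiset of letters; stability
  of the sort plays no part then.\<close>

lemma sort_key_swap_at:
  assumes "inj_on rk (set w)"
  shows "sort_key rk (swap_at i w) = sort_key rk w"
  by (rule sort_key_inj_key_eq) (use assms in simp_all)

text \<open>Separated from the next locale because the lifting of symmetric tensors assumed there is
  derived from the dimension hypothesis in this setting.\<close>

locale flip_quadratic = quadratic B \<Psi>
  for B :: "'y::cq_vector_space set" and \<Psi> :: "'y tensor_algebra \<Rightarrow> 'y tensor_algebra" +
  fixes rk :: "'y \<Rightarrow> nat"
  assumes fin: "finite B"
    and inj_rk: "inj_on rk B"
    and flip: "x \<in> B \<Longrightarrow> y \<in> B \<Longrightarrow> \<Psi> (gen x * gen y) - gen y * gen x \<in> maxspan (monomial ` words)"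

locale flat_quadratic = flip_quadratic B \<Psi> rk
  for B :: "'y::cq_vector_space set" and \<Psi> :: "'y tensor_algebra \<Rightarrow> 'y tensor_algebra" and rk +
  assumes braid: "t \<in> tpow 3 \<Longrightarrow> act 0 (act 1 (act 0 t)) = act 1 (act 0 (act 1 t))"
    and lift_invariant: "x \<in> B \<Longrightarrow> y \<in> B \<Longrightarrow>
      \<exists>s\<in>tpow 2. \<Psi> s = s \<and> gen x * gen y + gen y * gen x - s \<in> maxspan (monomial ` words)"
begin

abbreviation lattice :: "'y tensor_algebra set" where "lattice \<equiv> rspan (monomial ` words)"
abbreviation lattice0 :: "'y tensor_algebra set" where "lattice0 \<equiv> maxspan (monomial ` words)"

lemma swap_at_words [simp]: "swap_at i w \<in> words \<longleftrightarrow> w \<in> words"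
  by (simp add: words_def)

lemma monomial_in_lattice: "w \<in> words \<Longrightarrow> monomial w \<in> lattice"
  by (blast intro: rspan_superset)

lemma sandwich_lattice0:
  assumes "z \<in> lattice0" "u \<in> words" "v \<in> words"
  shows "monomial u * z * monomial v \<in> lattice0"
proof (rule maxspan_linear_image[where f = "\<lambda>z. monomial u * z * monomial v", OF _ _ assms(1)])
  show "qlinear (\<lambda>z. monomial u * z * monomial v)"
    by (rule qlinearI) (simp_all add: distrib_left distrib_right scaleq_mult_left scaleq_mult_right)
  fix s assume "s \<in> monomial ` words"
  then obtain w where w: "s = monomial w" "w \<in> words" by blast
  have "monomial u * s * monomial v = monomial (u @ w @ v)" using w(1) by (simp add: mult.assoc)
  also have "\<dots> \<in> lattice" by (rule monomial_in_lattice) (use assms w in simp)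
  finally show "monomial u * s * monomial v \<in> lattice" .
qed

lemma act_swap:
  assumes "w \<in> words"
  shows "act i (monomial w) - monomial (swap_at i w) \<in> lattice0"
proof (cases "Suc i < length w")
  case True
  then obtain u x y v where w: "w = u @ x # y # v" "length u = i" by (rule word_splitE)
  then have B: "x \<in> B" "y \<in> B" "u \<in> words" "v \<in> words" using assms by auto
  have s: "swap_at i w = u @ y # x # v" using w by auto
  have "act i (monomial w) = monomial u * \<Psi> (gen x * gen y) * monomial v"
    using act_monomial[of u x y v i] w assms by simp
  moreover have "monomial (swap_at i w) = monomial u * (gen y * gen x) * monomial v"
    unfolding s by (simp add: mult.assoc)
  ultimately have "act i (monomial w) - monomial (swap_at i w) =
      monomial u * (\<Psi> (gen x * gen y) - gen y * gen x) * monomial v"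
    by (simp only: left_diff_distrib right_diff_distrib)
  then show ?thesis using sandwich_lattice0[OF flip[OF B(1,2)] B(3,4)] by simp
next
  case False
  then show ?thesis using assms by (simp add: act_short swap_at_short maxspan_zero)
qed

lemma act_in_lattice: "s \<in> monomial ` words \<Longrightarrow> act i s \<in> lattice"
proof -
  assume "s \<in> monomial ` words"
  then obtain w where w: "s = monomial w" "w \<in> words" by blast
  have "act i s - monomial (swap_at i w) \<in> lattice"
    using act_swap[OF w(2)] w(1) maxspan_subset_rspan by blast
  then have "(act i s - monomial (swap_at i w)) + monomial (swap_at i w) \<in> lattice"
    by (rule rspan_add) (simp add: monomial_in_lattice w)
  then show ?thesis by simp
qed

lemma act_lattice0: "z \<in> lattice0 \<Longrightarrow> act i z \<in> lattice0"
  using maxspan_linear_image[OF qlinear_act act_in_lattice] by blast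

lemma qlinear_act_diff: "qlinear (\<lambda>z. act i z - z)"
  by (rule qlinearI)
     (simp_all add: qlinear_add[OF qlinear_act] qlinear_scale[OF qlinear_act] qv.scale_right_diff_distrib)

lemma act_diff_rels: "z \<in> lattice0 \<Longrightarrow> act i z - z \<in> maxspan rels"
proof (rule maxspan_linear_image[OF qlinear_act_diff])
  fix s assume "s \<in> monomial ` words"
  then show "act i s - s \<in> rspan rels"
    using rel_in_rels by (auto simp: rel_def intro!: rspan_superset)
qed

text \<open>An element congruent to a word at q = 1 may be replaced by that word, both in its image
  and in the relation that it produces. This turns identities between products of operators into
  identities between relations of words.\<close>

lemma act_approx:
  assumes "w \<in> words" "z - monomial w \<in> lattice0"
  shows "act i z - monomial (swap_at i w) \<in> lattice0"
    and "act i z - z - rel i w \<in> maxspan rels"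
proof -
  have "act i z - monomial (swap_at i w) =
      act i (z - monomial w) + (act i (monomial w) - monomial (swap_at i w))"
    by (simp add: qlinear_diff[OF qlinear_act])
  then show "act i z - monomial (swap_at i w) \<in> lattice0"
    using act_lattice0[OF assms(2), of i] act_swap[OF assms(1), of i] by (simp only: maxspan_add)
  have "act i z - z - rel i w = act i (z - monomial w) - (z - monomial w)"
    by (simp add: qlinear_diff[OF qlinear_act] rel_def)
  then show "act i z - z - rel i w \<in> maxspan rels"
    using act_diff_rels[OF assms(2), of i] by (simp only:)
qed

text \<open>The lift of (s_i - 1)(s_i + 1) = 0. The fixed tensor \<open>s\<close> contributes
  nothing to \<open>act i\<close> minus the identity, so only the error \<open>?z\<close> between
  the symmetric tensor and its lift remains, and that error is divisible by h.\<close>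

lemma rel_swap_sum:
  assumes "w \<in> words"
  shows "rel i w + rel i (swap_at i w) \<in> maxspan rels"
proof (cases "Suc i < length w")
  case True
  then obtain u x y v where w: "w = u @ x # y # v" "length u = i" by (rule word_splitE)
  then have B: "x \<in> B" "y \<in> B" "u \<in> words" "v \<in> words" using assms by auto
  obtain s where s: "s \<in> tpow 2" "\<Psi> s = s" "gen x * gen y + gen y * gen x - s \<in> lattice0"
    using lift_invariant[OF B(1,2)] by blast
  let ?z = "monomial u * (gen x * gen y + gen y * gen x - s) * monomial v"
  have m: "monomial w = monomial u * (gen x * gen y) * monomial v"
    "monomial (swap_at i w) = monomial u * (gen y * gen x) * monomial v"
    using w by (auto simp: mult.assoc)
  have "act i (monomial u * s * monomial v) = monomial u * s * monomial v"
    using act_mult[of "monomial u" i s "monomial v"] s w monomial_in_tpow[of u i] by simp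
  moreover have "?z = monomial w + monomial (swap_at i w) - monomial u * s * monomial v"
    unfolding m by (simp only: left_diff_distrib right_diff_distrib distrib_left distrib_right)
  ultimately have "rel i w + rel i (swap_at i w) = act i ?z - ?z"
    by (simp add: rel_def qlinear_diff[OF qlinear_act] qlinear_add[OF qlinear_act])
  then show ?thesis
    using act_diff_rels[OF sandwich_lattice0[OF s(3) B(3,4)], of i] by (simp only:)
next
  case False
  then show ?thesis using assms by (simp add: rel_short swap_at_short maxspan_zero)
qed

text \<open>Subtracting \<open>monomial w\<close> from the two equal products of operators and
  telescoping each gives one relation per factor.\<close>

lemma rel_commute:
  assumes w: "w \<in> words" and wd: "w = u @ x # y # v @ a # b # z"
    and i: "i = length u" and j: "j = length (u @ x # y # v)"
  shows "(rel i w + rel j (swap_at i w)) - (rel j w + rel i (swap_at j w)) \<in> maxspan rels"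
proof -
  have 1: "act i' (act j' (monomial w)) - monomial w - (rel j' w + rel i' (swap_at j' w)) \<in> maxspan rels" for i' j'
    using act_approx(2)[of "swap_at j' w" "act j' (monomial w)" i'] act_swap[OF w, of j'] w
    by (simp add: rel_def algebra_simps)
  have "act i (act j (monomial w)) = act j (act i (monomial w))"
    unfolding wd by (rule act_commute) (use w wd i j in auto)
  then show ?thesis
    using maxspan_diff[OF 1[of i j] 1[of j i]] by (simp add: algebra_simps)
qed

text \<open>The six relations sit on the edges of the hexagon of rearrangements of three adjacent
  letters.\<close>

lemma rel_braid:
  assumes w: "w \<in> words" and wd: "w = u @ x # y # z # v" and i: "i = length u"
  shows "(rel i w + rel (Suc i) (swap_at i w) + rel i (swap_at (Suc i) (swap_at i w))) -
    (rel (Suc i) w + rel i (swap_at (Suc i) w) + rel (Suc i) (swap_at i (swap_at (Suc i) w))) \<in> maxspan rels"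
proof -
  \<comment> \<open>ABA - 1 = (A - 1)BA + (B - 1)A + (A - 1), and each summand is congruent to a
    relation of the word reached so far.\<close>
  have 1: "act i' (act j' (act i' (monomial w))) - monomial w -
      (rel i' w + rel j' (swap_at i' w) + rel i' (swap_at j' (swap_at i' w))) \<in> maxspan rels" for i' j'
  proof -
    let ?z = "act i' (monomial w)"
    have a: "?z - monomial (swap_at i' w) \<in> lattice0" by (rule act_swap[OF w])
    have b: "act j' ?z - monomial (swap_at j' (swap_at i' w)) \<in> lattice0"
      by (rule act_approx(1)[OF _ a]) (simp add: w)
    have c: "act j' ?z - ?z - rel j' (swap_at i' w) \<in> maxspan rels"
      by (rule act_approx(2)[OF _ a]) (simp add: w)
    have d: "act i' (act j' ?z) - act j' ?z - rel i' (swap_at j' (swap_at i' w)) \<in> maxspan rels"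
      by (rule act_approx(2)[OF _ b]) (simp add: w)
    show ?thesis using maxspan_add[OF c d] by (simp add: rel_def algebra_simps)
  qed
  have "monomial [x, y, z] \<in> tpow 3" by (rule monomial_in_tpow) simp
  note t = this act_tpow[OF this] act_tpow[OF act_tpow[OF this]]
  have p: "monomial u \<in> tpow i" using monomial_in_tpow i by blast
  have m: "monomial w = monomial u * monomial [x, y, z] * monomial v"
    unfolding wd by (simp add: mult.assoc)
  have "act i (act (Suc i) (act i (monomial w))) = act (Suc i) (act i (act (Suc i) (monomial w)))"
    unfolding m by (simp only: act_mult_cube[OF p] t braid)
  then show ?thesis using maxspan_diff[OF 1[of "Suc i" i] 1[of i "Suc i"]] by (simp add: algebra_simps)
qed

text \<open>Telescoping sum of the relations along a path of adjacent transpositions from a word to its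
  sorted rearrangement. Modulo \<open>maxspan rels\<close> it does not depend on the path.\<close>

function path :: "'y list \<Rightarrow> 'y tensor_algebra" where
  "path w = (if sorted (map rk w) then 0
     else rel (LEAST i. descent rk i w) w + path (swap_at (LEAST i. descent rk i w) w))"
  by auto
termination
proof (relation "measure (weight rk)")
  fix w assume "\<not> sorted (map rk w)"
  then have "descent rk (LEAST i. descent rk i w) w"
    unfolding sorted_no_descent by (meson LeastI)
  then show "(swap_at (LEAST i. descent rk i w) w, w) \<in> measure (weight rk)"
    by (simp add: weight_swap_at)
qed simp

declare path.simps [simp del]

section \<open>Independence of the sorting path\<close>

lemma path_sorted: "sorted (map rk w) \<Longrightarrow> path w = 0"
  by (subst path.simps) simp

text \<open>The definition takes the leftmost descent; from here on only the existence of some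
  chosen descent is used.\<close>

lemma path_unsorted:
  assumes "descent rk j w"
  obtains i where "descent rk i w" "path w = rel i w + path (swap_at i w)"
proof -
  have "\<not> sorted (map rk w)" using assms sorted_no_descent by blast
  then have "path w = rel (LEAST i. descent rk i w) w + path (swap_at (LEAST i. descent rk i w) w)"
    by (subst path.simps) simp
  then show ?thesis using that LeastI[of "\<lambda>i. descent rk i w", OF assms] by blast
qed

lemma path_in_rspan: "w \<in> words \<Longrightarrow> path w \<in> rspan rels"
proof (induction w rule: measure_induct_rule[where f = "weight rk"])
  case (less w)
  show ?case
  proof (cases "sorted (map rk w)")
    case True
    then show ?thesis by (simp add: path_sorted rspan_zero)
  next
    case False
    then obtain j where "descent rk j w" using sorted_no_descent by blast
    then obtain i where i: "descent rk i w" "path w = rel i w + path (swap_at i w)"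
      by (rule path_unsorted)
    have "path (swap_at i w) \<in> rspan rels" using less weight_swap_at[OF i(1)] by simp
    then show ?thesis unfolding i(2)
      by (rule rspan_add[OF rspan_superset[OF rel_in_rels[OF less.prems]]])
  qed
qed

text \<open>Confluence by induction on the weight: two descents are either adjacent or disjoint, and
  a hexagon or a square of swaps leads from both to a common word. The lifted syzygies say that the
  two routes agree modulo h.\<close>

lemma path_descent:
  assumes "w \<in> words" "descent rk j w"
  shows "path w - (rel j w + path (swap_at j w)) \<in> maxspan rels"
  using assms
proof (induction w arbitrary: j rule: measure_induct_rule[where f = "weight rk"])
  case (less w)
  note IH = less.IH[OF weight_swap_at]
  have confluent: "(rel i w + path (swap_at i w)) - (rel j w + path (swap_at j w)) \<in> maxspan rels"
    if i: "descent rk i w" and j: "descent rk j w" and "i < j" for i j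
  proof -
    have wi: "swap_at i w \<in> words" and wj: "swap_at j w \<in> words" using less.prems by simp_all
    obtain u x y v where w: "w = u @ x # y # v" "length u = i"
      using i by (auto simp: descent_def elim: word_splitE)
    show ?thesis
    proof (cases "j = Suc i")
      case True
      then obtain z v' where v: "v = z # v'"
        using j w by (cases v) (auto simp: descent_def)
      have r: "rk z < rk y" "rk y < rk x"
        using i j unfolding True w(2)[symmetric] w(1) v by simp_all
      \<comment> \<open>The words two edges along either side of the hexagon. One more swap takes
        both to the word in which the three letters are reversed.\<close>
      define w1 w2 where "w1 = swap_at j (swap_at i w)" and "w2 = swap_at i (swap_at j w)"
      have e: "swap_at i w1 = swap_at j w2"
        unfolding w1_def w2_def True w(2)[symmetric] w(1) v by simp
      have d: "descent rk j (swap_at i w)" "descent rk i (swap_at j w)" "descent rk i w1" "descent rk j w2"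
        unfolding w1_def w2_def True w(2)[symmetric] w(1) v using r by simp_all
      have a1: "path (swap_at i w) - (rel j (swap_at i w) + path w1) \<in> maxspan rels"
        unfolding w1_def by (rule IH[OF i wi d(1)])
      have a2: "path (swap_at j w) - (rel i (swap_at j w) + path w2) \<in> maxspan rels"
        unfolding w2_def by (rule IH[OF j wj d(2)])
      have w12: "w1 \<in> words" "w2 \<in> words" using less.prems by (simp_all add: w1_def w2_def)
      have "weight rk w1 < weight rk w" "weight rk w2 < weight rk w"
        using weight_swap_at[OF i] weight_swap_at[OF j] weight_swap_at[OF d(1)] weight_swap_at[OF d(2)]
        by (simp_all add: w1_def w2_def)
      then have b1: "path w1 - (rel i w1 + path (swap_at i w1)) \<in> maxspan rels"
        and b2: "path w2 - (rel j w2 + path (swap_at j w2)) \<in> maxspan rels"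
        using less.IH w12 d(3,4) by blast+
      have "(rel i w + rel j (swap_at i w) + rel i w1) - (rel j w + rel i (swap_at j w) + rel j w2) \<in> maxspan rels"
        unfolding w1_def w2_def True by (rule rel_braid[OF less.prems(1), of u x y z v']) (use w v in auto)
      \<comment> \<open>The four congruences express both sides by three edges and the path from the
        common end, which cancels; the hexagon compares the edges.\<close>
      from maxspan_add[OF maxspan_diff[OF maxspan_add[OF a1 b1] maxspan_add[OF a2 b2]] this]
      show ?thesis unfolding e by (simp add: algebra_simps)
    next
      case False
      \<comment> \<open>\<open>j - i - 2\<close> is the number of letters between the two pairs; the
        2 accounts for \<open>x\<close> and \<open>y\<close>.\<close>
      with \<open>i < j\<close> w j have lv: "j - i - 2 < length v" "Suc (j - i - 2) < length v"
        by (auto simp: descent_def)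
      from lv(2) obtain v1 a b v2 where v: "v = v1 @ a # b # v2" "length v1 = j - i - 2"
        by (rule word_splitE)
      have j': "j = length (u @ x # y # v1)" using v(2) w(2) False \<open>i < j\<close> by simp
      have wj': "w = (u @ x # y # v1) @ a # b # v2" using w v by simp
      have sj: "swap_at j w = u @ x # y # v1 @ b # a # v2"
        unfolding j' wj' swap_at_append by simp
      have si: "swap_at i w = (u @ y # x # v1) @ a # b # v2"
        unfolding w(2)[symmetric] w(1) v swap_at_append by simp
      have j'': "j = length (u @ y # x # v1)" using j' by simp
      have e: "swap_at j (swap_at i w) = swap_at i (swap_at j w)"
        unfolding si sj unfolding j'' swap_at_append unfolding w(2)[symmetric] append_assoc
        by simp
      have r: "rk b < rk a" using j unfolding j' wj' by (rule descent_append[THEN iffD1])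
      have r': "rk y < rk x" using i unfolding w(2)[symmetric] w(1) by simp
      have d1: "descent rk j (swap_at i w)" unfolding si j'' using r by (rule descent_append[THEN iffD2])
      have d2: "descent rk i (swap_at j w)" unfolding sj w(2)[symmetric] using r' by simp
      have a1: "path (swap_at i w) - (rel j (swap_at i w) + path (swap_at j (swap_at i w))) \<in> maxspan rels"
        by (rule IH[OF i wi d1])
      have a2: "path (swap_at j w) - (rel i (swap_at j w) + path (swap_at i (swap_at j w))) \<in> maxspan rels"
        by (rule IH[OF j wj d2])
      have "(rel i w + rel j (swap_at i w)) - (rel j w + rel i (swap_at j w)) \<in> maxspan rels"
        by (rule rel_commute[of _ u x y v1 a b v2]) (use less.prems w v j' in simp_all)
      from maxspan_add[OF maxspan_diff[OF a1 a2] this]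
      show ?thesis unfolding e by (simp add: algebra_simps)
    qed
  qed
  obtain i where i: "descent rk i w" "path w = rel i w + path (swap_at i w)"
    by (rule path_unsorted[OF less.prems(2)])
  consider "i < j" | "i = j" | "j < i" by linarith
  then show ?case
  proof cases
    case 1
    then show ?thesis unfolding i(2) using confluent i(1) less.prems by blast
  next
    case 2
    then show ?thesis unfolding i(2) by (simp add: maxspan_zero)
  next
    case 3
    from maxspan_uminus[OF confluent[OF less.prems(2) i(1) 3]]
    show ?thesis unfolding i(2) by (simp only: minus_diff_eq)
  qed
qed

text \<open>The factor 2 arises at a pair of equal letters, where a relation is added to
  itself.\<close>

lemma half_maxspan:
  assumes "x + x \<in> maxspan S"
  shows "x \<in> maxspan S"
proof -
  have "cconst (1 / 2) + cconst (1 / 2) = 1"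
    by (simp add: cconst_def One_fract_def one_pCons)
  then have "cconst (1 / 2) *\<^sub>q (x + x) = x"
    by (simp add: scaleq_add_right scaleq_one flip: scaleq_add_left)
  then show ?thesis using maxspan_scale[OF assms regular_cconst[of "1 / 2"]] by simp
qed

text \<open>At a descent this is path independence. At an ascent path independence is used for the
  swapped word, and \<open>rel_swap_sum\<close> exchanges the two relations. With equal letters the
  two paths coincide, and twice the relation is divisible by h.\<close>

lemma rel_path:
  assumes w: "w \<in> words"
  shows "rel i w - (path w - path (swap_at i w)) \<in> maxspan rels"
proof (cases "Suc i < length w")
  case True
  then obtain u x y v where wd: "w = u @ x # y # v" "length u = i" by (rule word_splitE)
  then have xy: "x \<in> B" "y \<in> B" using w by auto
  have s: "swap_at i w = u @ y # x # v" "swap_at i (swap_at i w) = w" using wd by auto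
  consider "rk y < rk x" | "rk x < rk y" | "x = y"
    using inj_onD[OF inj_rk, of x y] xy by linarith
  then show ?thesis
  proof cases
    case 1
    then have "descent rk i w" using wd by auto
    from maxspan_uminus[OF path_descent[OF w this]] show ?thesis by (simp add: algebra_simps)
  next
    case 2
    then have "descent rk i (swap_at i w)" unfolding s(1) unfolding wd(2)[symmetric] by simp
    from path_descent[OF swap_at_words[THEN iffD2, OF w] this] have
      "path (swap_at i w) - (rel i (swap_at i w) + path w) \<in> maxspan rels" unfolding s(2) .
    from maxspan_add[OF this rel_swap_sum[OF w, of i]] show ?thesis by (simp add: algebra_simps)
  next
    case 3
    then have "swap_at i w = w" using s wd by simp
    then show ?thesis using half_maxspan rel_swap_sum[OF w, of i] by simp
  qed
next
  case False
  then show ?thesis using w by (simp add: rel_short swap_at_short maxspan_zero)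
qed


section \<open>Flatness\<close>

text \<open>A projection onto the span of the sorted words that annihilates every difference
  \<open>monomial (swap_at i w) - monomial w\<close>, the value of a relation at q = 1.\<close>

definition sort_map :: "'y tensor_algebra \<Rightarrow> 'y tensor_algebra" where
  "sort_map = extend (\<lambda>w. monomial (sort_key rk w))"

text \<open>Up to sign and modulo h it sends the value of a relation at q = 1 back to the relation,
  like a contracting homotopy for the reduced complex.\<close>

definition path_map :: "'y tensor_algebra \<Rightarrow> 'y tensor_algebra" where
  "path_map = extend path"

lemma qlinear_sort_map: "qlinear sort_map" and qlinear_path_map: "qlinear path_map"
  by (simp_all add: sort_map_def path_map_def qlinear_extend)

lemma sort_map_monomial: "w \<in> words \<Longrightarrow> sort_map (monomial w) = monomial (sort_key rk w)"
  and path_map_monomial: "w \<in> words \<Longrightarrow> path_map (monomial w) = path w"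
  by (simp_all add: sort_map_def path_map_def extend_monomial)

lemma sort_swap: "w \<in> words \<Longrightarrow> sort_key rk (swap_at i w) = sort_key rk w"
  using inj_rk by (intro sort_key_swap_at) (auto simp: words_def intro: inj_on_subset)

text \<open>\<open>z\<close> is the combination \<open>y\<close> with each relation replaced by the
  difference of words to which it reduces. The property of \<open>path_map\<close> says that
  \<open>y\<close> can be reconstructed from \<open>z\<close> modulo h; the one of
  \<open>sort_map\<close> serves to prove independence.\<close>

lemma rels_reduction:
  assumes "y \<in> rspan rels"
  obtains z where "z \<in> lattice" "y - z \<in> lattice0" "y + path_map z \<in> maxspan rels" "sort_map z = 0"
proof -
  have "\<exists>z\<in>lattice. y - z \<in> lattice0 \<and> y + path_map z \<in> maxspan rels \<and> sort_map z = 0"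
    using assms
  proof induction
    case rspan_zero
    show ?case by (intro bexI[of _ 0])
       (simp_all add: rspan.rspan_zero maxspan_zero qlinear_0[OF qlinear_sort_map] qlinear_0[OF qlinear_path_map])
  next
    case (rspan_step a s y)
    then obtain z where z: "z \<in> lattice" "y - z \<in> lattice0" "y + path_map z \<in> maxspan rels" "sort_map z = 0"
      by blast
    obtain i w where w: "s = rel i w" "w \<in> words" using rspan_step(2) by (auto simp: rels_def)
    let ?m = "monomial (swap_at i w) - monomial w"
    have m1: "?m \<in> lattice" by (intro rspan_diff monomial_in_lattice) (use w in simp_all)
    have m2: "s - ?m \<in> lattice0" using act_swap[OF w(2), of i] by (simp add: w rel_def)
    have m3: "s + path_map ?m \<in> maxspan rels"
      using rel_path[OF w(2), of i] w
      by (simp add: qlinear_diff[OF qlinear_path_map] path_map_monomial algebra_simps)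
    have m4: "sort_map ?m = 0"
      using w by (simp add: qlinear_diff[OF qlinear_sort_map] sort_map_monomial sort_swap)
    show ?case
    proof (intro bexI[of _ "a *\<^sub>q ?m + z"] conjI)
      show "a *\<^sub>q ?m + z \<in> lattice" by (rule rspan_step rspan_add rspan_scale m1 z)+
      have "a *\<^sub>q s + y - (a *\<^sub>q ?m + z) = a *\<^sub>q (s - ?m) + (y - z)"
        by (simp add: qv.scale_right_diff_distrib)
      also have "\<dots> \<in> lattice0" by (rule rspan_step maxspan_add maxspan_scale m2 z)+
      finally show "a *\<^sub>q s + y - (a *\<^sub>q ?m + z) \<in> lattice0" .
      have "a *\<^sub>q s + y + path_map (a *\<^sub>q ?m + z) = a *\<^sub>q (s + path_map ?m) + (y + path_map z)"
        by (simp add: qlinear_add[OF qlinear_path_map] qlinear_scale[OF qlinear_path_map] scaleq_add_right)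
      also have "\<dots> \<in> maxspan rels" by (rule rspan_step maxspan_add maxspan_scale m3 z)+
      finally show "a *\<^sub>q s + y + path_map (a *\<^sub>q ?m + z) \<in> maxspan rels" .
      show "sort_map (a *\<^sub>q ?m + z) = 0"
        by (simp only: qlinear_add[OF qlinear_sort_map] qlinear_scale[OF qlinear_sort_map] m4 z)
           simp
    qed
  qed
  then show ?thesis using that by blast
qed

text \<open>If \<open>y\<close> vanishes at q = 1, so does its reduction \<open>z\<close>. Then
  \<open>path_map z\<close> is a combination of relations with coefficients divisible by h, and it
  is congruent to - \<open>y\<close>.\<close>

lemma rels_torsion_free:
  assumes "y \<in> rspan rels" "y \<in> lattice0"
  shows "y \<in> maxspan rels"
proof -
  obtain z where z: "z \<in> lattice" "y - z \<in> lattice0" "y + path_map z \<in> maxspan rels"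
    using assms(1) by (rule rels_reduction)
  have z0: "z \<in> lattice0" using maxspan_diff[OF assms(2) z(2)] by simp
  have "path_map z \<in> maxspan rels"
  proof (rule maxspan_linear_image[OF qlinear_path_map _ z0])
    show "path_map s \<in> rspan rels" if "s \<in> monomial ` words" for s
      using that path_in_rspan by (auto simp: path_map_monomial)
  qed
  from maxspan_diff[OF z(3) this] show ?thesis by simp
qed

text \<open>The integral relations are saturated in the lattice: after clearing denominators the
  powers of h are removed one at a time by the absence of torsion.\<close>

lemma span_rels_lattice:
  assumes "x \<in> qv.span rels" "x \<in> lattice"
  shows "x \<in> rspan rels"
proof -
  obtain n where "qm1 ^ n *\<^sub>q x \<in> rspan rels" using assms(1) by (rule span_into_rspan)
  then show ?thesis
  proof (induction n)
    case 0
    then show ?case by (simp add: scaleq_one)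
  next
    case (Suc n)
    have e: "qm1 ^ Suc n *\<^sub>q x = qm1 *\<^sub>q (qm1 ^ n *\<^sub>q x)" by (simp add: scaleq_scaleq)
    have "qm1 ^ n *\<^sub>q x \<in> lattice" by (intro rspan_scale assms(2) regular_power regular_qm1)
    then have "qm1 ^ Suc n *\<^sub>q x \<in> lattice0" unfolding e by (rule maxspanI)
    then have "qm1 ^ Suc n *\<^sub>q x \<in> maxspan rels" by (rule rels_torsion_free[OF Suc.prems])
    then obtain v where "v \<in> rspan rels" "qm1 *\<^sub>q (qm1 ^ n *\<^sub>q x) = qm1 *\<^sub>q v"
      unfolding e maxspan_def by blast
    then show ?case using Suc.IH qm1_nonzero by (metis qv.scale_cancel_left)
  qed
qed

text \<open>A linear relation is scaled until it is regular with coefficient 1 at some word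
  \<open>j\<close>. It then lies in \<open>rspan rels\<close>, and \<open>sort_map\<close>, which
  fixes it and kills its reduction \<open>z\<close>, shows that it vanishes at q = 1, contrary to
  that coefficient.\<close>

lemma sorted_words_independent:
  assumes "finite F" "F \<subseteq> words" "\<And>w. w \<in> F \<Longrightarrow> sorted (map rk w)"
    and rel: "(\<Sum>w\<in>F. a w *\<^sub>q monomial w) \<in> qv.span rels" and "v \<in> F"
  shows "a v = 0"
proof (rule ccontr)
  assume "a v \<noteq> 0"
  then obtain j where j: "j \<in> F" "a j \<noteq> 0" "\<And>i. i \<in> F \<Longrightarrow> regular_at_1 (a i / a j)"
    using dominant_coefficient[OF assms(1), of a] assms(5) by blast
  define x where "x = (\<Sum>w\<in>F. (a w / a j) *\<^sub>q monomial w)"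
  have "x = inverse (a j) *\<^sub>q (\<Sum>w\<in>F. a w *\<^sub>q monomial w)"
    unfolding x_def qv.scale_sum_right by (simp add: scaleq_scaleq field_simps)
  then have "x \<in> qv.span rels" using rel by (simp add: qv.span_scale)
  moreover have "x \<in> lattice"
    unfolding x_def by (intro rspan_sum rspan_scale monomial_in_lattice j(3)) (use assms(2) in auto)
  ultimately have "x \<in> rspan rels" by (rule span_rels_lattice)
  then obtain z where z: "x - z \<in> lattice0" "sort_map z = 0" by (rule rels_reduction)
  have "sort_map x = x"
    unfolding x_def qlinear_sum[OF qlinear_sort_map] qlinear_scale[OF qlinear_sort_map]
  proof (rule sum.cong[OF refl])
    fix w assume "w \<in> F"
    then show "(a w / a j) *\<^sub>q sort_map (monomial w) = (a w / a j) *\<^sub>q monomial w"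
      using assms(2,3) by (auto simp: sort_map_monomial sort_key_id_if_sorted)
  qed
  then have "sort_map (x - z) = x" using z(2) by (simp add: qlinear_diff[OF qlinear_sort_map])
  moreover have "sort_map (x - z) \<in> lattice0"
  proof (rule maxspan_linear_image[OF qlinear_sort_map _ z(1)])
    fix s assume "s \<in> monomial ` words"
    then obtain w where "s = monomial w" "w \<in> words" by blast
    then show "sort_map s \<in> lattice"
      using monomial_in_lattice[of "sort_key rk w"] by (simp add: sort_map_monomial words_def)
  qed
  ultimately have "x \<in> lattice0" by simp
  then have "value_at_1 (coord B j x) = 0" by (simp add: maxspan_words_iff)
  moreover have "coord B j x = (\<Sum>w\<in>F. if w = j then a w / a j else 0)"
    unfolding x_def coord_sum
    by (rule sum.cong) (use assms(2) in \<open>auto simp: coord_scale coord_monomial\<close>)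
  then have "coord B j x = 1" using assms(1) j by simp
  ultimately show False by simp
qed

text \<open>Nakayama's lemma for the quotient by the relations and the sorted words: a linear functional
  on it that is normalized by its dominant value on words vanishes at \<open>q = 1\<close>.\<close>

lemma sorted_words_span:
  assumes x: "x \<in> tpow k"
  shows "x \<in> qv.span (monomial ` {w \<in> words_of_length k. sorted (map rk w)} \<union> rels)"
    (is "x \<in> qv.span ?S")
proof -
  have finW: "finite (words_of_length k)"
    unfolding words_of_length_def using finite_lists_length_eq[OF fin, of k] by simp
  have "monomial v \<in> qv.span ?S" if v: "v \<in> words_of_length k" for v
  proof (rule ccontr)
    assume nv: "monomial v \<notin> qv.span ?S"
    \<comment> \<open>A basis of the span is enlarged to one that contains
      \<open>monomial v\<close>. The coordinate \<open>f\<close> at this vector kills the sorted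
      words and the relations but is 1 at \<open>v\<close>.\<close>
    obtain C where C: "C \<subseteq> ?S" "qv.independent C" "?S \<subseteq> qv.span C"
      by (rule qv.maximal_independent_subset)
    have spanC: "qv.span C = qv.span ?S"
      using qv.span_mono[OF C(1)] qv.span_minimal[OF C(3) qv.subspace_span] by (rule subset_antisym)
    have ind: "qv.independent (insert (monomial v) C)"
      using nv C(2) spanC by (intro qv.independent_insertI) auto
    define E where "E = qv.extend_basis (insert (monomial v) C)"
    have E: "qv.independent E" "qv.span E = UNIV" "insert (monomial v) C \<subseteq> E"
      unfolding E_def using qv.independent_extend_basis[OF ind] qv.span_extend_basis[OF ind]
        qv.extend_basis_superset[OF ind] by simp_all
    define f where "f y = qv.representation E y (monomial v)" for y
    have f_add: "f (y + z) = f y + f z" and f_scale: "f (c *\<^sub>q y) = c * f y" and f_0: "f 0 = 0" for y z c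
      unfolding f_def using E by (simp_all add: qv.representation_add qv.representation_scale qv.representation_zero)
    have f_diff: "f (y - z) = f y - f z" for y z
      using f_add[of "y - z" z] by simp
    have f_sum: "f (sum g J) = (\<Sum>i\<in>J. f (g i))" for g :: "'y list \<Rightarrow> _" and J
      by (induction J rule: infinite_finite_induct) (simp_all add: f_0 f_add)
    have "monomial v \<notin> C" using nv C(1) qv.span_base by blast
    have f_C: "f y = 0" if "y \<in> qv.span C" for y
      using that
    proof (induction rule: qv.span_induct_alt)
      case (step c s y)
      then have "f s = 0"
        unfolding f_def using E \<open>monomial v \<notin> C\<close> by (subst qv.representation_basis) auto
      then show ?case using step by (simp add: f_add f_scale)
    qed (simp add: f_0)
    have f_v: "f (monomial v) = 1"
      unfolding f_def using E by (subst qv.representation_basis) auto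
    have "\<exists>j\<in>words_of_length k. f (monomial j) \<noteq> 0"
      by (rule bexI[OF _ v]) (simp only: f_v one_neq_zero not_False_eq_True)
    with finW obtain j where j: "j \<in> words_of_length k" "f (monomial j) \<noteq> 0"
      "\<And>w. w \<in> words_of_length k \<Longrightarrow> regular_at_1 (f (monomial w) / f (monomial j))"
      by (rule dominant_coefficient) (rule that)
    define g where "g y = f y / f (monomial j)" for y
    \<comment> \<open>The degree matters: regular values of \<open>g\<close> are known only on the
      finitely many words of length \<open>k\<close>.\<close>
    have g0: "regular_at_1 (g y) \<and> value_at_1 (g y) = 0" if y: "y \<in> lattice0" "y \<in> tpow k" for y
    proof -
      have sub: "{w. coord B w y \<noteq> 0} \<subseteq> words_of_length k" using coord_tpow[OF y(2)] by blast
      have "y = (\<Sum>w\<in>words_of_length k. coord B w y *\<^sub>q monomial w)"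
        using coord_expansion[of y] sum.mono_neutral_left[OF finW sub, of "\<lambda>w. coord B w y *\<^sub>q monomial w"]
        by simp
      then have "f y = f (\<Sum>w\<in>words_of_length k. coord B w y *\<^sub>q monomial w)" by (rule arg_cong)
      then have "g y = (\<Sum>w\<in>words_of_length k. coord B w y * (f (monomial w) / f (monomial j)))"
        by (simp add: g_def f_sum f_scale sum_divide_distrib)
      moreover have "regular_at_1 (coord B w y)" "value_at_1 (coord B w y) = 0" for w
        using y(1) by (auto simp: maxspan_words_iff)
      ultimately show ?thesis
        using j(3)
        by (simp add: value_at_1_sum value_at_1_mult regular_mult regular_sum del: times_divide_eq_right)
    qed
    \<comment> \<open>A relation at a descent equates \<open>g\<close> on a word with
      \<open>g\<close> on the swapped word of smaller weight, up to a term that vanishes at q = 1.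
      Sorted words are killed outright.\<close>
    have "w \<in> words_of_length k \<Longrightarrow> value_at_1 (g (monomial w)) = 0" for w
    proof (induction w rule: measure_induct_rule[where f = "weight rk"])
      case (less w)
      then have w: "w \<in> words" "length w = k" by (simp_all add: words_of_length_iff)
      show ?case
      proof (cases "sorted (map rk w)")
        case True
        then have "monomial w \<in> qv.span C"
          unfolding spanC using less.prems by (intro qv.span_base) blast
        then show ?thesis by (simp add: g_def f_C)
      next
        case False
        then obtain i where i: "descent rk i w" using sorted_no_descent by blast
        have sw: "swap_at i w \<in> words_of_length k" using w by (simp add: words_of_length_iff)
        have "rel i w \<in> qv.span C"
          unfolding spanC by (intro qv.span_base) (simp add: rel_in_rels w)
        then have "f (act i (monomial w) - monomial w) = 0"
          unfolding rel_def by (rule f_C)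
        then have "f (act i (monomial w)) = f (monomial w)" by (simp add: f_diff)
        then have "g (monomial w) = g (act i (monomial w) - monomial (swap_at i w)) + g (monomial (swap_at i w))"
          by (simp add: g_def f_diff diff_divide_distrib)
        moreover have "act i (monomial w) - monomial (swap_at i w) \<in> tpow k"
          by (intro qv.subspace_diff subspace_tpow act_tpow monomial_in_tpow) (simp_all add: w)
        note g0[OF act_swap[OF w(1)] this]
        moreover have "value_at_1 (g (monomial (swap_at i w))) = 0"
          by (rule less.IH[OF weight_swap_at[OF i] sw])
        moreover have "regular_at_1 (g (monomial (swap_at i w)))"
          unfolding g_def by (rule j(3)[OF sw])
        ultimately show ?thesis by (simp add: value_at_1_add)
      qed
    qed
    \<comment> \<open>By normalization \<open>g\<close> takes the value 1 at the dominant word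
      \<open>j\<close>.\<close>
    from this[OF j(1)] show False using j(2) by (simp add: g_def)
  qed
  then have "monomial ` words_of_length k \<subseteq> qv.span ?S" by blast
  then have "qv.span (monomial ` words_of_length k) \<subseteq> qv.span ?S"
    by (rule qv.span_minimal[OF _ qv.subspace_span])
  then show ?thesis using x by (auto simp: tpow_eq_span)
qed

end


section \<open>Bases of quotients\<close>

text \<open>Passes from sums over finite index sets to the unique finitely supported coefficient
  function in the definition; two such functions are compared on the union of their
  supports.\<close>

lemma basis_moduloI:
  fixes e :: "'j \<Rightarrow> 'a::cq_vector_space"
  assumes W: "qv.subspace W" and e: "\<And>j. j \<in> J \<Longrightarrow> e j \<in> V"
    and ind: "\<And>F a j. finite F \<Longrightarrow> F \<subseteq> J \<Longrightarrow> (\<Sum>j\<in>F. a j *\<^sub>q e j) \<in> W \<Longrightarrow> j \<in> F \<Longrightarrow> a j = 0"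
    and span: "\<And>v. v \<in> V \<Longrightarrow> \<exists>F a. finite F \<and> F \<subseteq> J \<and> v - (\<Sum>j\<in>F. a j *\<^sub>q e j) \<in> W"
  shows "basis_modulo W V J e"
  unfolding basis_modulo_def
proof (intro conjI ballI)
  fix v assume "v \<in> V"
  then obtain F a where F: "finite F" "F \<subseteq> J" "v - (\<Sum>j\<in>F. a j *\<^sub>q e j) \<in> W" using span by blast
  define c where "c j = (if j \<in> F then a j else 0)" for j
  have sub: "{j. c j \<noteq> 0} \<subseteq> F" by (auto simp: c_def)
  have "(\<Sum>j | c j \<noteq> 0. c j *\<^sub>q e j) = (\<Sum>j\<in>F. c j *\<^sub>q e j)"
    by (rule sum.mono_neutral_left[OF F(1) sub]) simp
  also have "\<dots> = (\<Sum>j\<in>F. a j *\<^sub>q e j)" by (simp add: c_def)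
  finally have ex: "finite {j. c j \<noteq> 0} \<and> {j. c j \<noteq> 0} \<subseteq> J \<and> v - (\<Sum>j | c j \<noteq> 0. c j *\<^sub>q e j) \<in> W"
    using F finite_subset[OF sub F(1)] sub by auto
  show "\<exists>!c. finite {j. c j \<noteq> 0} \<and> {j. c j \<noteq> 0} \<subseteq> J \<and> v - (\<Sum>j | c j \<noteq> 0. c j *\<^sub>q e j) \<in> W"
  proof (rule ex1I[of _ c], rule ex)
    fix c'
    assume c': "finite {j. c' j \<noteq> 0} \<and> {j. c' j \<noteq> 0} \<subseteq> J \<and> v - (\<Sum>j | c' j \<noteq> 0. c' j *\<^sub>q e j) \<in> W"
    let ?G = "{j. c j \<noteq> 0} \<union> {j. c' j \<noteq> 0}"
    have G: "finite ?G" "?G \<subseteq> J" using ex c' by auto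
    have "(\<Sum>j | c j \<noteq> 0. c j *\<^sub>q e j) = (\<Sum>j\<in>?G. c j *\<^sub>q e j)"
      "(\<Sum>j | c' j \<noteq> 0. c' j *\<^sub>q e j) = (\<Sum>j\<in>?G. c' j *\<^sub>q e j)"
      by (rule sum.mono_neutral_left[OF G(1)]; auto)+
    then have eq: "(v - (\<Sum>j | c j \<noteq> 0. c j *\<^sub>q e j)) - (v - (\<Sum>j | c' j \<noteq> 0. c' j *\<^sub>q e j)) =
        (\<Sum>j\<in>?G. (c' j - c j) *\<^sub>q e j)"
      by (simp add: sum_subtractf qv.scale_left_diff_distrib)
    have diff_W: "(\<Sum>j\<in>?G. (c' j - c j) *\<^sub>q e j) \<in> W"
      unfolding eq[symmetric]
      by (rule qv.subspace_diff[OF W conjunct2[OF conjunct2[OF ex]] conjunct2[OF conjunct2[OF c']]])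
    have "c' j - c j = 0" if "j \<in> ?G" for j by (rule ind[OF G diff_W that])
    then have "c' j = c j" for j by (cases "j \<in> ?G") auto
    then show "c' = c" by (rule ext)
  qed
qed (rule e)

text \<open>Uniqueness of the coefficients of the vector 0.\<close>

lemma basis_modulo_independent:
  fixes e :: "'j \<Rightarrow> 'a::cq_vector_space"
  assumes b: "basis_modulo W V J e" and fin: "finite J" and V: "qv.subspace V" and W: "qv.subspace W"
    and a: "(\<Sum>j\<in>J. a j *\<^sub>q e j) \<in> W" and j: "j \<in> J"
  shows "a j = 0"
proof -
  define c where "c j = (if j \<in> J then a j else 0)" for j
  have sub: "{j. c j \<noteq> 0} \<subseteq> J" by (auto simp: c_def)
  have "(\<Sum>j | c j \<noteq> 0. c j *\<^sub>q e j) = (\<Sum>j\<in>J. c j *\<^sub>q e j)"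
    by (rule sum.mono_neutral_left[OF fin sub]) simp
  also have "\<dots> = (\<Sum>j\<in>J. a j *\<^sub>q e j)" by (simp add: c_def)
  finally have in_W: "0 - (\<Sum>j | c j \<noteq> 0. c j *\<^sub>q e j) \<in> W"
    using qv.subspace_neg[OF W a] by simp
  define Q where "Q c \<longleftrightarrow> finite {j. c j \<noteq> 0} \<and> {j. c j \<noteq> 0} \<subseteq> J \<and>
      0 - (\<Sum>j | c j \<noteq> 0. c j *\<^sub>q e j) \<in> W" for c :: "'j \<Rightarrow> cq"
  have "\<exists>!c. Q c"
    unfolding Q_def using b qv.subspace_0[OF V] unfolding basis_modulo_def by (simp only:)
  moreover have "Q c"
    unfolding Q_def using sub finite_subset[OF sub fin] in_W by (simp only: simp_thms)
  moreover have "Q (\<lambda>_. 0)" unfolding Q_def using qv.subspace_0[OF W] by simp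
  ultimately have "c = (\<lambda>_. 0)" by blast
  then show ?thesis using j by (metis c_def)
qed

lemma independent_family:
  fixes f :: "'j \<Rightarrow> 'a::cq_vector_space"
  assumes fin: "finite J" and ind: "\<And>a j. (\<Sum>j\<in>J. a j *\<^sub>q f j) = 0 \<Longrightarrow> j \<in> J \<Longrightarrow> a j = 0"
  shows "inj_on f J \<and> qv.independent (f ` J)"
proof
  show inj: "inj_on f J"
  proof (rule inj_onI, rule ccontr)
    fix i j assume ij: "i \<in> J" "j \<in> J" "f i = f j" "i \<noteq> j"
    define a :: "'j \<Rightarrow> cq" where "a k = (if k = i then 1 else 0) - (if k = j then 1 else 0)" for k
    have "(\<Sum>k\<in>J. a k *\<^sub>q f k) = (\<Sum>k\<in>J. if k = i then f k else 0) - (\<Sum>k\<in>J. if k = j then f k else 0)"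
      unfolding sum_subtractf[symmetric]
      by (rule sum.cong) (auto simp: a_def qv.scale_left_diff_distrib scaleq_one)
    also have "\<dots> = 0" using fin ij by simp
    finally have "a i = 0" by (rule ind) (rule ij)
    then show False using ij by (simp add: a_def)
  qed
  show "qv.independent (f ` J)"
  proof (rule qv.independent_if_scalars_zero)
    show "finite (f ` J)" using fin by simp
    fix g x assume "(\<Sum>x\<in>f ` J. g x *\<^sub>q x) = 0" "x \<in> f ` J"
    then show "g x = 0" using ind[of "\<lambda>j. g (f j)"] by (auto simp: sum.reindex[OF inj])
  qed
qed


section \<open>The relations in degree two\<close>

context flip_quadratic
begin

definition ordered_pairs :: "('y \<times> 'y) set" where
  "ordered_pairs = {(x, y). x \<in> B \<and> y \<in> B \<and> rk x < rk y}"

definition pair_relation :: "'y \<times> 'y \<Rightarrow> 'y tensor_algebra" where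
  "pair_relation = (\<lambda>(x, y). \<Psi> (gen x * gen y) - gen x * gen y)"

lemma finite_ordered_pairs: "finite ordered_pairs"
  by (rule finite_subset[of _ "B \<times> B"]) (auto simp: ordered_pairs_def fin)

lemma ordered_pairs_subset: "ordered_pairs \<subseteq> B \<times> B"
  by (auto simp: ordered_pairs_def)

text \<open>Modulo squares, every tensor of degree two is a combination of the products \<open>x y\<close> with
  \<open>x < y\<close>.\<close>

lemma exterior_square_dim_le:
  assumes "quotient_has_dim exterior_square_kernel (tpow 2 :: 'y tensor_algebra set) d"
  shows "d \<le> card ordered_pairs"
proof -
  let ?E = "exterior_square_kernel :: 'y tensor_algebra set"
  let ?P = "(\<lambda>(x, y). gen x * gen y) ` ordered_pairs"
  have E: "qv.subspace ?E" unfolding exterior_square_kernel_def by (rule qv.subspace_span)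
  have sq: "gen y * gen y \<in> ?E" for y
    unfolding exterior_square_kernel_def by (intro qv.span_base) blast
  \<comment> \<open>The normal form modulo squares: a decreasing pair is reversed with a sign and a
    square goes to 0. Only its values on words of length two in \<open>B\<close> are used.\<close>
  define alt :: "'y tensor_algebra \<Rightarrow> 'y tensor_algebra" where
    "alt = extend (\<lambda>w. if rk (w ! 0) < rk (w ! 1) then monomial w
       else if rk (w ! 1) < rk (w ! 0) then - monomial (rev w) else 0)"
  have lin: "qlinear alt" unfolding alt_def by (rule qlinear_extend)
  have alt: "t - alt t \<in> ?E \<and> alt t \<in> qv.span ?P" if "t \<in> tpow 2" for t
    using that unfolding tpow_eq_span
  proof (induction rule: qv.span_induct_alt)
    case base
    show ?case using E by (simp add: qlinear_0[OF lin] qv.subspace_0 qv.span_zero)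
  next
    case (step c s t)
    then have "s \<in> (\<lambda>(a, b). gen a * gen b) ` (B \<times> B)" by (simp only: pair_monomials)
    then obtain x y where s: "s = gen x * gen y" and xy: "x \<in> B" "y \<in> B" by auto
    have a: "alt (gen x * gen y) = (if rk x < rk y then gen x * gen y else if rk y < rk x then - (gen y * gen x) else 0)"
      using extend_monomial[of "[x, y]" "\<lambda>w. if rk (w ! 0) < rk (w ! 1) then monomial w
         else if rk (w ! 1) < rk (w ! 0) then - monomial (rev w) else 0"] xy by (simp add: alt_def)
    have P: "gen x * gen y \<in> qv.span ?P" if "rk x < rk y" "x \<in> B" "y \<in> B" for x y
      using that by (intro qv.span_base) (auto simp: ordered_pairs_def)
    have "s - alt s \<in> ?E \<and> alt s \<in> qv.span ?P"
    proof -
      consider "rk x < rk y" | "rk y < rk x" | "x = y"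
        using inj_onD[OF inj_rk, of x y] xy by linarith
      then show ?thesis
      proof cases
        case 1
        then show ?thesis using P xy E by (simp add: a s qv.subspace_0)
      next
        case 2
        \<comment> \<open>Polarization expresses the symmetrized product by squares.\<close>
        have "gen x * gen y + gen y * gen x = gen (x + y) * gen (x + y) - gen x * gen x - gen y * gen y"
          by (simp add: gen_add algebra_simps)
        also have "\<dots> \<in> ?E" by (intro qv.subspace_diff[OF E] sq)
        finally show ?thesis using 2 P[OF 2] xy by (simp add: a s qv.span_neg)
      next
        case 3
        then show ?thesis unfolding s a using sq by (simp add: qv.span_zero)
      qed
    qed
    with step(2) have "c *\<^sub>q (s - alt s) + (t - alt t) \<in> ?E" "c *\<^sub>q alt s + alt t \<in> qv.span ?P"
      using E by (blast intro: qv.subspace_add qv.subspace_scale qv.span_add qv.span_scale)+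
    moreover have "c *\<^sub>q s + t - alt (c *\<^sub>q s + t) = c *\<^sub>q (s - alt s) + (t - alt t)"
      "alt (c *\<^sub>q s + t) = c *\<^sub>q alt s + alt t"
      by (simp_all add: qlinear_add[OF lin] qlinear_scale[OF lin] qv.scale_right_diff_distrib)
    ultimately show ?case by (simp only: simp_thms)
  qed
  obtain e where e: "basis_modulo ?E (tpow 2) {..<d} e"
    using assms unfolding quotient_has_dim_def by blast
  have eV: "e j \<in> tpow 2" if "j < d" for j using e that unfolding basis_modulo_def by blast
  have fam: "inj_on (\<lambda>j. alt (e j)) {..<d} \<and> qv.independent ((\<lambda>j. alt (e j)) ` {..<d})"
  proof (rule independent_family)
    fix a j assume 0: "(\<Sum>j<d. a j *\<^sub>q alt (e j)) = 0" and j: "j \<in> {..<d}"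
    let ?t = "\<Sum>j<d. a j *\<^sub>q e j"
    have "alt ?t = 0" using 0 by (simp add: qlinear_sum[OF lin] qlinear_scale[OF lin])
    moreover have "?t \<in> tpow 2"
      by (intro qv.subspace_sum subspace_tpow qv.subspace_scale eV) simp
    ultimately have "?t \<in> ?E" using alt[of ?t] by simp
    then show "a j = 0"
      by (intro basis_modulo_independent[OF e _ subspace_tpow E _ j]) simp_all
  qed simp
  have "card ((\<lambda>j. alt (e j)) ` {..<d}) \<le> card ?P"
    using qv.independent_span_bound[of ?P "(\<lambda>j. alt (e j)) ` {..<d}"] fam eV alt finite_ordered_pairs
    by auto
  also have "\<dots> \<le> card ordered_pairs" by (rule card_image_le[OF finite_ordered_pairs])
  finally show ?thesis using fam by (simp add: card_image)
qed

lemma pair_relation_coord: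
  assumes p: "p \<in> B \<times> B"
  shows "regular_at_1 (coord B w (pair_relation p))"
    and "value_at_1 (coord B w (pair_relation p)) =
      (if w = [snd p, fst p] then 1 else 0) - (if w = [fst p, snd p] then 1 else 0)"
proof -
  obtain x y where xy: "p = (x, y)" "x \<in> B" "y \<in> B" using p by blast
  define m where "m = \<Psi> (gen x * gen y) - gen y * gen x"
  have pm: "pair_relation p = m + (monomial [y, x] - monomial [x, y])"
    by (simp add: pair_relation_def m_def xy)
  have c: "coord B w (monomial [y, x]) = (if w = [y, x] then 1 else 0)"
    "coord B w (monomial [x, y]) = (if w = [x, y] then 1 else 0)"
    by (rule coord_monomial; simp add: xy)+
  have e: "coord B w (pair_relation p) =
      coord B w m + cconst ((if w = [y, x] then 1 else 0) - (if w = [x, y] then 1 else 0))"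
    unfolding pm coord_add coord_diff c
    by (cases "w = [y, x]"; cases "w = [x, y]"; simp only: if_True if_False diff_self diff_zero
        diff_0 cconst_0 cconst_1 cconst_minus_1 simp_thms)
  have m: "regular_at_1 (coord B w m)" "value_at_1 (coord B w m) = 0"
    using flip[OF xy(2,3)] unfolding m_def maxspan_words_iff by blast+
  show "regular_at_1 (coord B w (pair_relation p))" unfolding e by (intro regular_add m regular_cconst)
  show "value_at_1 (coord B w (pair_relation p)) =
      (if w = [snd p, fst p] then 1 else 0) - (if w = [fst p, snd p] then 1 else 0)"
    unfolding e value_at_1_add[OF m(1) regular_cconst] m(2) value_at_1_cconst
    unfolding xy(1) fst_conv snd_conv by (rule add_0)
qed

text \<open>At q = 1 the relation of (x, y) is yx - xy, so the coordinate at \<open>[x, y]\<close>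
  sees only the pairs (y, x) and (x, y). The set \<open>P\<close> is left open because both the
  ordered pairs and all of \<open>B \<times> B\<close> are needed.\<close>

lemma relation_combination_coord:
  assumes P: "finite P" "P \<subseteq> B \<times> B" and a: "\<And>p. p \<in> P \<Longrightarrow> regular_at_1 (a p)"
  shows "regular_at_1 (coord B [x, y] (\<Sum>p\<in>P. a p *\<^sub>q pair_relation p))"
    and "value_at_1 (coord B [x, y] (\<Sum>p\<in>P. a p *\<^sub>q pair_relation p)) =
      (if (y, x) \<in> P then value_at_1 (a (y, x)) else 0) - (if (x, y) \<in> P then value_at_1 (a (x, y)) else 0)"
proof -
  let ?c = "\<lambda>p. coord B [x, y] (pair_relation p)"
  have e: "coord B [x, y] (\<Sum>p\<in>P. a p *\<^sub>q pair_relation p) = (\<Sum>p\<in>P. a p * ?c p)"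
    by (simp add: coord_sum coord_scale)
  have c: "regular_at_1 (?c p)" if "p \<in> P" for p using that P by (intro pair_relation_coord(1)) auto
  have r: "regular_at_1 (a p * ?c p)" if "p \<in> P" for p by (intro regular_mult a c that)
  show "regular_at_1 (coord B [x, y] (\<Sum>p\<in>P. a p *\<^sub>q pair_relation p))"
    unfolding e by (rule regular_sum[OF r])
  have "value_at_1 (\<Sum>p\<in>P. a p * ?c p) = (\<Sum>p\<in>P. value_at_1 (a p * ?c p))"
    by (rule value_at_1_sum[OF r])
  also have "\<dots> = (\<Sum>p\<in>P. (if p = (y, x) then value_at_1 (a p) else 0) - (if p = (x, y) then value_at_1 (a p) else 0))"
  proof (rule sum.cong[OF refl])
    fix p assume p: "p \<in> P"
    then have pB: "p \<in> B \<times> B" using P by blast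
    have l: "[x, y] = [snd p, fst p] \<longleftrightarrow> p = (y, x)" "[x, y] = [fst p, snd p] \<longleftrightarrow> p = (x, y)"
      by (cases p; auto)+
    have d: "z * ((if b then 1 else 0) - (if b' then 1 else 0)) = (if b then z else 0) - (if b' then z else 0)"
      for z :: complex and b b' by simp
    show "value_at_1 (a p * ?c p) =
        (if p = (y, x) then value_at_1 (a p) else 0) - (if p = (x, y) then value_at_1 (a p) else 0)"
      unfolding value_at_1_mult[OF a[OF p] c[OF p]] pair_relation_coord(2)[OF pB] l
      by (rule d)
  qed
  finally show "value_at_1 (coord B [x, y] (\<Sum>p\<in>P. a p *\<^sub>q pair_relation p)) =
      (if (y, x) \<in> P then value_at_1 (a (y, x)) else 0) - (if (x, y) \<in> P then value_at_1 (a (x, y)) else 0)"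
    unfolding e using P(1) by (simp add: sum_subtractf)
qed

text \<open>The ordered relations stay independent at q = 1, so they span a saturated module. After
  division by the dominant coefficient \<open>a j\<close> one coordinate of the combination is a
  unit, and \<open>a j\<close> is that coordinate of the original element divided by the
  unit.\<close>

lemma ordered_relation_coefficients:
  assumes r: "(\<Sum>p\<in>ordered_pairs. a p *\<^sub>q pair_relation p) \<in> rspan (monomial ` words)"
    and p: "p \<in> ordered_pairs"
  shows "regular_at_1 (a p)"
    and "(\<Sum>p\<in>ordered_pairs. a p *\<^sub>q pair_relation p) \<in> maxspan (monomial ` words) \<Longrightarrow> value_at_1 (a p) = 0"
proof -
  let ?r = "\<Sum>p\<in>ordered_pairs. a p *\<^sub>q pair_relation p"
  have main: "regular_at_1 (a p) \<and> (?r \<in> maxspan (monomial ` words) \<longrightarrow> value_at_1 (a p) = 0)"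
  proof (cases "\<exists>p\<in>ordered_pairs. a p \<noteq> 0")
    case True
    with finite_ordered_pairs obtain j where j: "j \<in> ordered_pairs" "a j \<noteq> 0"
      "\<And>p. p \<in> ordered_pairs \<Longrightarrow> regular_at_1 (a p / a j)"
      by (rule dominant_coefficient) (rule that)
    obtain x y where xy: "j = (x, y)" by (cases j)
    let ?b = "\<Sum>p\<in>ordered_pairs. (a p / a j) *\<^sub>q pair_relation p"
    let ?u = "coord B [x, y] ?b"
    \<comment> \<open>Only one of the two orders of a pair is listed, so a single term survives; its
      sign gives the value - 1.\<close>
    have "(y, x) \<notin> ordered_pairs" "(x, y) \<in> ordered_pairs" "a (x, y) / a (x, y) = 1"
      using j(1,2) by (simp_all add: xy ordered_pairs_def)
    with relation_combination_coord[OF finite_ordered_pairs ordered_pairs_subset j(3), where x = x and y = y]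
    have u: "regular_at_1 ?u" "value_at_1 ?u = - 1"
      by (simp_all only: xy if_True if_False value_at_1_1 simp_thms diff_0)
    have "?r = a j *\<^sub>q ?b"
      using j(2) by (simp add: qv.scale_sum_right scaleq_scaleq)
    then have c: "coord B [x, y] ?r = a j * ?u" by (simp only: coord_scale)
    have reg: "regular_at_1 (inverse ?u)"
    proof -
      obtain p d where f: "poly d 1 \<noteq> 0" "d \<noteq> 0" "?u = Fract p d" using u(1) by (rule regular_at_1E)
      then have "poly p 1 \<noteq> 0" using u(2) by (auto simp: value_at_1_Fract)
      then show ?thesis using f by (simp add: regular_at_1I)
    qed
    have u0: "?u \<noteq> 0"
    proof
      assume "?u = 0"
      with u(2) have "value_at_1 0 = - 1" by (simp only:)
      then show False by simp
    qed
    have cr: "regular_at_1 (coord B [x, y] ?r)" using r by (simp only: rspan_words_iff)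
    have aj: "a j = coord B [x, y] ?r * inverse ?u"
      unfolding c mult.assoc right_inverse[OF u0] mult_1_right by (rule refl)
    have ajr: "regular_at_1 (a j)" using regular_mult[OF cr reg] by (simp only: aj[symmetric])
    have ap: "(a p / a j) * a j = a p" by (rule nonzero_eq_divide_eq[THEN iffD1, OF j(2) refl])
    have "value_at_1 (a p) = 0" if "?r \<in> maxspan (monomial ` words)"
    proof -
      have "value_at_1 (coord B [x, y] ?r) = 0" using that by (simp only: maxspan_words_iff)
      then have "value_at_1 (coord B [x, y] ?r * inverse ?u) = 0"
        unfolding value_at_1_mult[OF cr reg] by (simp only: mult_zero_left)
      then have "value_at_1 (a j) = 0" by (simp only: aj[symmetric])
      then have "value_at_1 ((a p / a j) * a j) = 0"
        unfolding value_at_1_mult[OF j(3)[OF p] ajr] by (simp only: mult_zero_right)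
      then show ?thesis by (simp only: ap)
    qed
    moreover have "regular_at_1 (a p)"
      using regular_mult[OF j(3)[OF p] ajr] by (simp only: ap)
    ultimately show ?thesis by blast
  qed (use p in simp)
  then show "regular_at_1 (a p)" "?r \<in> maxspan (monomial ` words) \<Longrightarrow> value_at_1 (a p) = 0" by blast+
qed

text \<open>Scaled to have a coefficient 1, a dependence would be the element 0, all of whose
  coefficients vanish at q = 1.\<close>

lemma ordered_relations_independent:
  "inj_on pair_relation ordered_pairs \<and> qv.independent (pair_relation ` ordered_pairs)"
proof (rule independent_family[OF finite_ordered_pairs], rule ccontr)
  fix a p
  assume 0: "(\<Sum>p\<in>ordered_pairs. a p *\<^sub>q pair_relation p) = 0" and p: "p \<in> ordered_pairs" "a p \<noteq> 0"
  have "(\<Sum>i\<in>ordered_pairs. (a i / a p) *\<^sub>q pair_relation i) = inverse (a p) *\<^sub>q 0"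
    unfolding 0[symmetric] qv.scale_sum_right by (simp add: scaleq_scaleq divide_inverse mult.commute)
  then have z: "(\<Sum>i\<in>ordered_pairs. (a i / a p) *\<^sub>q pair_relation i) = 0" by simp
  have "value_at_1 (a p / a p) = 0"
    by (rule ordered_relation_coefficients(2)[of "\<lambda>i. a i / a p", OF _ p(1)])
       (simp_all add: z rspan_zero maxspan_zero)
  then show False using p(2) by simp
qed

lemma pair_relation_in_relations: "pair_relation p \<in> relations \<Psi>"
  unfolding pair_relation_def split_beta by (rule imageI) (rule gen_gen_tpow)

section \<open>Consequences of the dimension hypothesis\<close>

context
  assumes dim: "quotient_has_dim exterior_square_kernel (tpow 2 :: 'y tensor_algebra set)
    (qv.dim (relations \<Psi>))"
begin

text \<open>The space of relations has dimension at most the number of ordered pairs, and that many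
  independent relations are already at hand.\<close>

lemma relations_in_ordered_span:
  assumes "r \<in> relations \<Psi>"
  obtains a where "r = (\<Sum>p\<in>ordered_pairs. a p *\<^sub>q pair_relation p)"
proof -
  let ?S = "pair_relation ` ordered_pairs"
  have finS: "finite ?S" using finite_ordered_pairs by simp
  have "r \<in> qv.span ?S"
  proof (rule ccontr)
    assume nr: "r \<notin> qv.span ?S"
    obtain C where C: "C \<subseteq> relations \<Psi>" "qv.independent C" "relations \<Psi> \<subseteq> qv.span C"
      "card C = qv.dim (relations \<Psi>)"
      using qv.basis_exists[of "relations \<Psi>"] by blast
    \<comment> \<open>The dimension is the cardinality of \<open>C\<close>, which can bound
      independent sets only when \<open>C\<close> is finite.\<close>
    have finC: "finite C"
      by (rule conjunct1[OF qv.independent_span_bound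
            [OF _ C(2) subset_trans[OF C(1) relations_subset_span]]]) (use fin in simp)
    have S: "?S \<subseteq> relations \<Psi>" by (rule image_subsetI) (rule pair_relation_in_relations)
    have "insert r ?S \<subseteq> qv.span C"
      by (rule subset_trans[OF _ C(3)]) (simp only: insert_subset assms S simp_thms)
    moreover have "qv.independent (insert r ?S)"
      by (rule qv.independent_insertI[OF nr conjunct2[OF ordered_relations_independent]])
    ultimately have "card (insert r ?S) \<le> card C"
      using qv.independent_span_bound[OF finC] by blast
    moreover have "card ?S = card ordered_pairs"
      by (rule card_image[OF conjunct1[OF ordered_relations_independent]])
    moreover have "r \<notin> ?S" using nr qv.span_base[of r ?S] by blast
    then have "card (insert r ?S) = Suc (card ?S)" by (rule card_insert_disjoint[OF finS])
    ultimately show False using exterior_square_dim_le[OF dim] unfolding C(4)[symmetric] by linarith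
  qed
  then obtain u where "r = (\<Sum>v\<in>?S. u v *\<^sub>q v)" unfolding qv.span_finite[OF finS] by blast
  then have "r = (\<Sum>p\<in>ordered_pairs. u (pair_relation p) *\<^sub>q pair_relation p)"
    unfolding sum.reindex[OF conjunct1[OF ordered_relations_independent]] o_def .
  then show ?thesis by (rule that)
qed

text \<open>The defect \<Psi> \<open>?t\<close> - \<open>?t\<close> vanishes at q = 1, hence so do
  its coefficients in the ordered relations. The combination \<open>m\<close> of the products of
  pairs with these coefficients has the same defect, and \<open>?t - m\<close> is the desired fixed
  vector.\<close>

lemma invariant_lift:
  assumes xy: "x \<in> B" "y \<in> B"
  shows "\<exists>s\<in>tpow 2. \<Psi> s = s \<and> gen x * gen y + gen y * gen x - s \<in> maxspan (monomial ` words)"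
proof -
  let ?t = "gen x * gen y + gen y * gen x"
  have t: "?t \<in> tpow 2" by (intro qv.subspace_add subspace_tpow gen_gen_tpow)
  obtain a where a: "\<Psi> ?t - ?t = (\<Sum>p\<in>ordered_pairs. a p *\<^sub>q pair_relation p)"
    using relations_in_ordered_span t by blast
  have "\<Psi> ?t = \<Psi> (gen x * gen y) + \<Psi> (gen y * gen x)"
    using linear gen_gen_tpow unfolding linear_map_on_def by blast
  then have "\<Psi> ?t - ?t = (\<Psi> (gen x * gen y) - gen y * gen x) + (\<Psi> (gen y * gen x) - gen x * gen y)"
    by simp
  also have "\<dots> \<in> maxspan (monomial ` words)" by (intro maxspan_add flip xy)
  finally have r0: "(\<Sum>p\<in>ordered_pairs. a p *\<^sub>q pair_relation p) \<in> maxspan (monomial ` words)"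
    unfolding a .
  then have r: "(\<Sum>p\<in>ordered_pairs. a p *\<^sub>q pair_relation p) \<in> rspan (monomial ` words)"
    using maxspan_subset_rspan by blast
  define m where "m = (\<Sum>p\<in>ordered_pairs. a p *\<^sub>q (gen (fst p) * gen (snd p)))"
  have m2: "m \<in> tpow 2"
    unfolding m_def by (intro qv.subspace_sum subspace_tpow qv.subspace_scale gen_gen_tpow)
  have "act 0 m - m = (\<Sum>p\<in>ordered_pairs. a p *\<^sub>q pair_relation p)"
    unfolding m_def qlinear_sum[OF qlinear_act] qlinear_scale[OF qlinear_act] sum_subtractf[symmetric]
      qv.scale_right_diff_distrib[symmetric]
    by (rule sum.cong) (auto simp: act_0_eq gen_gen_tpow pair_relation_def split_beta)
  then have "\<Psi> ?t - ?t = act 0 m - m" by (simp only: a)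
  moreover have "b - c = d - e \<Longrightarrow> b - d = c - e" for b c d e :: "'y tensor_algebra"
    by (auto simp: diff_eq_eq)
  ultimately have "\<Psi> ?t - act 0 m = ?t - m" by blast
  then have "act 0 (?t - m) = ?t - m"
    by (simp only: qlinear_diff[OF qlinear_act] act_0_eq[OF t])
  moreover have s: "?t - m \<in> tpow 2" by (intro qv.subspace_diff subspace_tpow t m2)
  ultimately have "\<Psi> (?t - m) = ?t - m" by (simp add: act_0_eq)
  moreover have "m \<in> maxspan (monomial ` words)"
  proof -
    show ?thesis
      unfolding m_def
    proof (rule maxspan_sum)
      fix p assume p: "p \<in> ordered_pairs"
      have "monomial [fst p, snd p] \<in> rspan (monomial ` words)"
        using p by (intro rspan_superset imageI) (auto simp: ordered_pairs_def)
      then show "a p *\<^sub>q (gen (fst p) * gen (snd p)) \<in> maxspan (monomial ` words)"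
        using ordered_relation_coefficients[OF r p] r0 by (intro maxspan_step) auto
    qed
  qed
  ultimately show ?thesis using s by (intro bexI[of _ "?t - m"]) simp_all
qed

lemma relations_specialize: "relations_specialize B \<Psi>"
  unfolding relations_specialize_def
proof (intro equalityI subsetI)
  fix f :: "'y \<times> 'y \<Rightarrow> complex"
  assume "f \<in> {(\<lambda>p. if p \<in> B \<times> B then value_at_1 (tensor_coeff B r p) else 0) | r.
        r \<in> relations \<Psi> \<and> (\<forall>p\<in>B \<times> B. regular_at_1 (tensor_coeff B r p))}"
  then obtain r where f: "f = (\<lambda>p. if p \<in> B \<times> B then value_at_1 (tensor_coeff B r p) else 0)"
    and r: "r \<in> relations \<Psi>" "\<And>p. p \<in> B \<times> B \<Longrightarrow> regular_at_1 (tensor_coeff B r p)" by blast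
  have r2: "r \<in> tpow 2" using r(1) into by (auto intro: qv.subspace_diff[OF subspace_tpow])
  have "regular_at_1 (coord B w r)" for w
  proof (cases "w \<in> words_of_length 2")
    case True
    then obtain x y where w: "w = [x, y]" "x \<in> B" "y \<in> B"
      by (auto simp: words_of_length_iff numeral_2_eq_2 length_Suc_conv)
    then show ?thesis using r(2)[of "(x, y)"] tensor_coeff_eq_coord[OF r2, of "(x, y)"] by simp
  qed (simp add: coord_tpow[OF r2])
  then have rl: "r \<in> rspan (monomial ` words)" by (simp add: rspan_words_iff)
  obtain a where a: "r = (\<Sum>p\<in>ordered_pairs. a p *\<^sub>q pair_relation p)"
    using relations_in_ordered_span[OF r(1)] .
  have reg: "regular_at_1 (a p)" if "p \<in> ordered_pairs" for p
    using ordered_relation_coefficients(1)[of a, OF _ that] rl a by simp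
  \<comment> \<open>A tensor supported on the ordered pairs suffices: symmetric tensors are lost in
    \<tau> g - g anyway.\<close>
  define g where "g p = (if p \<in> ordered_pairs then value_at_1 (a p) else 0)" for p
  have "f = (\<lambda>(c, c'). if (c, c') \<in> B \<times> B then g (c', c) - g (c, c') else 0)"
  proof (rule ext, clarify)
    fix c c'
    show "f (c, c') = (if (c, c') \<in> B \<times> B then g (c', c) - g (c, c') else 0)"
      using relation_combination_coord(2)[OF finite_ordered_pairs ordered_pairs_subset reg, where x = c and y = c']
        tensor_coeff_eq_coord[OF r2, of "(c, c')"]
      by (auto simp: f g_def a)
  qed
  then show "f \<in> {(\<lambda>(c, c'). if (c, c') \<in> B \<times> B then g (c', c) - g (c, c') else 0) |
      g :: 'y \<times> 'y \<Rightarrow> complex. True}" by blast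
next
  fix f :: "'y \<times> 'y \<Rightarrow> complex"
  assume "f \<in> {(\<lambda>(c, c'). if (c, c') \<in> B \<times> B then g (c', c) - g (c, c') else 0) |
      g :: 'y \<times> 'y \<Rightarrow> complex. True}"
  then obtain g where f: "f = (\<lambda>(c, c'). if (c, c') \<in> B \<times> B then g (c', c) - g (c, c') else 0)" by blast
  \<comment> \<open>The lift of \<open>g\<close> with constant coefficients; its relation is regular
    and specializes to \<tau> g - g.\<close>
  define t where "t = (\<Sum>p\<in>B \<times> B. cconst (g p) *\<^sub>q (gen (fst p) * gen (snd p)))"
  have t2: "t \<in> tpow 2"
    unfolding t_def by (intro qv.subspace_sum subspace_tpow qv.subspace_scale gen_gen_tpow)
  define r where "r = \<Psi> t - t"
  have r2: "r \<in> tpow 2" unfolding r_def by (intro qv.subspace_diff subspace_tpow into t2)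
  have "act 0 t - t = (\<Sum>p\<in>B \<times> B. cconst (g p) *\<^sub>q pair_relation p)"
    unfolding t_def qlinear_sum[OF qlinear_act] qlinear_scale[OF qlinear_act] sum_subtractf[symmetric]
      qv.scale_right_diff_distrib[symmetric]
    by (rule sum.cong) (auto simp: act_0_eq gen_gen_tpow pair_relation_def)
  then have re: "r = (\<Sum>p\<in>B \<times> B. cconst (g p) *\<^sub>q pair_relation p)"
    by (simp add: r_def act_0_eq t2)
  have BB: "finite (B \<times> B)" using fin by simp
  note c = relation_combination_coord[OF BB subset_refl, where a = "\<lambda>p. cconst (g p)", OF regular_cconst]
  have "regular_at_1 (tensor_coeff B r p)" if "p \<in> B \<times> B" for p
    unfolding tensor_coeff_eq_coord[OF r2 that] unfolding re by (rule c(1))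
  moreover have "f = (\<lambda>p. if p \<in> B \<times> B then value_at_1 (tensor_coeff B r p) else 0)"
  proof (rule ext)
    fix p :: "'y \<times> 'y"
    obtain x y where p: "p = (x, y)" by (cases p)
    show "f p = (if p \<in> B \<times> B then value_at_1 (tensor_coeff B r p) else 0)"
      using tensor_coeff_eq_coord[OF r2, of p] c(2)[where x = x and y = y]
      by (auto simp: f re p)
  qed
  moreover have "r \<in> relations \<Psi>" unfolding r_def using t2 by blast
  ultimately show "f \<in> {(\<lambda>p. if p \<in> B \<times> B then value_at_1 (tensor_coeff B r p) else 0) | r.
        r \<in> relations \<Psi> \<and> (\<forall>p\<in>B \<times> B. regular_at_1 (tensor_coeff B r p))}" by blast
qed

end

end


section \<open>Dimensions of the graded components\<close>

context flat_quadratic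
begin

definition sorted_words :: "'y list set" where
  "sorted_words = {w \<in> words. sorted (map rk w)}"

definition sorted_words_of_length :: "nat \<Rightarrow> 'y list set" where
  "sorted_words_of_length k = {w \<in> words_of_length k. sorted (map rk w)}"

lemma sorted_words_of_length_subset: "sorted_words_of_length k \<subseteq> sorted_words"
  by (auto simp: sorted_words_of_length_def sorted_words_def words_of_length_iff)

lemma finite_sorted_words_of_length: "finite (sorted_words_of_length k)"
proof (rule finite_subset)
  show "sorted_words_of_length k \<subseteq> {w. set w \<subseteq> B \<and> length w = k}"
    by (auto simp: sorted_words_of_length_def words_of_length_def)
  show "finite {w. set w \<subseteq> B \<and> length w = k}" by (rule finite_lists_length_eq[OF fin])
qed

lemma span_monomials_expansion:
  assumes J: "J \<subseteq> words" and x: "x \<in> qv.span (monomial ` J)"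
  obtains F a where "finite F" "F \<subseteq> J" "x = (\<Sum>w\<in>F. a w *\<^sub>q monomial w)"
proof
  show "finite {w. coord B w x \<noteq> 0}" using coord_expansion by blast
  have "coord B w x = 0" if "w \<notin> J" for w
    using x
  proof (induction rule: qv.span_induct_alt)
    case base
    show ?case by (rule coord_0)
  next
    case (step c s x)
    then obtain u where u: "u \<in> J" "s = monomial u" by blast
    then have "coord B w s = 0" using J that coord_monomial[of u w] by auto
    then show ?case using step by (simp only: coord_add coord_scale mult_zero_right add_0)
  qed
  then show "{w. coord B w x \<noteq> 0} \<subseteq> J" by blast
  show "x = (\<Sum>w | coord B w x \<noteq> 0. coord B w x *\<^sub>q monomial w)" using coord_expansion by simp
qed

lemma sorted_expansion:
  assumes "x \<in> tpow k"
  obtains F a where "finite F" "F \<subseteq> sorted_words_of_length k"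
    "x - (\<Sum>w\<in>F. a w *\<^sub>q monomial w) \<in> qv.span rels"
proof -
  have "x \<in> qv.span (monomial ` sorted_words_of_length k \<union> rels)"
    using sorted_words_span[OF assms] by (simp only: sorted_words_of_length_def)
  then obtain y z where yz: "x = y + z" "y \<in> qv.span (monomial ` sorted_words_of_length k)" "z \<in> qv.span rels"
    unfolding qv.span_Un by blast
  have "sorted_words_of_length k \<subseteq> words"
    by (auto simp: sorted_words_of_length_def words_of_length_iff)
  then obtain F a where F: "finite F" "F \<subseteq> sorted_words_of_length k" "y = (\<Sum>w\<in>F. a w *\<^sub>q monomial w)"
    using yz(2) by (rule span_monomials_expansion)
  then have "x - (\<Sum>w\<in>F. a w *\<^sub>q monomial w) \<in> qv.span rels" using yz by simp
  then show ?thesis by (rule that[OF F(1,2)])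
qed

lemma sorted_basis:
  "basis_modulo (qv.span rels) UNIV sorted_words monomial"
proof (rule basis_moduloI)
  show "qv.subspace (qv.span rels)" by (rule qv.subspace_span)
  show "a j = 0" if "finite F" "F \<subseteq> sorted_words" "(\<Sum>w\<in>F. a w *\<^sub>q monomial w) \<in> qv.span rels" "j \<in> F"
    for F a j
    by (rule sorted_words_independent[OF that(1) _ _ that(3,4)])
       (use that(2) in \<open>auto simp: sorted_words_def\<close>)
  fix v :: "'y tensor_algebra"
  have "v \<in> qv.span (monomial ` words)" by (simp only: span_words UNIV_I)
  then have "v \<in> qv.span (monomial ` sorted_words \<union> rels)"
  proof (rule subsetD[OF qv.span_minimal[OF _ qv.subspace_span], rotated])
    show "monomial ` words \<subseteq> qv.span (monomial ` sorted_words \<union> rels)"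
    proof (rule image_subsetI)
      fix w assume "w \<in> words"
      then have "monomial w \<in> qv.span (monomial ` sorted_words_of_length (length w) \<union> rels)"
        using sorted_words_span[OF monomial_in_tpow[OF refl, of w]]
        by (simp only: sorted_words_of_length_def)
      then show "monomial w \<in> qv.span (monomial ` sorted_words \<union> rels)"
        by (rule subsetD[OF qv.span_mono, rotated])
           (use sorted_words_of_length_subset in blast)
    qed
  qed
  then obtain y z where yz: "v = y + z" "y \<in> qv.span (monomial ` sorted_words)" "z \<in> qv.span rels"
    unfolding qv.span_Un by blast
  have "sorted_words \<subseteq> words" by (auto simp: sorted_words_def)
  then obtain F a where F: "finite F" "F \<subseteq> sorted_words" "y = (\<Sum>w\<in>F. a w *\<^sub>q monomial w)"
    using yz(2) by (rule span_monomials_expansion)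
  then have "v - (\<Sum>w\<in>F. a w *\<^sub>q monomial w) \<in> qv.span rels" using yz by simp
  then show "\<exists>F a. finite F \<and> F \<subseteq> sorted_words \<and> v - (\<Sum>w\<in>F. a w *\<^sub>q monomial w) \<in> qv.span rels"
    using F(1,2) by blast
qed simp

text \<open>The number of sorted words of length \<open>k\<close> refers to \<open>B\<close> and the
  ranks but not to \<Psi>; this is what makes the dimensions for the braiding and for the flip
  comparable.\<close>

lemma component_has_dim:
  "quotient_has_dim (qv.span rels) (tpow k) (card (sorted_words_of_length k))"
proof -
  let ?J = "sorted_words_of_length k"
  obtain h where h: "bij_betw h {..<card ?J} ?J"
    using ex_bij_betw_nat_finite[OF finite_sorted_words_of_length] unfolding lessThan_atLeast0 by blast
  have inj: "inj_on h {..<card ?J}" and hJ: "h ` {..<card ?J} = ?J"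
    using h by (simp_all add: bij_betw_def)
  have "basis_modulo (qv.span rels) (tpow k) {..<card ?J} (\<lambda>i. monomial (h i))"
  proof (rule basis_moduloI)
    show "qv.subspace (qv.span rels)" by (rule qv.subspace_span)
    show "monomial (h i) \<in> tpow k" if "i \<in> {..<card ?J}" for i
    proof (rule monomial_in_tpow)
      have "h i \<in> ?J" using that hJ by blast
      then show "length (h i) = k" by (simp add: sorted_words_of_length_def words_of_length_iff)
    qed
    fix F :: "nat set" and a j
    assume F: "finite F" "F \<subseteq> {..<card ?J}"
      and s: "(\<Sum>i\<in>F. a i *\<^sub>q monomial (h i)) \<in> qv.span rels" and j: "j \<in> F"
    have injF: "inj_on h F" using inj F(2) by (rule inj_on_subset)
    have hF: "h ` F \<subseteq> sorted_words"
      using hJ F(2) sorted_words_of_length_subset[of k] by blast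
    let ?b = "\<lambda>w. a (the_inv_into F h w)"
    have "(\<Sum>w\<in>h ` F. ?b w *\<^sub>q monomial w) = (\<Sum>i\<in>F. a i *\<^sub>q monomial (h i))"
      by (simp add: sum.reindex[OF injF] the_inv_into_f_f[OF injF])
    then have "?b (h j) = 0"
      using s j F(1) hF
      by (intro sorted_words_independent[where F = "h ` F" and a = ?b]) (auto simp: sorted_words_def)
    then show "a j = 0" by (simp add: the_inv_into_f_f[OF injF j])
  next
    fix v :: "'y tensor_algebra" assume "v \<in> tpow k"
    then obtain F a where F: "finite F" "F \<subseteq> ?J" "v - (\<Sum>w\<in>F. a w *\<^sub>q monomial w) \<in> qv.span rels"
      by (rule sorted_expansion)
    let ?G = "{i \<in> {..<card ?J}. h i \<in> F}"
    have G: "h ` ?G = F" using hJ F(2) by auto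
    have "inj_on h ?G" by (rule inj_on_subset[OF inj]) blast
    then have "(\<Sum>w\<in>F. a w *\<^sub>q monomial w) = (\<Sum>i\<in>?G. a (h i) *\<^sub>q monomial (h i))"
      by (subst G[symmetric]) (simp only: sum.reindex o_def)
    then show "\<exists>F a. finite F \<and> F \<subseteq> {..<card ?J} \<and>
        v - (\<Sum>i\<in>F. a i *\<^sub>q monomial (h i)) \<in> qv.span rels"
      using F(3) by (intro exI[of _ ?G] exI[of _ "\<lambda>i. a (h i)"]) auto
  qed
  then show ?thesis unfolding quotient_has_dim_def by blast
qed

end


section \<open>The symmetric algebra\<close>

context tensor_basis
begin

text \<open>Reversal of words, which is the permutation of factors in degree two, the only degree
  used.\<close>

definition flip_map :: "'y tensor_algebra \<Rightarrow> 'y tensor_algebra" where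
  "flip_map = extend (\<lambda>w. monomial (rev w))"

lemma qlinear_flip_map: "qlinear flip_map"
  unfolding flip_map_def by (rule qlinear_extend)

lemma flip_map_monomial: "w \<in> words \<Longrightarrow> flip_map (monomial w) = monomial (rev w)"
  unfolding flip_map_def by (rule extend_monomial)

lemma flip_map_pair: "x \<in> B \<Longrightarrow> y \<in> B \<Longrightarrow> flip_map (gen x * gen y) = gen y * gen x"
  using flip_map_monomial[of "[x, y]"] by simp

lemma flip_map_quadratic: "quadratic B flip_map"
proof
  show "linear_map_on (tpow 2) flip_map"
    by (simp add: linear_map_on_def qlinear_add[OF qlinear_flip_map] qlinear_scale[OF qlinear_flip_map])
  fix t :: "'y tensor_algebra" assume "t \<in> tpow 2"
  then have "flip_map t \<in> flip_map ` qv.span (monomial ` words_of_length 2)"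
    by (simp add: tpow_eq_span)
  also have "\<dots> = qv.span (flip_map ` monomial ` words_of_length 2)"
    by (rule qvp.linear_span_image[OF qlinear_flip_map, symmetric])
  also have "\<dots> \<subseteq> tpow 2"
    by (rule qv.span_minimal[OF _ subspace_tpow])
       (auto simp: words_of_length_iff flip_map_monomial intro!: monomial_in_tpow)
  finally show "flip_map t \<in> tpow 2" .
qed

text \<open>For the flip all congruences at q = 1 are equalities: \<open>act i\<close> permutes the
  words by \<open>swap_at i\<close>, and a symmetrized product is already fixed.\<close>

lemma flip_map_flat:
  assumes "finite B" "inj_on rk B"
  shows "flat_quadratic B flip_map rk"
proof -
  interpret quadratic B flip_map by (rule flip_map_quadratic)
  have act: "act i (monomial w) = monomial (swap_at i w)" if "w \<in> words" for i w
  proof (cases "Suc i < length w")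
    case True
    then obtain u x y v where w: "w = u @ x # y # v" "length u = i" by (rule word_splitE)
    have s: "swap_at i w = u @ y # x # v" unfolding w(2)[symmetric] w(1) by (rule swap_at_append)
    have "x \<in> B" "y \<in> B" using that w by auto
    then show ?thesis
      using act_monomial[of u x y v i] that unfolding s unfolding w
      by (simp add: flip_map_pair mult.assoc)
  next
    case False
    then show ?thesis using that by (simp add: act_short swap_at_short)
  qed
  show ?thesis
  proof
    show "finite B" "inj_on rk B" by (rule assms)+
    show "flip_map (gen x * gen y) - gen y * gen x \<in> maxspan (monomial ` words)" if "x \<in> B" "y \<in> B" for x y
      using that by (simp add: flip_map_pair maxspan_zero)
    show "\<exists>s\<in>tpow 2. flip_map s = s \<and> gen x * gen y + gen y * gen x - s \<in> maxspan (monomial ` words)"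
      if "x \<in> B" "y \<in> B" for x y
    proof (intro bexI[of _ "gen x * gen y + gen y * gen x"] conjI)
      show "flip_map (gen x * gen y + gen y * gen x) = gen x * gen y + gen y * gen x"
        using that by (simp add: qlinear_add[OF qlinear_flip_map] flip_map_pair)
      show "gen x * gen y + gen y * gen x \<in> tpow 2"
        by (intro qv.subspace_add subspace_tpow gen_gen_tpow)
    qed (simp add: maxspan_zero)
    fix t :: "'y tensor_algebra" assume t: "t \<in> tpow 3"
    show "act 0 (act 1 (act 0 t)) = act 1 (act 0 (act 1 t))"
    proof (rule qvp.linear_eq_on[where f = "\<lambda>t. act 0 (act 1 (act 0 t))"
          and g = "\<lambda>t. act 1 (act 0 (act 1 t))"])
      show "qlinear (\<lambda>t. act 0 (act 1 (act 0 t)))" "qlinear (\<lambda>t. act 1 (act 0 (act 1 t)))"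
        by (rule qlinearI; simp only: qlinear_add[OF qlinear_act] qlinear_scale[OF qlinear_act])+
      show "t \<in> qv.span (monomial ` words_of_length 3)" using t by (simp only: tpow_eq_span)
      fix s assume "s \<in> monomial ` words_of_length 3"
      then obtain w where w: "s = monomial w" "w \<in> words_of_length 3" by blast
      then obtain a b c where abc: "w = [a, b, c]"
        by (auto simp: words_of_length_iff numeral_3_eq_3 length_Suc_conv)
      have in_words: "w \<in> words" "swap_at i w \<in> words" "swap_at i (swap_at j w) \<in> words" for i j
        using w(2) by (simp_all add: words_of_length_iff words_def)
      have "swap_at 0 (swap_at 1 (swap_at 0 w)) = swap_at 1 (swap_at 0 (swap_at 1 w))"
        by (simp add: abc swap_at_def)
      then show "act 0 (act 1 (act 0 s)) = act 1 (act 0 (act 1 s))"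
        unfolding w(1) by (simp only: act in_words)
    qed
  qed
qed

end

lemma (in quadratic) symmetric_ideal_eq_span:
  assumes "\<And>x y. x \<in> B \<Longrightarrow> y \<in> B \<Longrightarrow> \<Psi> (gen x * gen y) = gen y * gen x"
  shows "symmetric_ideal = qv.span rels"
  unfolding symmetric_ideal_def
proof (rule ideal_eq_span_rels)
  fix x y assume "x \<in> B" "y \<in> B"
  then have "\<Psi> (gen x * gen y) - gen x * gen y = gen y * gen x - gen x * gen y" by (simp add: assms)
  also have "\<dots> \<in> ideal_generated {gen x * gen y - gen y * gen x | x y :: 'y. True}"
    by (rule hull_inc) blast
  finally show "\<Psi> (gen x * gen y) - gen x * gen y \<in> ideal_generated {gen x * gen y - gen y * gen x | x y :: 'y. True}" .
next
  have span_B: "z \<in> qv.span B" for z using basis by (simp add: is_basis_def)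
  \<comment> \<open>The commutators of all vectors are reduced to those of basis vectors by
    bilinearity, in \<open>x\<close> and then in \<open>y\<close>.\<close>
  have "gen x * gen y - gen y * gen x \<in> qv.span rels" for x y :: 'y
    using span_B[of x]
  proof (induction rule: qv.span_induct_alt)
    case base
    have "gen (0 :: 'y) = 0" using gen_scaleq[of 0 "0 :: 'y"] by simp
    then show ?case by (simp add: qv.span_zero)
  next
    case (step c b x)
    have "gen b * gen y - gen y * gen b \<in> qv.span rels"
      using span_B[of y]
    proof (induction rule: qv.span_induct_alt)
      case base
      have "gen (0 :: 'y) = 0" using gen_scaleq[of 0 "0 :: 'y"] by simp
      then show ?case by (simp add: qv.span_zero)
    next
      case (step c' b' y)
      have "\<Psi> (gen b' * gen b) - gen b' * gen b \<in> qv.span rels"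
        using step(1) \<open>b \<in> B\<close> by (intro qv.span_base pair_relation_in_rels)
      then have "gen b * gen b' - gen b' * gen b \<in> qv.span rels"
        using step(1) \<open>b \<in> B\<close> by (simp only: assms)
      then have "c' *\<^sub>q (gen b * gen b' - gen b' * gen b) + (gen b * gen y - gen y * gen b) \<in> qv.span rels"
        using step(2) by (intro qv.span_add qv.span_scale)
      then show ?case
        by (simp add: gen_add gen_scaleq algebra_simps scaleq_mult_left scaleq_mult_right
            qv.scale_right_diff_distrib)
    qed
    then have "c *\<^sub>q (gen b * gen y - gen y * gen b) + (gen x * gen y - gen y * gen x) \<in> qv.span rels"
      using step(2) by (intro qv.span_add qv.span_scale)
    then show ?case
      by (simp add: gen_add gen_scaleq algebra_simps scaleq_mult_left scaleq_mult_right
          qv.scale_right_diff_distrib)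
  qed
  then show "{gen x * gen y - gen y * gen x | x y :: 'y. True} \<subseteq> qv.span rels" by blast
qed


section \<open>The braided symmetric algebra\<close>

text \<open>The rank of an element counts the elements of \<open>B\<close> below or equal to
  it.\<close>

lemma linear_order_rank:
  assumes fin: "finite B" and lin: "linear_order_on B r"
  obtains rk :: "'a \<Rightarrow> nat" where "inj_on rk B"
    "\<And>x y. x \<in> B \<Longrightarrow> y \<in> B \<Longrightarrow> (x, y) \<in> r \<longleftrightarrow> rk x \<le> rk y"
proof -
  define rk where "rk x = card {z \<in> B. (z, x) \<in> r}" for x
  have r: "trans r" "antisym r" "total_on B r" "refl_on B r"
    using lin unfolding linear_order_on_def partial_order_on_def preorder_on_def by blast+
  have less: "rk x < rk y" if "x \<in> B" "y \<in> B" "(x, y) \<in> r" "x \<noteq> y" for x y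
    unfolding rk_def
  proof (rule psubset_card_mono)
    have "(y, y) \<in> r" using r(4) that(2) by (rule refl_onD)
    moreover have "(y, x) \<notin> r" using r(2) that(3,4) by (meson antisymD)
    moreover have "{z \<in> B. (z, x) \<in> r} \<subseteq> {z \<in> B. (z, y) \<in> r}" using r(1) that(3) by (blast dest: transD)
    ultimately show "{z \<in> B. (z, x) \<in> r} \<subset> {z \<in> B. (z, y) \<in> r}" using that(2) by blast
  qed (use fin in simp)
  have tot: "(x, y) \<in> r \<or> (y, x) \<in> r" if "x \<in> B" "y \<in> B" "x \<noteq> y" for x y
    using r(3) that unfolding total_on_def by blast
  show ?thesis
  proof (rule that[of rk])
    show "inj_on rk B"
    proof (rule inj_onI, rule ccontr)
      fix x y assume "x \<in> B" "y \<in> B" "rk x = rk y" "x \<noteq> y"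
      then show False using tot[of x y] less[of x y] less[of y x] by auto
    qed
    show "(x, y) \<in> r \<longleftrightarrow> rk x \<le> rk y" if "x \<in> B" "y \<in> B" for x y
    proof (cases "x = y")
      case True
      then show ?thesis using refl_onD[OF r(4) that(1)] by simp
    next
      case False
      then show ?thesis using tot[OF that False] less[of x y] less[of y x] that by fastforce
    qed
  qed
qed

text \<open>The maps \<Psi> \<otimes> 1 and 1 \<otimes> \<Psi> are determined on the third tensor
  power by their values on products of three generators. The witnesses of the braid equation
  therefore agree there with \<open>act 0\<close> and \<open>act 1\<close>, which preserve that
  space.\<close>

lemma (in quadratic) braid_equation_act:
  assumes "braid_equation \<Psi>" and t: "t \<in> tpow 3"
  shows "act 0 (act 1 (act 0 t)) = act 1 (act 0 (act 1 t))"
proof -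
  obtain F G where F: "acts_on_12 \<Psi> F" and G: "acts_on_23 \<Psi> G"
    and FG: "\<And>t. t \<in> tpow 3 \<Longrightarrow> F (G (F t)) = G (F (G t))"
    using assms(1) unfolding braid_equation_def by blast
  have sub: "monomial ` words_of_length 3 \<subseteq> tpow 3"
    unfolding tpow_eq_span by (rule qv.span_superset)
  have w3: "\<exists>a b c. s = (gen a * gen b) * gen c" if "s \<in> monomial ` words_of_length 3" for s :: "'y tensor_algebra"
  proof -
    from that obtain w where w: "s = monomial w" "w \<in> words_of_length 3" by blast
    then obtain a b c where "w = [a, b, c]"
      by (auto simp: words_of_length_iff numeral_3_eq_3 length_Suc_conv)
    then show ?thesis using w(1) by (intro exI[of _ a] exI[of _ b] exI[of _ c]) (simp add: mult.assoc)
  qed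
  have 1: "F x = act 0 x" if "x \<in> tpow 3" for x
  proof (rule linear_map_on_eq[where F = F and G = "act 0", OF _ _ subspace_tpow sub])
    show "linear_map_on (tpow 3) F" "linear_map_on (tpow 3) (act 0)"
      using F acts_on_12_act unfolding acts_on_12_def by blast+
    show "x \<in> qv.span (monomial ` words_of_length 3)" using that by (simp only: tpow_eq_span)
    fix s :: "'y tensor_algebra" assume "s \<in> monomial ` words_of_length 3"
    then obtain a b c where s: "s = (gen a * gen b) * gen c" using w3 by blast
    show "F s = act 0 s"
      unfolding s using F acts_on_12_act unfolding acts_on_12_def by (simp add: gen_gen_tpow)
  qed
  have 2: "G x = act 1 x" if "x \<in> tpow 3" for x
  proof (rule linear_map_on_eq[where F = G and G = "act 1", OF _ _ subspace_tpow sub])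
    show "linear_map_on (tpow 3) G" "linear_map_on (tpow 3) (act 1)"
      using G acts_on_23_act unfolding acts_on_23_def by blast+
    show "x \<in> qv.span (monomial ` words_of_length 3)" using that by (simp only: tpow_eq_span)
    fix s :: "'y tensor_algebra" assume "s \<in> monomial ` words_of_length 3"
    then obtain a b c where "s = (gen a * gen b) * gen c" using w3 by blast
    then have s: "s = gen a * (gen b * gen c)" by (simp only: mult.assoc)
    show "G s = act 1 s"
      unfolding s using G acts_on_23_act unfolding acts_on_23_def by (simp add: gen_gen_tpow)
  qed
  show ?thesis using FG[OF t] by (simp only: 1 2 act_tpow t)
qed

text \<open>The matrix condition speaks of words of length two only; all other coordinates of the
  difference vanish because it is homogeneous of degree two.\<close>

lemma (in quadratic) specializes_to_flip_maxspan:
  assumes "specializes_to_flip B \<Psi>" and xy: "x \<in> B" "y \<in> B"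
  shows "\<Psi> (gen x * gen y) - gen y * gen x \<in> maxspan (monomial ` words)"
  unfolding maxspan_words_iff
proof
  fix w
  let ?t = "\<Psi> (gen x * gen y)"
  have t2: "?t \<in> tpow 2" by (intro into gen_gen_tpow)
  have m: "coord B w (gen y * gen x) = (if w = [y, x] then 1 else 0)"
    using coord_monomial[of "[y, x]" w] xy by simp
  show "regular_at_1 (coord B w (?t - gen y * gen x)) \<and> value_at_1 (coord B w (?t - gen y * gen x)) = 0"
  proof (cases "w \<in> words_of_length 2")
    case True
    then obtain c c' where w: "w = [c, c']" "c \<in> B" "c' \<in> B"
      by (auto simp: words_of_length_iff numeral_2_eq_2 length_Suc_conv)
    have e: "tensor_coeff B ?t (c, c') = coord B w ?t"
      using tensor_coeff_eq_coord[OF t2, of "(c, c')"] w by simp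
    have r: "regular_at_1 (coord B w ?t)" "value_at_1 (coord B w ?t) = (if (c, c') = (y, x) then 1 else 0)"
      using assms(1) xy w(2,3) unfolding specializes_to_flip_def specializable_def specialization_def e[symmetric]
      by auto
    show ?thesis
      unfolding coord_diff m using r w(1)
      by (auto simp: value_at_1_diff regular_diff)
  next
    case False
    then have "w \<noteq> [y, x]" using xy by (auto simp: words_of_length_iff)
    then show ?thesis by (simp add: coord_diff m coord_tpow[OF t2 False])
  qed
qed

theorem theorem1p11:
  fixes \<Psi> :: "'y::cq_vector_space tensor_algebra \<Rightarrow> 'y tensor_algebra"
  assumes finite_dim: "\<exists>B :: 'y set. finite B \<and> qv.span B = UNIV"
    and linear: "linear_map_on (tpow 2) \<Psi>"
    and invertible: "bij_betw \<Psi> (tpow 2) (tpow 2)"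
    and braid: "braid_equation \<Psi>"
    and specialization: "\<exists>B. is_basis B \<and> specializes_to_flip B \<Psi>"
    and dim_relations: "quotient_has_dim exterior_square_kernel (tpow 2 :: 'y tensor_algebra set)
                          (qv.dim (relations \<Psi>))"
  shows "\<forall>B. is_basis B \<and> specializes_to_flip B \<Psi> \<longrightarrow>
           flat_deformation B \<Psi> \<and>
           (\<forall>r. linear_order_on B r \<longrightarrow> pbw (braided_ideal \<Psi>) B r)"
proof (intro allI impI, elim conjE)
  fix B :: "'y set" assume B: "is_basis B" and flip: "specializes_to_flip B \<Psi>"
  obtain C :: "'y set" where C: "finite C" "qv.span C = UNIV" using finite_dim by blast
  have fin: "finite B"
    using qv.independent_span_bound[OF C(1), of B] B C(2) by (auto simp: is_basis_def)
  interpret quadratic B \<Psi>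
  proof
    show "is_basis B" by (rule B)
    show "linear_map_on (tpow 2) \<Psi>" by (rule linear)
    show "\<Psi> t \<in> tpow 2" if "t \<in> tpow 2" for t by (rule bij_betwE[OF invertible, rule_format, OF that])
  qed
  have flip_rk: "flip_quadratic B \<Psi> rk" if "inj_on rk B" for rk
    by unfold_locales (fact fin, fact that, rule specializes_to_flip_maxspan[OF flip])
  have flat: "flat_quadratic B \<Psi> rk" if rk: "inj_on rk B" for rk
  proof -
    interpret flip_quadratic B \<Psi> rk by (rule flip_rk[OF rk])
    show ?thesis
      by unfold_locales (rule braid_equation_act[OF braid], assumption, rule invariant_lift[OF dim_relations])
  qed
  have flat_def: "flat_deformation B \<Psi>"
  proof -
    \<comment> \<open>Any ranking will do, since the dimensions of the components do not refer to an
      order.\<close>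
    obtain rk :: "'y \<Rightarrow> nat" where rk: "inj_on rk B"
      using finite_imp_inj_to_nat_seg[OF fin] by blast
    interpret f: flat_quadratic B \<Psi> rk by (rule flat[OF rk])
    \<comment> \<open>With the same ranking for the flip, both quotients have bases indexed by the
      same sorted words.\<close>
    interpret g: flat_quadratic B flip_map rk by (rule flip_map_flat[OF fin rk])
    have "(symmetric_ideal :: 'y tensor_algebra set) = qv.span g.rels"
      by (rule g.symmetric_ideal_eq_span) (rule flip_map_pair)
    then have "quotient_has_dim symmetric_ideal (tpow k :: 'y tensor_algebra set)
        (card (g.sorted_words_of_length k))" for k
      using g.component_has_dim[of k] by (simp only:)
    moreover have "quotient_has_dim (braided_ideal \<Psi>) (tpow k) (card (g.sorted_words_of_length k))" for k
      using f.component_has_dim[of k]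
      by (simp only: braided_ideal_eq_span f.sorted_words_of_length_def g.sorted_words_of_length_def)
    ultimately show ?thesis
      unfolding flat_deformation_def using f.relations_specialize[OF dim_relations] by blast
  qed
  have "pbw (braided_ideal \<Psi>) B r" if r: "linear_order_on B r" for r
  proof -
    obtain rk :: "'y \<Rightarrow> nat" where rk: "inj_on rk B"
      "\<And>x y. x \<in> B \<Longrightarrow> y \<in> B \<Longrightarrow> (x, y) \<in> r \<longleftrightarrow> rk x \<le> rk y"
      using fin r by (rule linear_order_rank) (rule that)
    interpret f: flat_quadratic B \<Psi> rk by (rule flat[OF rk(1)])
    \<comment> \<open>Restricted to letters of \<open>B\<close>, where the given order and the order
      of the ranks agree.\<close>
    have "sorted_wrt (\<lambda>x y. (x, y) \<in> r) w \<longleftrightarrow> sorted (map rk w)" if "set w \<subseteq> B" for w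
      unfolding sorted_map using that rk(2)
      by (induction w) auto
    then have "{w. set w \<subseteq> B \<and> sorted_wrt (\<lambda>x y. (x, y) \<in> r) w} = f.sorted_words"
      by (auto simp: f.sorted_words_def words_def)
    then show ?thesis
      unfolding pbw_def using f.sorted_basis by (simp only: braided_ideal_eq_span)
  qed
  then show "flat_deformation B \<Psi> \<and> (\<forall>r. linear_order_on B r \<longrightarrow> pbw (braided_ideal \<Psi>) B r)"
    using flat_def by blast
qed

end
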